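(* Let $n\ge 3$ and let $\Omega\subset\mathbb{R}^n$ be a bounded domain with smooth boundary containing the origin. Let $u$ be a positive solution to either the exterior problem $$-\Delta u=0\ \text{ in }\mathbb{R}^n\setminus\overline\Omega,\qquad u=1\ \text{ on }\partial\Omega,\qquad u(x)\to 0\ \text{ as }|x|\to\infty ,$$ or the interior problem $$-\Delta u=d\,|\partial\Omega|\,\delta_0\ \text{ in }\Omega,\qquad u=c\ \text{ on }\partial\Omega,$$ for some given $d>0$ and $c\in\mathbb{R}$. Suppose that $u$ satisfies $$\frac{H}{n-1}\ge\frac{|Du|}{(n-2)\,u}\ \text{ on }\{u=a\}\qquad\text{and}\qquad\frac{H}{n-1}\le\frac{|Du|}{(n-2)\,u}\ \text{ on }\{u=b\},$$ for some $0<a<b$ such that $\{u=a\}$ and $\{u=b\}$ are regular level sets. Suppose that either $\{u=a\}$ or $\{u=b\}$ is connected. Then $\Omega$ is a ball and $u$ is rotationally symmetric.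
   Context: $D$ and $\Delta$ are the Euclidean gradient and Laplacian; $|\partial\Omega|$ is the $(n-1)$-dimensional area of $\partial\Omega$. In the interior problem, $\delta_0$ is the Dirac distribution at the origin and the equation is understood in the sense of distributions. Set $M=\mathbb{R}^n\setminus\Omega$ for the exterior problem and $M=\overline\Omega\setminus\{0\}$ for the interior problem. $\{u=t\}$ denotes $\{x\in M:u(x)=t\}$; it is regular if $Du\ne 0$ at each of its points. $H$ is the mean curvature of the level set with respect to the unit normal $\nu=-Du/|Du|$: the sum of the $n-1$ principal curvatures (not their average), with the sign convention that a round sphere with its outward normal has positive mean curvature; $H=D^2u(\nu,\nu)/|Du|$. Rotationally symmetric means depending only on the distance to the center of the ball $\Omega$.
   Formalization: In the exterior problem the complement of the closure of Ω is assumed connected, and both level sets {u=a}, {u=b} are assumed non-empty; the claim fails without either. Positivity of u is read on all of M, including ∂Ω. *)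

theory Defs
  imports "HOL-Analysis.Analysis"
begin

text \<open>
  All derivatives are taken within a set \<open>S\<close>, so that they also make sense at those points of a
  closed region \<open>S\<close> with smooth boundary that lie on the boundary, where they are the continuous
  extensions of the derivatives in the interior.  At interior points of \<open>S\<close> they are the usual ones.
\<close>

definition pd :: "'a::euclidean_space set \<Rightarrow> 'a \<Rightarrow> ('a \<Rightarrow> real) \<Rightarrow> 'a \<Rightarrow> real" where
  "pd S i f x = frechet_derivative f (at x within S) i"

definition grad :: "'a::euclidean_space set \<Rightarrow> ('a \<Rightarrow> real) \<Rightarrow> 'a \<Rightarrow> 'a" where
  "grad S f x = (\<Sum>i\<in>Basis. pd S i f x *\<^sub>R i)"

definition laplacian :: "'a::euclidean_space set \<Rightarrow> ('a \<Rightarrow> real) \<Rightarrow> 'a \<Rightarrow> real" where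
  "laplacian S f x = (\<Sum>i\<in>Basis. pd S i (pd S i f) x)"

primrec Ck_on :: "nat \<Rightarrow> 'a::euclidean_space set \<Rightarrow> ('a \<Rightarrow> real) \<Rightarrow> bool" where
  "Ck_on 0 S f \<longleftrightarrow> continuous_on S f"
| "Ck_on (Suc k) S f \<longleftrightarrow> f differentiable_on S \<and> (\<forall>i\<in>Basis. Ck_on k S (pd S i f))"

definition smooth_on :: "'a::euclidean_space set \<Rightarrow> ('a \<Rightarrow> real) \<Rightarrow> bool" where
  "smooth_on S f \<longleftrightarrow> (\<forall>k. Ck_on k S f)"

text \<open>
  Smooth boundary: near each boundary point, \<open>\<Omega>\<close> is one side of a regular level set of a smooth
  function, so that \<open>\<Omega>\<close> lies locally on one side of its boundary.
\<close>

definition smooth_boundary :: "'a::euclidean_space set \<Rightarrow> bool" where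
  "smooth_boundary \<Omega> \<longleftrightarrow>
     (\<forall>p\<in>frontier \<Omega>. \<exists>U \<phi>. open U \<and> p \<in> U \<and> smooth_on U \<phi> \<and>
        (\<forall>x\<in>U. grad U \<phi> x \<noteq> 0) \<and>
        \<Omega> \<inter> U = {x \<in> U. \<phi> x < 0} \<and> frontier \<Omega> \<inter> U = {x \<in> U. \<phi> x = 0})"

text \<open>
  Hausdorff measure, normalised by the volume of the unit ball so that on hypersurfaces the
  measure of dimension \<open>n - 1\<close> is the usual area.
\<close>

definition hausdorff_premeasure :: "real \<Rightarrow> real \<Rightarrow> 'a::euclidean_space set \<Rightarrow> ennreal" where
  "hausdorff_premeasure s \<delta> A =
     (INF C \<in> {C :: nat \<Rightarrow> 'a set. A \<subseteq> (\<Union>i. C i) \<and> (\<forall>i. bounded (C i) \<and> diameter (C i) \<le> \<delta>)}.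
        \<Sum>i. ennreal (unit_ball_vol s * (diameter (C i) / 2) powr s))"

definition hausdorff_measure :: "real \<Rightarrow> 'a::euclidean_space set \<Rightarrow> ennreal" where
  "hausdorff_measure s A = (SUP \<delta>\<in>{0<..}. hausdorff_premeasure s \<delta> A)"

definition boundary_area :: "'a::euclidean_space set \<Rightarrow> real" where
  "boundary_area \<Omega> = enn2real (hausdorff_measure (real DIM('a) - 1) (frontier \<Omega>))"

definition test_function :: "'a::euclidean_space set \<Rightarrow> ('a \<Rightarrow> real) \<Rightarrow> bool" where
  "test_function \<Omega> \<phi> \<longleftrightarrow>
     smooth_on UNIV \<phi> \<and> compact (closure {x. \<phi> x \<noteq> 0}) \<and> closure {x. \<phi> x \<noteq> 0} \<subseteq> \<Omega>"

text \<open>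
  Solutions are classical up to the boundary: \<open>u\<close> is of class \<open>C\<^sup>2\<close> on the region on which it is
  considered (including \<open>\<partial>\<Omega>\<close>), so that gradient and mean curvature of a level set are meaningful
  also where the level set meets \<open>\<partial>\<Omega>\<close>.  As \<open>\<partial>\<Omega>\<close> is smooth, elliptic regularity provides this.
\<close>

definition exterior_problem :: "'a::euclidean_space set \<Rightarrow> ('a \<Rightarrow> real) \<Rightarrow> bool" where
  "exterior_problem \<Omega> u \<longleftrightarrow>
     Ck_on 2 (- \<Omega>) u \<and>
     (\<forall>x \<in> - closure \<Omega>. - laplacian (- \<Omega>) u x = 0) \<and>
     (\<forall>x \<in> frontier \<Omega>. u x = 1) \<and>
     (u \<longlongrightarrow> 0) at_infinity"

text \<open>
  The value of \<open>u\<close> at the origin, where the solution is singular, is irrelevant.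
\<close>

definition interior_problem ::
    "real \<Rightarrow> real \<Rightarrow> 'a::euclidean_space set \<Rightarrow> ('a \<Rightarrow> real) \<Rightarrow> bool" where
  "interior_problem d c \<Omega> u \<longleftrightarrow>
     Ck_on 2 (closure \<Omega> - {0}) u \<and>
     (\<forall>K. compact K \<and> K \<subseteq> \<Omega> \<longrightarrow> set_integrable lborel K u) \<and>
     (\<forall>\<phi>. test_function \<Omega> \<phi> \<longrightarrow>
        - (LINT x:\<Omega>|lborel. u x * laplacian UNIV \<phi> x) = d * boundary_area \<Omega> * \<phi> 0) \<and>
     (\<forall>x \<in> frontier \<Omega>. u x = c)"

definition level_set :: "'a set \<Rightarrow> ('a \<Rightarrow> real) \<Rightarrow> real \<Rightarrow> 'a set" where
  "level_set M u t = {x \<in> M. u x = t}"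

text \<open>
  A level set in the range of \<open>u\<close>, i.e. a nonempty one, without critical points.
\<close>

definition regular_level_set :: "'a::euclidean_space set \<Rightarrow> ('a \<Rightarrow> real) \<Rightarrow> real \<Rightarrow> bool" where
  "regular_level_set M u t \<longleftrightarrow>
     level_set M u t \<noteq> {} \<and> (\<forall>x \<in> level_set M u t. grad M u x \<noteq> 0)"

definition unit_normal :: "'a::euclidean_space set \<Rightarrow> ('a \<Rightarrow> real) \<Rightarrow> 'a \<Rightarrow> 'a" where
  "unit_normal M u x = - (grad M u x /\<^sub>R norm (grad M u x))"

text \<open>
  With the sign convention that a round sphere with outward normal has positive curvatures, the
  shape operator is the differential of the unit normal, restricted to the tangent space.
\<close>

definition shape_operator :: "'a::euclidean_space set \<Rightarrow> ('a \<Rightarrow> real) \<Rightarrow> 'a \<Rightarrow> 'a \<Rightarrow> 'a" where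
  "shape_operator M u x = frechet_derivative (unit_normal M u) (at x within M)"

text \<open>
  \<open>E\<close> is an orthonormal basis of principal directions of the level set of \<open>u\<close> through \<open>x\<close>, and
  \<open>\<kappa> e\<close> is the principal curvature in direction \<open>e\<close>.
\<close>

definition principal_frame ::
    "'a::euclidean_space set \<Rightarrow> ('a \<Rightarrow> real) \<Rightarrow> 'a \<Rightarrow> 'a set \<Rightarrow> ('a \<Rightarrow> real) \<Rightarrow> bool" where
  "principal_frame M u x E \<kappa> \<longleftrightarrow>
     pairwise orthogonal E \<and> (\<forall>e\<in>E. norm e = 1) \<and> span E = {v. v \<bullet> unit_normal M u x = 0} \<and>
     (\<forall>e\<in>E. shape_operator M u x e = \<kappa> e *\<^sub>R e)"

text \<open>
  The sum of the principal curvatures does not depend on the frame, being the trace of the shape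
  operator; a frame exists where \<open>u\<close> is \<open>C\<^sup>2\<close> and its gradient does not vanish.
\<close>

definition mean_curvature :: "'a::euclidean_space set \<Rightarrow> ('a \<Rightarrow> real) \<Rightarrow> 'a \<Rightarrow> real" where
  "mean_curvature M u x = (THE h. \<exists>E \<kappa>. principal_frame M u x E \<kappa> \<and> h = (\<Sum>e\<in>E. \<kappa> e))"

end

(*
  The P-function P = |Du|^2 u^(-2(n-1)/(n-2)) of a positive harmonic function satisfies
  lap P + 2 <Du, DP> / u = 2 u^(-2(n-1)/(n-2)) |T|^2 >= 0, where T is, up to a factor, the trace-free Hessian of
  w = u^(-2/(n-2)). The curvature conditions say exactly that the outward normal derivative of P on the boundary of
  {a < u < b} is nonpositive. By the Hopf lemma, the maximum of P over {a <= u <= b} is therefore also attained in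
  the interior, so that P is constant on a ball. (In the interior problem {a <= u <= b} is compact because Harnack's
  inequality on small spheres about the origin forces u to tend to infinity there.) There T = 0, hence w is a multiple of |x - x0|^2, and by unique
  continuation u is a multiple of |x - x0|^(2-n) everywhere. Since u is constant on the boundary of Omega, that
  boundary lies on a sphere about x0.
*)
theory Submission
  imports Defs
begin

section \<open>Partial derivatives and classes of differentiability\<close>

text \<open>Two points shape the proof. A level set may meet the boundary of \<Omega>, where only
  derivatives within \<open>M\<close> make sense. Every such point is therefore reached through a
  ball that lies in the open set where \<open>u\<close> is harmonic and whose sphere passes through
  the point. The directions entering the ball span the space, so they determine derivatives within
  \<open>M\<close> and the direction of the gradient, and Hopf's lemma applies on the ball.
  Regularity of the level sets and smoothness of the boundary supply these balls. At the touching
  point P is only known to be differentiable within \<open>M\<close>, so the conclusion of Hopf's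
  lemma is stated as an estimate along a segment.

  Secondly, averages over spheres are replaced by averages with smooth radial weights, so no surface
  integral occurs. The mean value property, smoothness, derivative estimates, Harnack's inequality
  and unique continuation all come from one family of bumps.

  The exponent of \<open>u\<close> in P is the one for which P is constant when u = |x -
  x0|^(2-n).\<close>

lemma pd_open:
  assumes "open W" "x \<in> W" "W \<subseteq> S"
  shows "pd S i f x = pd UNIV i f x"
  using assms by (metis pd_def at_within_interior interiorI)

lemma grad_open:
  assumes "open W" "x \<in> W" "W \<subseteq> S"
  shows "grad S f x = grad UNIV f x"
  using pd_open[OF assms] by (simp add: grad_def)

lemma has_derivative_grad:
  assumes "f differentiable (at x within S)"
  shows "(f has_derivative (\<lambda>v. grad S f x \<bullet> v)) (at x within S)"
proof -
  let ?D = "frechet_derivative f (at x within S)"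
  have D: "(f has_derivative ?D) (at x within S)"
    using assms frechet_derivative_works by blast
  interpret bounded_linear ?D using D has_derivative_bounded_linear by blast
  have "?D v = grad S f x \<bullet> v" for v
  proof -
    have "?D v = ?D (\<Sum>i\<in>Basis. (v \<bullet> i) *\<^sub>R i)" by (simp add: euclidean_representation)
    also have "\<dots> = (\<Sum>i\<in>Basis. (v \<bullet> i) * ?D i)" by (simp add: sum scaleR)
    also have "\<dots> = grad S f x \<bullet> v"
      by (simp add: grad_def pd_def inner_sum_left inner_sum_right mult.commute inner_commute)
    finally show ?thesis .
  qed
  then have "?D = (\<lambda>v. grad S f x \<bullet> v)" by auto
  with D show ?thesis by simp
qed

lemma pd_eqI:
  assumes "(f has_derivative D) (at x)"
  shows "pd UNIV i f x = D i"
  using frechet_derivative_at[OF assms] by (simp add: pd_def)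

lemma grad_eqI:
  assumes "(f has_derivative (\<lambda>v. g \<bullet> v)) (at x)"
  shows "grad UNIV f x = g"
  by (simp add: grad_def pd_eqI[OF assms] euclidean_representation)

lemma grad_inner_Basis: "i \<in> Basis \<Longrightarrow> grad S f x \<bullet> i = pd S i f x"
  by (simp add: grad_def)

lemma Ck_on_Suc_open:
  assumes "open W"
  shows "Ck_on (Suc k) W f \<longleftrightarrow> (\<forall>x\<in>W. f differentiable (at x)) \<and> (\<forall>i\<in>Basis. Ck_on k W (pd W i f))"
proof -
  have "f differentiable_on W \<longleftrightarrow> (\<forall>x\<in>W. f differentiable (at x))"
    unfolding differentiable_on_def using at_within_open[OF _ assms] by (intro ball_cong) auto
  then show ?thesis by simp
qed

lemma has_derivative_cong_open:
  assumes "open W" "\<And>x. x \<in> W \<Longrightarrow> f x = g x" "x \<in> W"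
  shows "(f has_derivative D) (at x) \<longleftrightarrow> (g has_derivative D) (at x)"
proof -
  have "(f has_derivative D) (at x) \<Longrightarrow> (g has_derivative D) (at x)"
    using has_derivative_transform_within_open[of f D x UNIV W g] assms by blast
  moreover have "(g has_derivative D) (at x) \<Longrightarrow> (f has_derivative D) (at x)"
    using has_derivative_transform_within_open[of g D x UNIV W f] assms by metis
  ultimately show ?thesis by blast
qed

text \<open>Differentiability is not assumed: \<open>frechet_derivative\<close> chooses from the set
  of all derivatives, and this set is the same for both functions.\<close>

lemma pd_cong_open:
  assumes "open W" "\<And>x. x \<in> W \<Longrightarrow> f x = g x" "x \<in> W"
  shows "pd UNIV i f x = pd UNIV i g x"
proof -
  have "(\<lambda>D. (f has_derivative D) (at x)) = (\<lambda>D. (g has_derivative D) (at x))"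
    using has_derivative_cong_open[of W f g x, OF assms] by blast
  then show ?thesis by (simp add: pd_def frechet_derivative_def)
qed

lemma Ck_on_cong:
  assumes "open W" "\<And>x. x \<in> W \<Longrightarrow> f x = g x"
  shows "Ck_on k W f \<longleftrightarrow> Ck_on k W g"
  using assms(2)
proof (induction k arbitrary: f g)
  case 0
  then show ?case unfolding Ck_on.simps by (intro continuous_on_cong) auto
next
  case (Suc k)
  have d: "f differentiable (at x) \<longleftrightarrow> g differentiable (at x)" if "x \<in> W" for x
    unfolding differentiable_def
    using has_derivative_cong_open[of W f g x, OF assms(1) Suc.prems that] by simp
  have "pd W i f x = pd W i g x" if "x \<in> W" for x i
    using pd_cong_open[of W f g x, OF assms(1) Suc.prems that] pd_open[OF assms(1) that order_refl] by metis
  then have "Ck_on k W (pd W i f) \<longleftrightarrow> Ck_on k W (pd W i g)" for i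
    by (intro Suc.IH)
  then show ?case
    unfolding Ck_on_Suc_open[OF assms(1)] using d by blast
qed

lemma Ck_on_open_subset:
  assumes "open V" "V \<subseteq> S" "Ck_on k S f"
  shows "Ck_on k V f"
  using assms(3)
proof (induction k arbitrary: f)
  case 0
  then show ?case using continuous_on_subset[OF _ assms(2), of f] by simp
next
  case (Suc k)
  have "Ck_on k V (pd V i f)" if "i \<in> Basis" for i
  proof -
    have "Ck_on k V (pd S i f)" using Suc.IH Suc.prems that by simp
    moreover have "pd V i f x = pd S i f x" if "x \<in> V" for x
      using pd_open[OF assms(1) that order_refl] pd_open[OF assms(1) that assms(2)] by simp
    ultimately show ?thesis using Ck_on_cong[OF assms(1), of "pd V i f" "pd S i f" k] by blast
  qed
  moreover have "f differentiable_on V"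
    using Suc.prems differentiable_on_subset[OF _ assms(2), of f] by simp
  ultimately show ?case by simp
qed

text \<open>The mean value formula represents a harmonic function as a smooth convolution only near
  one point at a time; this rule glues the local statements.\<close>

lemma Ck_on_local:
  assumes "open W" "\<And>x. x \<in> W \<Longrightarrow> \<exists>V. open V \<and> x \<in> V \<and> V \<subseteq> W \<and> Ck_on k V f"
  shows "Ck_on k W f"
  using assms(2)
proof (induction k arbitrary: f)
  case 0
  have "continuous (at x) f" if x: "x \<in> W" for x
  proof -
    obtain V where V: "open V" "x \<in> V" "continuous_on V f"
      using 0[OF x] unfolding Ck_on.simps by blast
    then show ?thesis using continuous_on_eq_continuous_at[OF V(1)] by blast
  qed
  then show ?case unfolding Ck_on.simps continuous_on_eq_continuous_at[OF assms(1)] by blast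
next
  case (Suc k)
  have d: "f differentiable (at x)" if x: "x \<in> W" for x
  proof -
    obtain V where "open V" "x \<in> V" "Ck_on (Suc k) V f"
      using Suc.prems[OF x] by blast
    then show ?thesis using Ck_on_Suc_open by blast
  qed
  have "Ck_on k W (pd W i f)" if i: "i \<in> Basis" for i
  proof (rule Suc.IH)
    fix x assume "x \<in> W"
    then obtain V where V: "open V" "x \<in> V" "V \<subseteq> W" "Ck_on (Suc k) V f" using Suc.prems by blast
    have "Ck_on k V (pd V i f)" using V(4) i unfolding Ck_on.simps by blast
    moreover have "pd V i f y = pd W i f y" if "y \<in> V" for y
      using pd_open[OF V(1) that order_refl] pd_open[OF V(1) that V(3)] by simp
    ultimately have "Ck_on k V (pd W i f)"
      using Ck_on_cong[OF V(1), of "pd V i f" "pd W i f" k] by blast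
    with V(1-3) show "\<exists>V. open V \<and> x \<in> V \<and> V \<subseteq> W \<and> Ck_on k V (pd W i f)" by blast
  qed
  then show ?case unfolding Ck_on_Suc_open[OF assms(1)] using d by blast
qed

lemma Ck_on_SucD: "Ck_on (Suc k) S f \<Longrightarrow> Ck_on k S f"
proof (induction k arbitrary: f)
  case 0
  then show ?case by (simp add: differentiable_imp_continuous_on)
next
  case (Suc k)
  then have "f differentiable_on S" "\<And>i. i \<in> Basis \<Longrightarrow> Ck_on k S (pd S i f)"
    unfolding Ck_on.simps(2)[of "Suc k"] by blast+
  then show ?case by simp
qed

lemma Ck_on_le: "k \<le> l \<Longrightarrow> Ck_on l S f \<Longrightarrow> Ck_on k S f"
  by (induction rule: inc_induct) (blast dest: Ck_on_SucD)+

lemma Ck_on_imp_continuous_on: "Ck_on k S f \<Longrightarrow> continuous_on S f"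
  using Ck_on_le[of 0 k S f] by simp

lemma Ck_on_imp_differentiable: "open W \<Longrightarrow> Ck_on (Suc k) W f \<Longrightarrow> x \<in> W \<Longrightarrow> f differentiable (at x)"
  using Ck_on_Suc_open by blast

lemma Ck_on_imp_has_derivative:
  assumes "open W" "Ck_on (Suc k) W f" "x \<in> W"
  shows "(f has_derivative (\<lambda>v. grad UNIV f x \<bullet> v)) (at x)"
  using Ck_on_imp_differentiable[OF assms] has_derivative_grad by blast

lemma Ck_on_pd: "open W \<Longrightarrow> Ck_on (Suc k) W f \<Longrightarrow> i \<in> Basis \<Longrightarrow> Ck_on k W (pd UNIV i f)"
  using Ck_on_cong[of W "pd W i f" "pd UNIV i f" k] pd_open[of W _ W i f] by simp

text \<open>An explicit derivative \<open>D\<close> replaces the chosen one, so each closure rule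
  below only needs a derivative formula whose components are again C^k.\<close>

lemma Ck_on_SucI:
  assumes "open W" "\<And>x. x \<in> W \<Longrightarrow> (f has_derivative D x) (at x)"
    "\<And>i. i \<in> Basis \<Longrightarrow> Ck_on k W (\<lambda>x. D x i)"
  shows "Ck_on (Suc k) W f"
proof -
  have "pd W i f x = D x i" if "x \<in> W" for x i
    using pd_open[OF assms(1) that order_refl] pd_eqI[OF assms(2)[OF that]] by simp
  then have "Ck_on k W (pd W i f)" if "i \<in> Basis" for i
    using Ck_on_cong[OF assms(1), of "pd W i f" "\<lambda>x. D x i" k] assms(3)[OF that] by simp
  then show ?thesis unfolding Ck_on_Suc_open[OF assms(1)] using assms(2) differentiable_def by blast
qed

lemma Ck_on_const [simp]: "open W \<Longrightarrow> Ck_on k W (\<lambda>x. c)"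
proof (induction k arbitrary: c)
  case (Suc k)
  show ?case by (rule Ck_on_SucI[where D="\<lambda>x v. 0"]) (use Suc in \<open>auto simp: has_derivative_const\<close>)
qed auto

lemma Ck_on_add:
  assumes "open W" "Ck_on k W f" "Ck_on k W g"
  shows "Ck_on k W (\<lambda>x. f x + g x)"
  using assms(2,3)
proof (induction k arbitrary: f g)
  case 0
  then show ?case by (auto intro: continuous_intros)
next
  case (Suc k)
  show ?case
  proof (rule Ck_on_SucI[OF assms(1)])
    fix x assume "x \<in> W"
    then show "((\<lambda>x. f x + g x) has_derivative (\<lambda>v. grad UNIV f x \<bullet> v + grad UNIV g x \<bullet> v)) (at x)"
      using Suc.prems assms(1) by (intro has_derivative_add Ck_on_imp_has_derivative)
  next
    fix i :: 'a assume "i \<in> Basis"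
    then show "Ck_on k W (\<lambda>x. grad UNIV f x \<bullet> i + grad UNIV g x \<bullet> i)"
      using Suc assms(1) by (simp add: grad_inner_Basis Ck_on_pd del: Ck_on.simps)
  qed
qed

lemma Ck_on_mult:
  assumes "open W" "Ck_on k W f" "Ck_on k W g"
  shows "Ck_on k W (\<lambda>x. f x * g x)"
  using assms(2,3)
proof (induction k arbitrary: f g)
  case 0
  then show ?case by (auto intro: continuous_intros)
next
  case (Suc k)
  show ?case
  proof (rule Ck_on_SucI[OF assms(1)])
    fix x assume "x \<in> W"
    then show "((\<lambda>x. f x * g x) has_derivative (\<lambda>v. f x * (grad UNIV g x \<bullet> v) + (grad UNIV f x \<bullet> v) * g x)) (at x)"
      using Suc.prems assms(1) by (intro has_derivative_mult Ck_on_imp_has_derivative)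
  next
    fix i :: 'a assume "i \<in> Basis"
    then show "Ck_on k W (\<lambda>x. f x * (grad UNIV g x \<bullet> i) + (grad UNIV f x \<bullet> i) * g x)"
      using Suc.prems assms(1)
      by (simp add: grad_inner_Basis Ck_on_pd Ck_on_add Suc.IH Ck_on_SucD del: Ck_on.simps)
  qed
qed

lemma Ck_on_cmult: "open W \<Longrightarrow> Ck_on k W f \<Longrightarrow> Ck_on k W (\<lambda>x. c * f x)"
  by (rule Ck_on_mult) auto

lemma Ck_on_diff:
  assumes "open W" "Ck_on k W f" "Ck_on k W g"
  shows "Ck_on k W (\<lambda>x. f x - g x)"
  using Ck_on_add[OF assms(1,2) Ck_on_cmult[OF assms(1,3), of "-1"]] by simp

lemma Ck_on_sum:
  assumes "open W" "\<And>i. i \<in> I \<Longrightarrow> Ck_on k W (f i)"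
  shows "Ck_on k W (\<lambda>x. \<Sum>i\<in>I. f i x)"
  using assms(2) by (induction I rule: infinite_finite_induct) (auto intro!: Ck_on_add simp: assms(1))

lemma Ck_on_inner:
  assumes "open W"
  shows "Ck_on k W (\<lambda>x. (x - c) \<bullet> v)"
proof (cases k)
  case 0
  then show ?thesis by (auto intro!: continuous_intros)
next
  case (Suc l)
  show ?thesis unfolding Suc
    by (rule Ck_on_SucI[OF assms, where D="\<lambda>x w. w \<bullet> v"]) (auto intro!: derivative_eq_intros simp: assms)
qed

text \<open>The outer function comes as a sequence \<open>F\<close> in which each member has the
  next as derivative. The induction on \<open>k\<close> can then move from \<open>m\<close> to
  \<open>Suc m\<close>, and no separate notion of smoothness on the real line is required.\<close>

lemma Ck_on_compose_real:
  fixes F :: "nat \<Rightarrow> real \<Rightarrow> real"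
  assumes "open W" "Ck_on k W s"
    and F: "\<And>m x. x \<in> W \<Longrightarrow> (F m has_real_derivative F (Suc m) (s x)) (at (s x))"
  shows "Ck_on k W (\<lambda>x. F m (s x))"
  using assms(2)
proof (induction k arbitrary: m)
  case 0
  have "continuous_on (s ` W) (F m)"
    using DERIV_isCont[OF F] by (auto intro!: continuous_at_imp_continuous_on)
  then show ?case using 0 continuous_on_compose2[of "s ` W" "F m" W s] by auto
next
  case (Suc k)
  show ?case
  proof (rule Ck_on_SucI[OF assms(1)])
    fix x assume x: "x \<in> W"
    show "((\<lambda>x. F m (s x)) has_derivative (\<lambda>v. F (Suc m) (s x) * (grad UNIV s x \<bullet> v))) (at x)"
      using has_derivative_compose[OF Ck_on_imp_has_derivative[OF assms(1) Suc.prems x]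
          F[OF x, of m, unfolded has_field_derivative_def]] by simp
  next
    fix i :: 'a assume i: "i \<in> Basis"
    show "Ck_on k W (\<lambda>x. F (Suc m) (s x) * (grad UNIV s x \<bullet> i))"
      using Suc.prems assms(1) i
      by (simp add: grad_inner_Basis Ck_on_pd Ck_on_mult Suc.IH Ck_on_SucD del: Ck_on.simps)
  qed
qed

section \<open>A smooth bump\<close>

text \<open>Dividing exp(-1/t) by t^m makes the family closed under differentiation up to linear
  combinations; \<open>m = 0\<close> is the usual smooth function that is flat at 0.\<close>

definition bump :: "nat \<Rightarrow> real \<Rightarrow> real" where
  "bump m t = (if t \<le> 0 then 0 else exp (- 1 / t) / t ^ m)"

lemma bump_nonneg: "bump m t \<ge> 0"
  by (simp add: bump_def)

lemma bump_pos: "t > 0 \<Longrightarrow> bump m t > 0"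
  by (simp add: bump_def)

lemma bump_nonpos: "t \<le> 0 \<Longrightarrow> bump m t = 0"
  by (simp add: bump_def)

text \<open>A single term of the series of exp(1/t), the one of degree \<open>Suc m\<close>, already
  dominates t^(-m-1). The bound forces \<open>bump m\<close> to tend to 0 at 0.\<close>

lemma bump_le: "\<bar>bump m t\<bar> \<le> fact (Suc m) * \<bar>t\<bar>"
proof (cases "t \<le> 0")
  case False
  then have t: "t > 0" by simp
  have "(1 / t) ^ Suc m / fact (Suc m) \<le> exp (1 / t)"
  proof -
    have s: "(\<lambda>n. (1 / t) ^ n /\<^sub>R fact n) sums exp (1 / t)" by (rule exp_converges)
    have "(\<Sum>n\<in>{Suc m}. (1 / t) ^ n /\<^sub>R fact n) \<le> (\<Sum>n. (1 / t) ^ n /\<^sub>R fact n)"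
      by (rule sum_le_suminf) (use s t in \<open>auto simp: sums_iff\<close>)
    then show ?thesis using s by (simp add: sums_iff divide_inverse mult.commute)
  qed
  then have "1 / fact (Suc m) \<le> exp (1 / t) * t ^ Suc m"
    using t by (simp add: field_simps power_divide del: fact_Suc)
  then have "1 \<le> fact (Suc m) * t * (exp (1 / t) * t ^ m)"
    by (simp add: field_simps del: fact_Suc)
  then have "exp (- 1 / t) / t ^ m \<le> fact (Suc m) * t"
    using t by (simp add: exp_minus field_simps del: fact_Suc)
  then show ?thesis using t by (simp add: bump_def del: fact_Suc)
qed (simp add: bump_def mult_nonneg_nonpos del: fact_Suc)

lemma bump_deriv: "(bump m has_real_derivative bump (m + 2) t - m * bump (m + 1) t) (at t)"
proof -
  consider "t < 0" | "t = 0" | "t > 0" by linarith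
  then show ?thesis
  proof cases
    case 1
    have "((\<lambda>_. 0) has_real_derivative 0) (at t)" by simp
    then have "(bump m has_real_derivative 0) (at t)"
      by (rule has_field_derivative_transform_within_open[where S="{..<0}"])
        (use 1 in \<open>auto simp: bump_def\<close>)
    then show ?thesis using 1 by (simp add: bump_def)
  next
    case 3
    have "((\<lambda>t. exp (- 1 / t) / t ^ m) has_real_derivative
       (exp (- 1 / t) * (1 / t^2) * t ^ m - exp (- 1 / t) * (m * t ^ (m - 1))) / (t ^ m * t ^ m)) (at t)"
      using 3 by (auto intro!: derivative_eq_intros simp: power2_eq_square)
    moreover have "(exp (- 1 / t) * (1 / t^2) * t ^ m - exp (- 1 / t) * (m * t ^ (m - 1))) / (t ^ m * t ^ m)
       = bump (m + 2) t - m * bump (m + 1) t"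
      using 3 by (cases m) (auto simp: bump_def field_simps power2_eq_square)
    ultimately have "((\<lambda>t. exp (- 1 / t) / t ^ m) has_real_derivative bump (m + 2) t - m * bump (m + 1) t) (at t)"
      by simp
    then show ?thesis
      by (rule has_field_derivative_transform_within_open[where S="{0<..}"])
        (use 3 in \<open>auto simp: bump_def\<close>)
  next
    case 2
    have "((\<lambda>h. fact (Suc (Suc m)) * \<bar>h\<bar>) \<longlongrightarrow> 0) (at (0::real))"
      by (auto intro!: tendsto_eq_intros)
    then have "((\<lambda>h. bump (Suc m) h) \<longlongrightarrow> 0) (at 0)"
      by (rule Lim_null_comparison[rotated]) (use bump_le in \<open>auto simp del: fact_Suc\<close>)
    \<comment> \<open>At 0 the difference quotient of \<open>bump m\<close> is
      \<open>bump (Suc m) h\<close>, on both sides.\<close>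
    then have "((\<lambda>h. (bump m (0 + h) - bump m 0) / h) \<longlongrightarrow> 0) (at 0)"
      by (rule Lim_transform_eventually) (auto simp: bump_def eventually_at_filter field_simps)
    then show ?thesis using 2 by (simp add: DERIV_def bump_def)
  qed
qed

lemma bump_deriv_within [derivative_intros]:
  "(f has_real_derivative f') (at x within S) \<Longrightarrow>
    ((\<lambda>x. bump m (f x)) has_real_derivative (bump (m + 2) (f x) - m * bump (m + 1) (f x)) * f') (at x within S)"
  using DERIV_chain2[OF bump_deriv] by blast

lemma continuous_on_bump [continuous_intros]: "continuous_on S f \<Longrightarrow> continuous_on S (\<lambda>x. bump m (f x))"
  by (rule continuous_on_compose2[where t=UNIV and g="bump m"])
    (auto intro!: continuous_at_imp_continuous_on DERIV_isCont bump_deriv)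

text \<open>A radial bump that vanishes outside \<open>cball c r\<close>; squaring the norm keeps it
  smooth at the center.\<close>

definition bump_fn :: "nat \<Rightarrow> 'a::euclidean_space \<Rightarrow> real \<Rightarrow> 'a \<Rightarrow> real" where
  "bump_fn m c r x = bump m (1 - (norm (x - c) / r)\<^sup>2)"

lemma has_derivative_bump_fn:
  assumes "r > 0"
  shows "(bump_fn m c r has_derivative (\<lambda>v. (bump_fn (m + 2) c r x - m * bump_fn (m + 1) c r x) *
     (- 2 / r\<^sup>2 * ((x - c) \<bullet> v)))) (at x)"
proof -
  have e: "(norm (x - c) / r)\<^sup>2 = ((x - c) \<bullet> (x - c)) / r\<^sup>2" for x :: 'a
    by (simp add: power_divide power2_norm_eq_inner)
  have "((\<lambda>x. 1 - (norm (x - c) / r)\<^sup>2) has_derivative (\<lambda>v. - 2 / r\<^sup>2 * ((x - c) \<bullet> v))) (at x)"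
    unfolding e using assms
    by (auto intro!: derivative_eq_intros simp: field_simps inner_commute)
  from has_derivative_compose[OF this bump_deriv[unfolded has_field_derivative_def]]
  show ?thesis by (simp add: bump_fn_def[abs_def])
qed

lemma Ck_on_bump_fn:
  assumes "r > 0"
  shows "Ck_on k UNIV (bump_fn m c r)"
proof (induction k arbitrary: m)
  case 0
  then show ?case using assms by (auto intro!: continuous_intros simp: bump_fn_def[abs_def])
next
  case (Suc k)
  show ?case
  proof (rule Ck_on_SucI[OF open_UNIV has_derivative_bump_fn[OF assms]])
    fix i :: 'a
    show "Ck_on k UNIV (\<lambda>x. (bump_fn (m + 2) c r x - real m * bump_fn (m + 1) c r x) * (- 2 / r\<^sup>2 * ((x - c) \<bullet> i)))"
      by (intro Ck_on_mult Ck_on_diff Ck_on_cmult Suc Ck_on_inner open_UNIV)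
        simp
  qed
qed

lemma bump_fn_nonneg: "bump_fn m c r x \<ge> 0"
  by (simp add: bump_fn_def bump_nonneg)

lemma bump_fn_eq_0:
  assumes "r > 0" "dist c x \<ge> r"
  shows "bump_fn m c r x = 0"
proof -
  have "norm (x - c) / r \<ge> 1" using assms by (simp add: dist_norm norm_minus_commute)
  then have "(norm (x - c) / r)\<^sup>2 \<ge> 1" by (rule one_le_power)
  then show ?thesis by (simp add: bump_fn_def bump_nonpos)
qed

lemma bump_fn_pos:
  assumes "r > 0" "dist c x < r"
  shows "bump_fn m c r x > 0"
proof -
  have "norm (x - c) / r < 1" using assms by (simp add: dist_norm norm_minus_commute)
  then have "(norm (x - c) / r)\<^sup>2 < 1" using assms(1) by (simp add: power_less_one_iff abs_square_less_1)
  then show ?thesis by (simp add: bump_fn_def bump_pos)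
qed

section \<open>Compactly supported integrands\<close>

text \<open>\<open>f\<close> is controlled on \<open>W\<close> only, but the kernel vanishes off the
  closed set \<open>S\<close> inside \<open>W\<close>. The open sets \<open>W\<close> and
  \<open>- S\<close> cover the space, and the product is continuous on each. The parameter set
  \<open>T\<close> is there for differentiation under the integral sign.\<close>

lemma continuous_on_supported_product:
  fixes f :: "'a::euclidean_space \<Rightarrow> real" and K :: "'b::metric_space \<Rightarrow> 'a \<Rightarrow> 'c::real_normed_vector"
  assumes W: "open W" "continuous_on W f" and S: "closed S" "S \<subseteq> W"
    and K: "continuous_on (T \<times> UNIV) (\<lambda>p. K (fst p) (snd p))"
    and 0: "\<And>t z. t \<in> T \<Longrightarrow> z \<notin> S \<Longrightarrow> K t z = 0"
  shows "continuous_on (T \<times> UNIV) (\<lambda>p. f (snd p) *\<^sub>R K (fst p) (snd p))"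
proof -
  let ?h = "\<lambda>p. f (snd p) *\<^sub>R K (fst p) (snd p)"
  have 1: "continuous_on (T \<times> W) ?h"
    by (intro continuous_intros continuous_on_compose2[OF W(2)] continuous_on_subset[OF K]) auto
  have "continuous_on (T \<times> (- S)) (\<lambda>p. 0 :: 'c)" by (rule continuous_on_const)
  then have 2: "continuous_on (T \<times> (- S)) ?h"
    by (rule continuous_on_eq) (auto simp: 0)
  have eq: "T \<times> (W \<union> - S) = (T \<times> UNIV :: ('b \<times> 'a) set)" using S(2) by auto
  have o1: "openin (top_of_set (T \<times> UNIV)) (T \<times> W)"
    unfolding openin_open by (rule exI[of _ "UNIV \<times> W"]) (auto simp: W open_Times)
  have o2: "openin (top_of_set (T \<times> UNIV)) (T \<times> (- S))"
    unfolding openin_open by (rule exI[of _ "UNIV \<times> (- S)"]) (use S in \<open>auto intro!: open_Times\<close>)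
  have "continuous_on (T \<times> W \<union> T \<times> (- S)) ?h"
    by (rule continuous_on_Un_local_open) (use o1 o2 1 2 S(2) in \<open>auto simp: Sigma_Un_distrib2[symmetric] eq\<close>)
  then show ?thesis by (simp add: Sigma_Un_distrib2[symmetric] eq)
qed

lemma continuous_on_supported_mult:
  fixes f h :: "'a::euclidean_space \<Rightarrow> real"
  assumes W: "open W" "continuous_on W f" and S: "closed S" "S \<subseteq> W"
    and K: "continuous_on UNIV h"
    and 0: "\<And>z. z \<notin> S \<Longrightarrow> h z = 0"
  shows "continuous_on UNIV (\<lambda>z. f z * h z)"
proof -
  have c: "continuous_on ({0::real} \<times> UNIV) (\<lambda>p. f (snd p) *\<^sub>R h (snd p))"
    by (rule continuous_on_supported_product[OF W S])
      (use 0 in \<open>auto intro!: continuous_on_compose2[OF K] continuous_intros\<close>)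
  have "continuous_on UNIV (\<lambda>z. (0::real, z :: 'a))" by (intro continuous_intros)
  from continuous_on_compose2[OF c this] show ?thesis by (simp add: image_subset_iff)
qed

lemma integral_cbox_eq_UNIV:
  fixes h :: "'a::euclidean_space \<Rightarrow> 'b::banach"
  assumes "\<And>z. z \<notin> S \<Longrightarrow> h z = 0" "S \<subseteq> cbox a b"
  shows "integral (cbox a b) h = integral UNIV h"
proof -
  have "(\<lambda>z. if z \<in> cbox a b then h z else 0) = h"
    using assms by (intro ext) (metis subsetD)
  then show ?thesis using integral_restrict_UNIV[of "cbox a b" h] by simp
qed

lemma integrable_on_supported:
  fixes h :: "'a::euclidean_space \<Rightarrow> 'b::banach"
  assumes "bounded S" "continuous_on UNIV h" "\<And>z. z \<notin> S \<Longrightarrow> h z = 0"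
  shows "h integrable_on UNIV"
proof -
  obtain a where a: "S \<subseteq> cbox (-a) a" using bounded_subset_cbox_symmetric[OF assms(1)] by blast
  have "h integrable_on cbox (-a) a"
    using integrable_continuous continuous_on_subset[OF assms(2)] by blast
  then show ?thesis by (rule integrable_on_superset) (use a assms(3) in auto)
qed

lemma integral_translate:
  fixes h :: "'a::euclidean_space \<Rightarrow> real"
  assumes "bounded S" "\<And>z. z \<notin> S \<Longrightarrow> h z = 0"
  shows "integral UNIV (\<lambda>z. h (c + z)) = integral UNIV h"
proof -
  have "bounded (S \<union> (\<lambda>z. z - c) ` S)"
    using assms(1) bounded_translation[of S "-c"] by (simp add: add.commute)
  then obtain a where a: "S \<union> (\<lambda>z. z - c) ` S \<subseteq> cbox (-a) a"
    using bounded_subset_cbox_symmetric by blast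
  have "z \<notin> cbox (-a) a \<Longrightarrow> h (c + z) = 0" for z
    using a assms(2)[of "c + z"] by (metis UnCI add_diff_cancel_left' image_eqI subsetD)
  then have "integral UNIV (\<lambda>z. h (c + z)) = integral (cbox (-a) a) (\<lambda>z. h (c + z))"
    using integral_cbox_eq_UNIV[of "cbox (-a) a" "\<lambda>z. h (c + z)" "-a" a] by simp
  also have "\<dots> = integral (cbox (-a + c) (a + c)) h"
    using integral_shift_cbox_plus[of "-a" a h c] by (simp add: o_def)
  also have "\<dots> = integral UNIV h"
  proof (rule integral_cbox_eq_UNIV[OF assms(2)])
    show "S \<subseteq> cbox (- a + c) (a + c)"
    proof
      fix z assume "z \<in> S"
      then have "z - c \<in> cbox (-a) a" using a by auto
      then show "z \<in> cbox (- a + c) (a + c)" by (auto simp: mem_box algebra_simps)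
    qed
  qed
  finally show ?thesis .
qed

section \<open>Integration by parts without boundary terms\<close>

lemma has_real_derivative_line:
  assumes "(h has_derivative D) (at (z + t *\<^sub>R e))"
  shows "((\<lambda>t. h (z + t *\<^sub>R e)) has_real_derivative D e) (at t within U)"
proof -
  have lin: "linear D" using assms has_derivative_linear by blast
  have "((\<lambda>t. h (z + t *\<^sub>R e)) has_derivative (\<lambda>s. D (s *\<^sub>R e))) (at t)"
    by (rule has_derivative_compose[where f="\<lambda>t. z + t *\<^sub>R e", OF _ assms])
      (auto intro!: derivative_eq_intros)
  then have "((\<lambda>t. h (z + t *\<^sub>R e)) has_real_derivative D e) (at t)"
    by (simp add: has_field_derivative_def linear_scale[OF lin] mult.commute[of _ "D e"])
  then show ?thesis by (rule has_field_derivative_at_within)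
qed

lemma pd_eq_0_outside:
  assumes "closed S" "\<And>z. z \<notin> S \<Longrightarrow> h z = 0" "z \<notin> S"
  shows "pd UNIV e h z = 0"
proof -
  have "pd UNIV e h z = pd UNIV e (\<lambda>_. 0) z"
    by (rule pd_cong_open[of "- S"]) (use assms in auto)
  then show ?thesis by (simp add: pd_eqI[OF has_derivative_const])
qed

text \<open>The integral of h(z + t e) does not depend on t. Differentiating it at t = 0 under the
  integral sign gives the integral of the partial derivative, which is therefore 0.\<close>

lemma integral_pd_eq_0:
  fixes h :: "'a::euclidean_space \<Rightarrow> real"
  assumes S: "bounded S" "\<And>z. z \<notin> S \<Longrightarrow> h z = 0"
    and d: "\<And>z. h differentiable (at z)" and c: "continuous_on UNIV (pd UNIV e h)"
  shows "integral UNIV (pd UNIV e h) = 0"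
proof -
  have S': "bounded (closure S)" using S(1) by (rule bounded_closure)
  have p0: "pd UNIV e h z = 0" if "z \<notin> closure S" for z
    by (rule pd_eq_0_outside[OF closed_closure _ that]) (use S(2) closure_subset in blast)
  \<comment> \<open>One box has to contain the supports of all translates with parameter in
    \<open>{-1..1}\<close>, so that the domain of integration stays fixed while t varies.\<close>
  have "bounded ((\<lambda>(t, s). s - t *\<^sub>R e) ` ({-1..1} \<times> closure S))"
    using S' by (intro compact_imp_bounded compact_continuous_image compact_Times)
      (auto simp: compact_eq_bounded_closed case_prod_unfold intro!: continuous_intros)
  then obtain a where a: "(\<lambda>(t, s). s - t *\<^sub>R e) ` ({-1..1} \<times> closure S) \<subseteq> cbox (-a) a"
    using bounded_subset_cbox_symmetric by blast
  have out: "z + t *\<^sub>R e \<notin> closure S" if "z \<notin> cbox (-a) a" "t \<in> {-1..1}" for z t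
  proof
    assume "z + t *\<^sub>R e \<in> closure S"
    then have "(\<lambda>(t, s). s - t *\<^sub>R e) (t, z + t *\<^sub>R e) \<in> cbox (-a) a" using a that(2) by blast
    then show False using that(1) by simp
  qed
  let ?F = "\<lambda>t. integral (cbox (-a) a) (\<lambda>z. h (z + t *\<^sub>R e))"
  have hc: "continuous_on UNIV h"
    using d differentiable_imp_continuous_within continuous_on_eq_continuous_within by blast
  have F: "?F t = integral UNIV h" if "t \<in> {-1..1}" for t
  proof -
    have "?F t = integral UNIV (\<lambda>z. h (z + t *\<^sub>R e))"
      by (rule integral_cbox_eq_UNIV[of "cbox (-a) a"]) (use out that S(2) closure_subset in blast)+
    also have "\<dots> = integral UNIV h"
      using integral_translate[of S h "t *\<^sub>R e"] S by (simp add: add.commute)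
    finally show ?thesis .
  qed
  have "(?F has_real_derivative integral (cbox (-a) a) (\<lambda>z. pd UNIV e h (z + 0 *\<^sub>R e))) (at 0 within {-1..1})"
  proof (rule leibniz_rule_field_derivative)
    fix t z
    have "(h has_derivative (\<lambda>v. grad UNIV h (z + t *\<^sub>R e) \<bullet> v)) (at (z + t *\<^sub>R e))"
      by (rule has_derivative_grad[OF d])
    from has_real_derivative_line[OF this] pd_eqI[OF this]
    show "((\<lambda>t. h (z + t *\<^sub>R e)) has_real_derivative pd UNIV e h (z + t *\<^sub>R e)) (at t within {-1..1})"
      by simp
  next
    fix t
    show "(\<lambda>z. h (z + t *\<^sub>R e)) integrable_on cbox (-a) a"
      by (intro integrable_continuous continuous_on_compose2[OF hc]) (auto intro!: continuous_intros)
  next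
    show "continuous_on ({-1..1} \<times> cbox (- a) a) (\<lambda>(t, z). pd UNIV e h (z + t *\<^sub>R e))"
      unfolding case_prod_unfold
      by (intro continuous_on_compose2[OF c]) (auto intro!: continuous_intros)
  qed auto
  then have "(?F has_real_derivative integral (cbox (-a) a) (pd UNIV e h)) (at 0)"
    using at_within_Icc_at[of "-1" "0::real" 1] by simp
  moreover have "(?F has_real_derivative 0) (at 0)"
    by (rule has_field_derivative_transform_within_open[where S="{-1<..<1}" and f="\<lambda>_. integral UNIV h"])
      (use F in auto)
  ultimately have "integral (cbox (-a) a) (pd UNIV e h) = 0" using DERIV_unique by blast
  moreover have "integral (cbox (-a) a) (pd UNIV e h) = integral UNIV (pd UNIV e h)"
    by (rule integral_cbox_eq_UNIV[of "closure S"]) (use p0 out[of _ 0] in \<open>force+\<close>)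
  ultimately show ?thesis by simp
qed

lemma pd_mult:
  assumes "f differentiable (at x)" "g differentiable (at x)"
  shows "pd UNIV i (\<lambda>x. f x * g x) x = f x * pd UNIV i g x + pd UNIV i f x * g x"
  using pd_eqI[OF has_derivative_mult[OF assms[unfolded frechet_derivative_works]], of i]
  by (simp add: pd_def)

lemma pd_add:
  assumes "f differentiable (at x)" "g differentiable (at x)"
  shows "pd UNIV i (\<lambda>x. f x + g x) x = pd UNIV i f x + pd UNIV i g x"
  using pd_eqI[OF has_derivative_add[OF assms[unfolded frechet_derivative_works]], of i]
  by (simp add: pd_def)

lemma pd_cmult:
  assumes "f differentiable (at x)"
  shows "pd UNIV i (\<lambda>x. c * f x) x = c * pd UNIV i f x"
  using pd_mult[of "\<lambda>_. c" x f i] assms by (simp add: pd_eqI[OF has_derivative_const])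

lemma Ck_on_2D:
  assumes "open W" "Ck_on 2 W f"
  shows "x \<in> W \<Longrightarrow> f differentiable (at x)"
    and "x \<in> W \<Longrightarrow> i \<in> Basis \<Longrightarrow> pd UNIV i f differentiable (at x)"
    and "continuous_on W f"
    and "i \<in> Basis \<Longrightarrow> continuous_on W (pd UNIV i f)"
    and "i \<in> Basis \<Longrightarrow> j \<in> Basis \<Longrightarrow> continuous_on W (pd UNIV j (pd UNIV i f))"
proof -
  have 2: "Ck_on (Suc (Suc 0)) W f" using assms(2) by (simp only: numeral_2_eq_2)
  have 1: "Ck_on (Suc 0) W (pd UNIV i f)" if "i \<in> Basis" for i
    using Ck_on_pd[OF assms(1) 2 that] .
  show "x \<in> W \<Longrightarrow> f differentiable (at x)" using Ck_on_imp_differentiable[OF assms(1) 2] .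
  show "x \<in> W \<Longrightarrow> i \<in> Basis \<Longrightarrow> pd UNIV i f differentiable (at x)"
    using Ck_on_imp_differentiable[OF assms(1) 1] .
  show "continuous_on W f" using Ck_on_imp_continuous_on[OF 2] .
  show "i \<in> Basis \<Longrightarrow> continuous_on W (pd UNIV i f)" using Ck_on_imp_continuous_on[OF 1] .
  show "i \<in> Basis \<Longrightarrow> j \<in> Basis \<Longrightarrow> continuous_on W (pd UNIV j (pd UNIV i f))"
    using Ck_on_imp_continuous_on[OF Ck_on_pd[OF assms(1) 1]] .
qed

text \<open>\<open>f\<close> is C^1 on \<open>W\<close> only. The product with \<eta> is
  nevertheless differentiable everywhere: on \<open>W\<close> by the product rule, off
  \<open>S\<close> because it vanishes in a neighbourhood.\<close>

lemma integration_by_parts: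
  fixes f \<eta> :: "'a::euclidean_space \<Rightarrow> real"
  assumes W: "open W" "Ck_on 1 W f" and S: "compact S" "S \<subseteq> W"
    and \<eta>: "Ck_on 1 UNIV \<eta>" "\<And>z. z \<notin> S \<Longrightarrow> \<eta> z = 0" and i: "i \<in> Basis"
  shows "integral UNIV (\<lambda>z. pd UNIV i f z * \<eta> z) = - integral UNIV (\<lambda>z. f z * pd UNIV i \<eta> z)"
proof -
  have f1: "Ck_on (Suc 0) W f" and \<eta>1: "Ck_on (Suc 0) UNIV \<eta>" using W(2) \<eta>(1) by simp_all
  note df = Ck_on_imp_differentiable[OF W(1) f1] and de = Ck_on_imp_differentiable[OF open_UNIV \<eta>1, OF UNIV_I]
  have cS: "closed S" and bS: "bounded S" using S(1) by (auto simp: compact_imp_closed compact_imp_bounded)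
  note e1 = pd_eq_0_outside[OF cS \<eta>(2)]
  have i1: "continuous_on UNIV (\<lambda>z. f z * pd UNIV i \<eta> z)"
    by (rule continuous_on_supported_mult[OF W(1) Ck_on_imp_continuous_on[OF W(2)] cS S(2)
        Ck_on_imp_continuous_on[OF Ck_on_pd[OF open_UNIV \<eta>1 i]] e1])
  have i2: "continuous_on UNIV (\<lambda>z. pd UNIV i f z * \<eta> z)"
    by (rule continuous_on_supported_mult[OF W(1) Ck_on_imp_continuous_on[OF Ck_on_pd[OF W(1) f1 i]] cS S(2)
        Ck_on_imp_continuous_on[OF \<eta>(1)] \<eta>(2)])
  let ?h = "\<lambda>z. f z * \<eta> z"
  have h0: "?h z = 0" if "z \<notin> S" for z using that \<eta>(2) by simp
  have dh: "?h differentiable (at z)" for z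
  proof (cases "z \<in> W")
    case True
    then show ?thesis using df de by (intro differentiable_mult)
  next
    case False
    then have z: "z \<in> - S" using S(2) by auto
    have "(?h has_derivative (\<lambda>_. 0)) (at z)"
      using has_derivative_cong_open[of "-S" ?h "\<lambda>_. 0" z "\<lambda>_. 0"] z h0
        open_Compl[OF cS] has_derivative_const by blast
    then show ?thesis using differentiable_def by blast
  qed
  have ph: "pd UNIV i ?h z = f z * pd UNIV i \<eta> z + pd UNIV i f z * \<eta> z" for z
  proof (cases "z \<in> W")
    case True
    then show ?thesis using df de by (intro pd_mult)
  next
    case False
    then have z: "z \<notin> S" using S(2) by auto
    then show ?thesis using pd_eq_0_outside[of S ?h z i, OF cS h0] e1 \<eta>(2) by simp
  qed
  have "integral UNIV (pd UNIV i ?h) = 0"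
  proof (rule integral_pd_eq_0[OF bS h0 dh])
    show "continuous_on UNIV (pd UNIV i ?h)"
      using continuous_on_add[OF i1 i2] by (simp add: ph[abs_def])
  qed
  moreover have "integral UNIV (pd UNIV i ?h) = integral UNIV (\<lambda>z. f z * pd UNIV i \<eta> z)
     + integral UNIV (\<lambda>z. pd UNIV i f z * \<eta> z)"
    unfolding ph[abs_def]
    by (rule integral_add) (use i1 i2 e1 \<eta>(2) bS in \<open>auto intro!: integrable_on_supported[of S]\<close>)
  ultimately show ?thesis by simp
qed

lemma green:
  fixes f \<eta> :: "'a::euclidean_space \<Rightarrow> real"
  assumes W: "open W" "Ck_on 2 W f" and S: "compact S" "S \<subseteq> W"
    and \<eta>: "Ck_on 2 UNIV \<eta>" "\<And>z. z \<notin> S \<Longrightarrow> \<eta> z = 0"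
  shows "integral UNIV (\<lambda>z. f z * laplacian UNIV \<eta> z) = integral UNIV (\<lambda>z. laplacian UNIV f z * \<eta> z)"
proof -
  note f = Ck_on_2D[OF W]
  note e = Ck_on_2D[OF open_UNIV \<eta>(1), simplified]
  have cS: "closed S" and bS: "bounded S" using S(1) by (auto simp: compact_imp_closed compact_imp_bounded)
  note e1 = pd_eq_0_outside[OF cS \<eta>(2)]
  note e2 = pd_eq_0_outside[OF cS e1]
  have f1: "Ck_on 1 W f" and \<eta>1: "Ck_on 1 UNIV \<eta>" using Ck_on_le[of 1 2] W(2) \<eta>(1) by auto
  have f2: "Ck_on 1 W (pd UNIV i f)" and \<eta>2: "Ck_on 1 UNIV (pd UNIV i \<eta>)" if "i \<in> Basis" for i
    using Ck_on_pd[of W "Suc 0" f i] Ck_on_pd[of UNIV "Suc 0" \<eta> i] W \<eta>(1) that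
    by (simp_all only: numeral_2_eq_2 One_nat_def open_UNIV)
  have i1: "continuous_on UNIV (\<lambda>z. f z * pd UNIV i (pd UNIV i \<eta>) z)" if "i \<in> Basis" for i
    by (rule continuous_on_supported_mult[OF W(1) f(3) cS S(2)]) (use that e e2 in auto)
  have i2: "continuous_on UNIV (\<lambda>z. pd UNIV i (pd UNIV i f) z * \<eta> z)" if "i \<in> Basis" for i
    by (rule continuous_on_supported_mult[OF W(1) f(5)[OF that that] cS S(2)]) (use that e \<eta> in auto)
  have eq: "integral UNIV (\<lambda>z. f z * pd UNIV i (pd UNIV i \<eta>) z) = integral UNIV (\<lambda>z. pd UNIV i (pd UNIV i f) z * \<eta> z)"
    if i: "i \<in> Basis" for i
    using integration_by_parts[OF W(1) f1 S \<eta>2[OF i] e1 i] integration_by_parts[OF W(1) f2[OF i] S \<eta>1 \<eta>(2) i] by simp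
  have "integral UNIV (\<lambda>z. f z * laplacian UNIV \<eta> z)
    = (\<Sum>i\<in>Basis. integral UNIV (\<lambda>z. f z * pd UNIV i (pd UNIV i \<eta>) z))"
    unfolding laplacian_def sum_distrib_left
    by (rule integral_sum) (use i1 e2 bS in \<open>auto intro!: integrable_on_supported[of S]\<close>)
  also have "\<dots> = (\<Sum>i\<in>Basis. integral UNIV (\<lambda>z. pd UNIV i (pd UNIV i f) z * \<eta> z))"
    using eq by simp
  also have "\<dots> = integral UNIV (\<lambda>z. laplacian UNIV f z * \<eta> z)"
    unfolding laplacian_def sum_distrib_right
    by (rule integral_sum[symmetric]) (use i2 \<eta>(2) bS in \<open>auto intro!: integrable_on_supported[of S]\<close>)
  finally show ?thesis .
qed

section \<open>Symmetry of second derivatives\<close>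

text \<open>The second difference is symmetric in \<open>i\<close> and \<open>j\<close>, while
  applying the mean value theorem first along \<open>i\<close> and then along \<open>j\<close>
  produces one particular order of derivatives. Exchanging the roles yields the other order, whence
  \<open>pd_commute\<close> by letting \<open>h\<close> shrink.\<close>

lemma second_difference_mean_value:
  assumes W: "open W" "Ck_on 2 W g" and ij: "i \<in> Basis" "j \<in> Basis"
    and h: "h > 0" "cball x (2 * h) \<subseteq> W"
  shows "\<exists>y\<in>cball x (2 * h). g (x + h *\<^sub>R i + h *\<^sub>R j) - g (x + h *\<^sub>R i) - g (x + h *\<^sub>R j) + g x
    = h\<^sup>2 * pd UNIV j (pd UNIV i g) y"
proof -
  note g = Ck_on_2D[OF W]
  have inb: "x + s *\<^sub>R i + t *\<^sub>R j \<in> cball x (2 * h)" if "0 \<le> s" "s \<le> h" "0 \<le> t" "t \<le> h" for s t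
  proof -
    have "norm (s *\<^sub>R i + t *\<^sub>R j) \<le> norm (s *\<^sub>R i) + norm (t *\<^sub>R j)" by (rule norm_triangle_ineq)
    also have "\<dots> \<le> 2 * h" using that ij by simp
    finally have "norm (s *\<^sub>R i + t *\<^sub>R j) \<le> 2 * h" .
    moreover have "dist x (x + s *\<^sub>R i + t *\<^sub>R j) = norm (s *\<^sub>R i + t *\<^sub>R j)"
      by (metis add.assoc add_diff_cancel_left' dist_commute dist_norm)
    ultimately show ?thesis by simp
  qed
  have inW: "x + s *\<^sub>R i + t *\<^sub>R j \<in> W" if "0 \<le> s" "s \<le> h" "0 \<le> t" "t \<le> h" for s t
    using inb[OF that] h(2) by blast
  define a where "a s = g ((x + h *\<^sub>R j) + s *\<^sub>R i) - g (x + s *\<^sub>R i)" for s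
  have da: "(a has_real_derivative pd UNIV i g (x + h *\<^sub>R j + s *\<^sub>R i) - pd UNIV i g (x + s *\<^sub>R i)) (at s)"
    if "0 \<le> s" "s \<le> h" for s
  proof -
    have d: "(g has_derivative (\<lambda>v. grad UNIV g y \<bullet> v)) (at y)" if "y \<in> W" for y
      by (rule has_derivative_grad[OF g(1)[OF that]])
    have "x + h *\<^sub>R j + s *\<^sub>R i \<in> W" using inW[of s h] that h by (simp add: algebra_simps)
    moreover have "x + s *\<^sub>R i \<in> W" using inW[of s 0] that h by (simp add: algebra_simps)
    ultimately show ?thesis unfolding a_def[abs_def]
      using has_real_derivative_line[OF d] ij by (intro DERIV_diff) (simp_all flip: grad_inner_Basis)
  qed
  obtain s where s: "0 < s" "s < h"
    "a h - a 0 = (h - 0) * (pd UNIV i g (x + h *\<^sub>R j + s *\<^sub>R i) - pd UNIV i g (x + s *\<^sub>R i))"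
    using MVT2[of 0 h a, OF h(1) da] by auto
  define b where "b t = pd UNIV i g ((x + s *\<^sub>R i) + t *\<^sub>R j)" for t
  have db: "(b has_real_derivative pd UNIV j (pd UNIV i g) (x + s *\<^sub>R i + t *\<^sub>R j)) (at t)"
    if "0 \<le> t" "t \<le> h" for t
  proof -
    have "pd UNIV i g differentiable (at (x + s *\<^sub>R i + t *\<^sub>R j))"
      by (rule g(2)) (use inW[of s t] that s ij in auto)
    from has_real_derivative_line[OF has_derivative_grad[OF this]]
    show ?thesis unfolding b_def[abs_def] using ij by (simp flip: grad_inner_Basis)
  qed
  obtain t where t: "0 < t" "t < h" "b h - b 0 = (h - 0) * pd UNIV j (pd UNIV i g) (x + s *\<^sub>R i + t *\<^sub>R j)"
    using MVT2[of 0 h b, OF h(1) db] by auto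
  have "g (x + h *\<^sub>R i + h *\<^sub>R j) - g (x + h *\<^sub>R i) - g (x + h *\<^sub>R j) + g x = a h - a 0"
    by (simp add: a_def algebra_simps)
  also have "\<dots> = h * (b h - b 0)" using s(3) by (simp add: b_def algebra_simps)
  also have "\<dots> = h\<^sup>2 * pd UNIV j (pd UNIV i g) (x + s *\<^sub>R i + t *\<^sub>R j)"
    using t(3) by (simp add: power2_eq_square)
  finally show ?thesis using inb[of s t] s t by force
qed

lemma pd_commute:
  assumes W: "open W" "Ck_on 2 W g" and ij: "i \<in> Basis" "j \<in> Basis" and x: "x \<in> W"
  shows "pd UNIV j (pd UNIV i g) x = pd UNIV i (pd UNIV j g) x"
proof (rule ccontr)
  let ?p = "pd UNIV j (pd UNIV i g)" and ?q = "pd UNIV i (pd UNIV j g)"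
  assume ne: "?p x \<noteq> ?q x"
  define e where "e = \<bar>?p x - ?q x\<bar> / 2"
  have e: "e > 0" using ne by (simp add: e_def)
  have "continuous_on W ?p" "continuous_on W ?q" using Ck_on_2D(5)[OF W] ij by auto
  then have "isCont ?p x" "isCont ?q x" using W(1) x by (auto simp: continuous_on_eq_continuous_at)
  then obtain d1 d2 where d: "d1 > 0" "\<And>y. dist y x < d1 \<Longrightarrow> dist (?p y) (?p x) < e"
      "d2 > 0" "\<And>y. dist y x < d2 \<Longrightarrow> dist (?q y) (?q x) < e"
    using e unfolding continuous_at_eps_delta by (metis dist_norm)
  obtain R where R: "R > 0" "cball x R \<subseteq> W" using W(1) x open_contains_cball by blast
  define h where "h = min R (min d1 d2) / 4"
  have h: "h > 0" "2 * h < d1" "2 * h < d2" "2 * h \<le> R" using d R by (auto simp: h_def)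
  then have sub: "cball x (2 * h) \<subseteq> W" using R(2) by auto
  obtain y where y: "y \<in> cball x (2 * h)"
    "g (x + h *\<^sub>R i + h *\<^sub>R j) - g (x + h *\<^sub>R i) - g (x + h *\<^sub>R j) + g x = h\<^sup>2 * ?p y"
    using second_difference_mean_value[OF W ij h(1) sub] by blast
  obtain z where z: "z \<in> cball x (2 * h)"
    "g (x + h *\<^sub>R j + h *\<^sub>R i) - g (x + h *\<^sub>R j) - g (x + h *\<^sub>R i) + g x = h\<^sup>2 * ?q z"
    using second_difference_mean_value[OF W ij(2,1) h(1) sub] by blast
  have "h\<^sup>2 * ?p y = h\<^sup>2 * ?q z" using y(2) z(2) by (simp add: algebra_simps)
  then have "?p y = ?q z" using h(1) by simp
  moreover have "dist (?p y) (?p x) < e" "dist (?q z) (?q x) < e"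
    using d(2)[of y] d(4)[of z] y(1) z(1) h by (simp_all add: dist_commute[of _ x])
  ultimately have "\<bar>?p x - ?q x\<bar> < 2 * e" unfolding dist_real_def by arith
  then show False by (simp add: e_def)
qed

section \<open>Convolutions with smooth kernels\<close>

lemma continuous_on_grad:
  assumes "open W" "Ck_on (Suc k) W f"
  shows "continuous_on W (grad UNIV f)"
  unfolding grad_def[abs_def]
  using Ck_on_imp_continuous_on[OF Ck_on_pd[OF assms]] by (intro continuous_intros)

text \<open>\<open>r\<close> bounds the support of the kernels and \<open>s\<close> the region of
  evaluation. For \<open>x\<close> in \<open>ball x0 s\<close> only points of
  \<open>cball x0 (r + s)\<close> contribute, and there \<open>f\<close> is continuous.\<close>

locale convolution =
  fixes W :: "'a::euclidean_space set" and f :: "'a \<Rightarrow> real" and x0 :: 'a and r s :: real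
  assumes W: "open W" "continuous_on W f" and sub: "cball x0 (r + s) \<subseteq> W"
begin

definition conv :: "('a \<Rightarrow> real) \<Rightarrow> 'a \<Rightarrow> real" where
  "conv \<kappa> x = integral UNIV (\<lambda>z. f z * \<kappa> (x - z))"

definition supported :: "('a \<Rightarrow> 'b::zero) \<Rightarrow> bool" where
  "supported \<kappa> \<longleftrightarrow> (\<forall>z. z \<notin> cball 0 r \<longrightarrow> \<kappa> z = 0)"

lemma supportedD:
  assumes "supported \<kappa>" "x \<in> ball x0 s" "z \<notin> cball x0 (r + s)"
  shows "\<kappa> (x - z) = 0"
proof -
  have "dist x0 z \<le> dist x0 x + dist x z" by (rule dist_triangle)
  then have "x - z \<notin> cball 0 r" using assms(2,3) by (simp add: dist_norm norm_minus_commute)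
  then show ?thesis using assms(1) by (simp add: supported_def)
qed

lemma supported_pd: "supported \<kappa> \<Longrightarrow> supported (pd UNIV i \<kappa>)"
  unfolding supported_def using pd_eq_0_outside[of "cball 0 r" \<kappa>] by (metis closed_cball)

lemma supported_grad: "supported \<kappa> \<Longrightarrow> supported (grad UNIV \<kappa>)"
  using supported_pd by (simp add: supported_def grad_def)

lemma continuous_on_kernel:
  fixes \<kappa> :: "'a \<Rightarrow> 'b::real_normed_vector"
  assumes "continuous_on UNIV \<kappa>" "supported \<kappa>"
  shows "continuous_on (ball x0 s \<times> UNIV) (\<lambda>p. f (snd p) *\<^sub>R \<kappa> (fst p - snd p))"
  by (rule continuous_on_supported_product[OF W closed_cball sub])
    (use assms(2) in \<open>auto intro!: continuous_on_compose2[OF assms(1)] continuous_intros supportedD\<close>)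

lemma conv_eq_cbox:
  assumes "supported \<kappa>" "cball x0 (r + s) \<subseteq> cbox a b" "x \<in> ball x0 s"
  shows "conv \<kappa> x = integral (cbox a b) (\<lambda>z. f z * \<kappa> (x - z))"
  unfolding conv_def
  by (rule integral_cbox_eq_UNIV[symmetric, OF _ assms(2)]) (use supportedD[OF assms(1,3)] in simp)

lemma obtain_cbox: obtains a b where "cball x0 (r + s) \<subseteq> cbox a b"
  using bounded_subset_cbox_symmetric[OF bounded_cball] by blast

lemma continuous_on_conv:
  assumes "continuous_on UNIV \<kappa>" "supported \<kappa>"
  shows "continuous_on (ball x0 s) (conv \<kappa>)"
proof -
  obtain a b where ab: "cball x0 (r + s) \<subseteq> cbox a b" by (rule obtain_cbox)
  have "continuous_on (ball x0 s) (\<lambda>x. integral (cbox a b) (\<lambda>z. f z * \<kappa> (x - z)))"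
    by (rule integral_continuous_on_param)
      (use continuous_on_subset[OF continuous_on_kernel[OF assms], of "ball x0 s \<times> cbox a b"]
        in \<open>auto simp: case_prod_unfold\<close>)
  then show ?thesis
    by (rule continuous_on_eq) (use conv_eq_cbox[OF assms(2) ab] in simp)
qed

lemma conv_has_derivative:
  assumes \<kappa>: "Ck_on 1 UNIV \<kappa>" "supported \<kappa>" and x: "x \<in> ball x0 s"
  shows "(conv \<kappa> has_derivative (\<lambda>v. integral UNIV (\<lambda>z. f z * (grad UNIV \<kappa> (x - z) \<bullet> v)))) (at x)"
proof -
  obtain a b where ab: "cball x0 (r + s) \<subseteq> cbox a b" by (rule obtain_cbox)
  have \<kappa>1: "Ck_on (Suc 0) UNIV \<kappa>" using \<kappa>(1) by simp
  have \<kappa>c: "continuous_on UNIV \<kappa>" using Ck_on_imp_continuous_on[OF \<kappa>(1)] .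
  have \<kappa>g: "continuous_on UNIV (grad UNIV \<kappa>)" by (rule continuous_on_grad[OF open_UNIV \<kappa>1])
  note kg = continuous_on_kernel[OF \<kappa>g supported_grad[OF \<kappa>(2)]]
  let ?fx = "\<lambda>x z. blinfun_inner_right (f z *\<^sub>R grad UNIV \<kappa> (x - z))"
  have slice: "continuous_on (cbox a b) (\<lambda>z. f z *\<^sub>R h (x - z))"
    if "continuous_on UNIV h" "supported h" "x \<in> ball x0 s" for h :: "'a \<Rightarrow> 'c::real_normed_vector" and x
    using that(3) by (intro continuous_on_compose2[OF continuous_on_kernel[OF that(1,2)], where f="Pair x", simplified])
      (auto intro!: continuous_intros)
  have "((\<lambda>x. integral (cbox a b) (\<lambda>z. f z * \<kappa> (x - z))) has_derivative integral (cbox a b) (?fx x)) (at x within ball x0 s)"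
  proof (rule leibniz_rule)
    fix y t assume "y \<in> ball x0 s"
    have "((\<lambda>x. \<kappa> (x - t)) has_derivative (\<lambda>v. grad UNIV \<kappa> (y - t) \<bullet> v)) (at y)"
      by (rule has_derivative_compose[where f="\<lambda>x. x - t", OF _ Ck_on_imp_has_derivative[OF open_UNIV \<kappa>1]])
        (auto intro!: derivative_eq_intros)
    then have "((\<lambda>x. f t * \<kappa> (x - t)) has_derivative (\<lambda>v. f t * (grad UNIV \<kappa> (y - t) \<bullet> v))) (at y)"
      by (rule has_derivative_mult_right)
    moreover have "blinfun_apply (?fx y t) = (\<lambda>v. f t * (grad UNIV \<kappa> (y - t) \<bullet> v))"
      by (rule ext) simp
    ultimately show "((\<lambda>x. f t * \<kappa> (x - t)) has_derivative blinfun_apply (?fx y t)) (at y within ball x0 s)"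
      using has_derivative_at_withinI by metis
  next
    fix y assume "y \<in> ball x0 s"
    then show "(\<lambda>z. f z * \<kappa> (y - z)) integrable_on cbox a b"
      using slice[OF \<kappa>c \<kappa>(2)] by (auto intro: integrable_continuous)
  next
    show "continuous_on (ball x0 s \<times> cbox a b) (\<lambda>(x, t). ?fx x t)"
      unfolding case_prod_unfold
      by (intro bounded_linear.continuous_on[OF bounded_linear_blinfun_inner_right] continuous_on_subset[OF kg]) auto
  qed (use x in auto)
  moreover have "blinfun_apply (integral (cbox a b) (?fx x)) v = integral UNIV (\<lambda>z. f z * (grad UNIV \<kappa> (x - z) \<bullet> v))" for v
  proof -
    have "(?fx x) integrable_on cbox a b"
      by (intro integrable_continuous bounded_linear.continuous_on[OF bounded_linear_blinfun_inner_right]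
          slice[OF \<kappa>g supported_grad[OF \<kappa>(2)] x])
    then have "blinfun_apply (integral (cbox a b) (?fx x)) v = integral (cbox a b) (\<lambda>z. f z * (grad UNIV \<kappa> (x - z) \<bullet> v))"
      by (subst blinfun_apply_integral) auto
    also have "\<dots> = integral UNIV (\<lambda>z. f z * (grad UNIV \<kappa> (x - z) \<bullet> v))"
      by (rule integral_cbox_eq_UNIV[OF _ ab]) (use supportedD[OF supported_grad[OF \<kappa>(2)] x] in simp)
    finally show ?thesis .
  qed
  ultimately have "((\<lambda>x. integral (cbox a b) (\<lambda>z. f z * \<kappa> (x - z))) has_derivative
      (\<lambda>v. integral UNIV (\<lambda>z. f z * (grad UNIV \<kappa> (x - z) \<bullet> v)))) (at x)"
    using x at_within_open[OF x open_ball] by (metis (no_types, lifting) ext)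
  then show ?thesis
    by (rule has_derivative_transform_within_open[OF _ open_ball x])
      (use conv_eq_cbox[OF \<kappa>(2) ab] in simp)
qed

text \<open>All derivatives fall on the kernel, so continuity of \<open>f\<close> is enough for
  every \<open>k\<close>.\<close>

lemma Ck_on_conv:
  assumes "Ck_on k UNIV \<kappa>" "supported \<kappa>"
  shows "Ck_on k (ball x0 s) (conv \<kappa>)"
  using assms
proof (induction k arbitrary: \<kappa>)
  case 0
  then show ?case using continuous_on_conv by simp
next
  case (Suc k)
  have 1: "Ck_on 1 UNIV \<kappa>" using Ck_on_le[OF _ Suc.prems(1), of 1] by simp
  show ?case
  proof (rule Ck_on_SucI[OF open_ball conv_has_derivative[OF 1 Suc.prems(2)]])
    fix i :: 'a assume i: "i \<in> Basis"
    have "Ck_on k (ball x0 s) (conv (pd UNIV i \<kappa>))"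
      by (rule Suc.IH[OF Ck_on_pd[OF open_UNIV Suc.prems(1) i] supported_pd[OF Suc.prems(2)]])
    then show "Ck_on k (ball x0 s) (\<lambda>x. integral UNIV (\<lambda>z. f z * (grad UNIV \<kappa> (x - z) \<bullet> i)))"
      using i by (simp add: conv_def[abs_def] grad_inner_Basis)
  qed
qed

end

section \<open>Harmonic functions\<close>

text \<open>Derivatives are the unrestricted ones; the predicate is meant for open \<open>W\<close>,
  where they agree with those within \<open>W\<close>.\<close>

definition harmonic_on :: "'a::euclidean_space set \<Rightarrow> ('a \<Rightarrow> real) \<Rightarrow> bool" where
  "harmonic_on W f \<longleftrightarrow> Ck_on 2 W f \<and> (\<forall>x\<in>W. laplacian UNIV f x = 0)"

lemma laplacian_open:
  assumes "open W" "x \<in> W" "W \<subseteq> S"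
  shows "laplacian S f x = laplacian UNIV f x"
proof -
  have "pd S i (pd S i f) x = pd UNIV i (pd UNIV i f) x" for i
  proof -
    have "pd S i (pd S i f) x = pd UNIV i (pd S i f) x" by (rule pd_open[OF assms])
    also have "\<dots> = pd UNIV i (pd UNIV i f) x"
      by (rule pd_cong_open[OF assms(1) _ assms(2)]) (use pd_open[OF assms(1) _ assms(3)] in blast)
    finally show ?thesis .
  qed
  then show ?thesis by (simp add: laplacian_def)
qed

lemma laplacian_cong_open:
  assumes "open W" "\<And>x. x \<in> W \<Longrightarrow> f x = g x" "x \<in> W"
  shows "laplacian UNIV f x = laplacian UNIV g x"
proof -
  have "pd UNIV i (pd UNIV i f) x = pd UNIV i (pd UNIV i g) x" for i
    by (rule pd_cong_open[OF assms(1) pd_cong_open[OF assms(1,2)] assms(3)])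
  then show ?thesis by (simp add: laplacian_def)
qed

lemma harmonic_on_subset: "open V \<Longrightarrow> V \<subseteq> W \<Longrightarrow> harmonic_on W f \<Longrightarrow> harmonic_on V f"
  unfolding harmonic_on_def using Ck_on_open_subset by blast

lemma harmonic_on_imp_continuous_on: "harmonic_on W f \<Longrightarrow> continuous_on W f"
  unfolding harmonic_on_def using Ck_on_imp_continuous_on by blast

lemma laplacian_const: "laplacian UNIV (\<lambda>x. c) x = 0"
  by (simp add: laplacian_def pd_eqI[OF has_derivative_const, abs_def])

lemma harmonic_on_const: "open W \<Longrightarrow> harmonic_on W (\<lambda>x. c)"
  by (simp add: harmonic_on_def laplacian_const del: Ck_on.simps)

lemma laplacian_add:
  assumes W: "open W" "Ck_on 2 W f" "Ck_on 2 W g" "x \<in> W"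
  shows "laplacian UNIV (\<lambda>x. f x + g x) x = laplacian UNIV f x + laplacian UNIV g x"
proof -
  note f = Ck_on_2D[OF W(1,2)] and g = Ck_on_2D[OF W(1,3)]
  have "pd UNIV i (pd UNIV i (\<lambda>x. f x + g x)) x = pd UNIV i (pd UNIV i f) x + pd UNIV i (pd UNIV i g) x"
    if i: "i \<in> Basis" for i
  proof -
    have "pd UNIV i (pd UNIV i (\<lambda>x. f x + g x)) x = pd UNIV i (\<lambda>x. pd UNIV i f x + pd UNIV i g x) x"
      by (rule pd_cong_open[OF W(1) _ W(4)]) (rule pd_add[OF f(1) g(1)])
    then show ?thesis using pd_add[OF f(2)[OF W(4) i] g(2)[OF W(4) i]] by simp
  qed
  then show ?thesis by (simp add: laplacian_def sum.distrib)
qed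

lemma laplacian_cmult:
  assumes W: "open W" "Ck_on 2 W f" "x \<in> W"
  shows "laplacian UNIV (\<lambda>x. c * f x) x = c * laplacian UNIV f x"
proof -
  note f = Ck_on_2D[OF W(1,2)]
  have "pd UNIV i (pd UNIV i (\<lambda>x. c * f x)) x = c * pd UNIV i (pd UNIV i f) x" if i: "i \<in> Basis" for i
  proof -
    have "pd UNIV i (pd UNIV i (\<lambda>x. c * f x)) x = pd UNIV i (\<lambda>x. c * pd UNIV i f x) x"
      by (rule pd_cong_open[OF W(1) _ W(3)]) (rule pd_cmult[OF f(1)])
    then show ?thesis using pd_cmult[OF f(2)[OF W(3) i]] by simp
  qed
  then show ?thesis by (simp add: laplacian_def sum_distrib_left)
qed

lemma harmonic_on_add:
  "open W \<Longrightarrow> harmonic_on W f \<Longrightarrow> harmonic_on W g \<Longrightarrow> harmonic_on W (\<lambda>x. f x + g x)"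
  by (simp add: harmonic_on_def laplacian_add Ck_on_add)

lemma harmonic_on_cmult: "open W \<Longrightarrow> harmonic_on W f \<Longrightarrow> harmonic_on W (\<lambda>x. c * f x)"
  by (simp add: harmonic_on_def laplacian_cmult Ck_on_cmult)

lemma harmonic_on_diff:
  "open W \<Longrightarrow> harmonic_on W f \<Longrightarrow> harmonic_on W g \<Longrightarrow> harmonic_on W (\<lambda>x. f x - g x)"
  using harmonic_on_add[of W f "\<lambda>x. (-1) * g x"] harmonic_on_cmult[of W g "-1"] by simp

lemma harmonic_on_sum:
  assumes "open W" "\<And>i. i \<in> I \<Longrightarrow> harmonic_on W (f i)"
  shows "harmonic_on W (\<lambda>x. \<Sum>i\<in>I. f i x)"
  using assms(2) by (induction I rule: infinite_finite_induct)
    (auto intro!: harmonic_on_add harmonic_on_const simp: assms(1))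

subsection \<open>The mean value property\<close>

lemma pd_bump_fn:
  assumes "r > 0"
  shows "pd UNIV i (bump_fn m c r) x = (bump_fn (m + 2) c r x - m * bump_fn (m + 1) c r x) * (- 2 / r\<^sup>2 * ((x - c) \<bullet> i))"
  by (rule pd_eqI[OF has_derivative_bump_fn[OF assms]])

text \<open>Written with the indices 2, 3, 4 of the family in order to be compared with the
  derivative of the averaging weight in its radius.\<close>

lemma laplacian_bump_fn:
  fixes c z :: "'a::euclidean_space"
  assumes "r > 0"
  shows "laplacian UNIV (bump_fn 0 c r) z =
    (bump_fn 4 c r z - 2 * bump_fn 3 c r z) * (4 / r ^ 4 * (norm (z - c))\<^sup>2)
     - 2 * DIM('a) / r\<^sup>2 * bump_fn 2 c r z"
proof -
  have 1: "pd UNIV i (bump_fn 0 c r) = (\<lambda>x. bump_fn 2 c r x * (- 2 / r\<^sup>2 * ((x - c) \<bullet> i)))" for i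
    by (rule ext) (simp add: pd_bump_fn[OF assms] numeral_2_eq_2)
  have 2: "pd UNIV i (pd UNIV i (bump_fn 0 c r)) z = (bump_fn 4 c r z - 2 * bump_fn 3 c r z) * (4 / r ^ 4 * ((z - c) \<bullet> i)\<^sup>2)
     - 2 / r\<^sup>2 * bump_fn 2 c r z" if "i \<in> Basis" for i
  proof -
    have l: "((\<lambda>x. - 2 / r\<^sup>2 * ((x - c) \<bullet> i)) has_derivative (\<lambda>v. - 2 / r\<^sup>2 * (v \<bullet> i))) (at z)"
      by (rule has_derivative_mult_right) (auto intro!: derivative_eq_intros)
    have "pd UNIV i (pd UNIV i (bump_fn 0 c r)) z = bump_fn 2 c r z * pd UNIV i (\<lambda>x. - 2 / r\<^sup>2 * ((x - c) \<bullet> i)) z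
      + pd UNIV i (bump_fn 2 c r) z * (- 2 / r\<^sup>2 * ((z - c) \<bullet> i))"
      unfolding 1 by (rule pd_mult) (use has_derivative_bump_fn[OF assms] l in \<open>auto simp: differentiable_def\<close>)
    also have "pd UNIV i (\<lambda>x. - 2 / r\<^sup>2 * ((x - c) \<bullet> i)) z = - 2 / r\<^sup>2"
      using pd_eqI[OF l, of i] that by (simp add: inner_Basis)
    also have "pd UNIV i (bump_fn 2 c r) z = (bump_fn 4 c r z - 2 * bump_fn 3 c r z) * (- 2 / r\<^sup>2 * ((z - c) \<bullet> i))"
      using pd_bump_fn[OF assms, of i 2 c z] by simp
    finally show ?thesis using assms by (simp add: field_simps power2_eq_square power4_eq_xxxx)
  qed
  have n: "(norm (z - c))\<^sup>2 = (\<Sum>i\<in>Basis. ((z - c) \<bullet> i)\<^sup>2)"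
    by (subst power2_norm_eq_inner, subst euclidean_inner) (simp add: power2_eq_square)
  show ?thesis unfolding laplacian_def n
    by (simp add: 2 sum_subtractf sum_distrib_left)
qed

lemma continuous_on_bump_fn: "r > 0 \<Longrightarrow> continuous_on S (bump_fn m c r)"
  using Ck_on_imp_continuous_on[OF Ck_on_bump_fn] continuous_on_subset by blast

lemma bump_fn_outside: "r > 0 \<Longrightarrow> z \<notin> cball c r \<Longrightarrow> bump_fn m c r z = 0"
  by (rule bump_fn_eq_0) auto

lemma has_derivative_bump_fn_radius:
  assumes "t > 0"
  shows "((\<lambda>t. bump_fn m c t z) has_real_derivative
     (bump_fn (m + 2) c t z - m * bump_fn (m + 1) c t z) * (2 * (norm (z - c))\<^sup>2 / t ^ 3)) (at t within U)"
  unfolding bump_fn_def using assms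
  by (auto intro!: derivative_eq_intros simp: field_simps power2_eq_square power3_eq_cube)

context
  fixes W :: "'a::euclidean_space set" and f :: "'a \<Rightarrow> real" and x :: 'a and R :: real
  assumes W: "open W" "harmonic_on W f" "cball x R \<subseteq> W"
begin

text \<open>A volume average in place of the average over a sphere. The weight has index 2 because
  \<open>bump 2\<close> is the derivative of \<open>bump 0\<close>; this links its dependence on the
  radius to the Laplacian of \<open>bump_fn 0\<close>.\<close>

definition weighted_mean :: "real \<Rightarrow> real" where
  "weighted_mean t = integral UNIV (\<lambda>z. f z * (inverse t ^ DIM('a) * bump_fn 2 x t z))"

text \<open>The derivative of the scaled weight in t is t^(-n) (t/2) times the Laplacian of
  \<open>bump_fn 0 x t\<close>. Green's identity moves that Laplacian onto the harmonic
  function.\<close>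

lemma weighted_mean_deriv:
  assumes t: "0 < t" "t < R"
  shows "(weighted_mean has_real_derivative 0) (at t)"
proof -
  let ?U = "{0<..<R}" and ?n = "DIM('a)"
  have f: "Ck_on 2 W f" "\<And>x. x \<in> W \<Longrightarrow> laplacian UNIV f x = 0" "continuous_on W f"
    using W(2) harmonic_on_imp_continuous_on by (auto simp: harmonic_on_def)
  let ?K = "\<lambda>t z. inverse t ^ ?n * bump_fn 2 x t z"
  let ?K' = "\<lambda>t z. inverse t ^ ?n * ((bump_fn 4 x t z - 2 * bump_fn 3 x t z) * (2 * (norm (z - x))\<^sup>2 / t ^ 3))
     - real ?n * inverse t ^ Suc ?n * bump_fn 2 x t z"
  obtain a b where ab: "cball x R \<subseteq> cbox a b"
    using bounded_subset_cbox_symmetric[OF bounded_cball] by blast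
  have out: "bump_fn m x t z = 0" if "z \<notin> cball x R" "t \<in> ?U" for t z m
    by (rule bump_fn_outside) (use that in auto)
  have box: "weighted_mean t = integral (cbox a b) (\<lambda>z. f z * ?K t z)" if "t \<in> ?U" for t
    unfolding weighted_mean_def
    by (rule integral_cbox_eq_UNIV[symmetric, OF _ ab]) (use out that in auto)
  have dK: "((\<lambda>t. ?K t z) has_real_derivative ?K' t z) (at t within ?U)" if "t \<in> ?U" for t z
  proof -
    have t: "t > 0" using that by simp
    have i: "((\<lambda>t. inverse t ^ ?n) has_real_derivative - (real ?n * inverse t ^ Suc ?n)) (at t within ?U)"
    proof -
      obtain k where k: "?n = Suc k" using DIM_positive[where 'a='a] gr0_conv_Suc by auto
      show ?thesis unfolding k using t
        using DERIV_power[OF DERIV_inverse[of t ?U], of "Suc k"] by (simp add: algebra_simps)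
    qed
    have n: "(2::nat) + 2 = 4" "(2::nat) + 1 = 3" by auto
    show ?thesis
      using DERIV_mult[OF i has_derivative_bump_fn_radius[OF t, of 2 x z ?U, unfolded n]]
      by (simp add: algebra_simps)
  qed
  have cb: "continuous_on (?U \<times> UNIV) (\<lambda>p. bump_fn m x (fst p) (snd p))" for m
    unfolding bump_fn_def by (auto intro!: continuous_intros)
  have cK: "continuous_on (?U \<times> UNIV) (\<lambda>p. f (snd p) *\<^sub>R ?K (fst p) (snd p))"
    by (rule continuous_on_supported_product[OF W(1) f(3) closed_cball W(3)])
      (use out in \<open>auto intro!: continuous_intros cb\<close>)
  have cK': "continuous_on (?U \<times> UNIV) (\<lambda>p. f (snd p) *\<^sub>R ?K' (fst p) (snd p))"
    by (rule continuous_on_supported_product[OF W(1) f(3) closed_cball W(3)])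
      (use out in \<open>auto intro!: continuous_intros cb\<close>)
  have "((\<lambda>t. integral (cbox a b) (\<lambda>z. f z * ?K t z)) has_real_derivative integral (cbox a b) (\<lambda>z. f z * ?K' t z)) (at t within ?U)"
  proof (rule leibniz_rule_field_derivative)
    fix s z assume "s \<in> ?U"
    then show "((\<lambda>t. f z * ?K t z) has_real_derivative f z * ?K' s z) (at s within ?U)"
      by (intro DERIV_cmult dK)
  next
    fix s assume "s \<in> ?U"
    then show "(\<lambda>z. f z * ?K s z) integrable_on cbox a b"
      by (intro integrable_continuous continuous_on_compose2[OF cK, where f="Pair s", simplified])
        (auto intro!: continuous_intros)
  next
    show "continuous_on (?U \<times> cbox a b) (\<lambda>(t, z). f z * ?K' t z)"
      unfolding case_prod_unfold using continuous_on_subset[OF cK', of "?U \<times> cbox a b"] by auto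
  qed (use t in auto)
  moreover have "integral (cbox a b) (\<lambda>z. f z * ?K' t z) = 0"
  proof -
    have cb: "cball x t \<subseteq> cbox a b" "cball x t \<subseteq> W"
      using t ab W(3) subset_cball[of t R x] by auto
    have K'eq: "?K' t z = inverse t ^ ?n * (t / 2) * laplacian UNIV (bump_fn 0 x t) z" for z
      using t by (simp add: laplacian_bump_fn field_simps power2_eq_square power3_eq_cube power4_eq_xxxx)
    have "integral (cbox a b) (\<lambda>z. f z * ?K' t z) = integral UNIV (\<lambda>z. f z * ?K' t z)"
      by (rule integral_cbox_eq_UNIV[OF _ cb(1)]) (simp add: bump_fn_outside[OF t(1)])
    also have "\<dots> = integral UNIV (\<lambda>z. (inverse t ^ ?n * (t / 2)) *\<^sub>R (f z * laplacian UNIV (bump_fn 0 x t) z))"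
      unfolding K'eq by (rule arg_cong[where f="integral UNIV"]) auto
    also have "\<dots> = (inverse t ^ ?n * (t / 2)) *\<^sub>R integral UNIV (\<lambda>z. f z * laplacian UNIV (bump_fn 0 x t) z)"
      by (rule integral_cmul)
    also have "integral UNIV (\<lambda>z. f z * laplacian UNIV (bump_fn 0 x t) z) = integral UNIV (\<lambda>z. laplacian UNIV f z * bump_fn 0 x t z)"
      by (rule green[OF W(1) f(1) compact_cball cb(2)]) (use t bump_fn_outside Ck_on_bump_fn in auto)
    also have "(\<lambda>z. laplacian UNIV f z * bump_fn 0 x t z) = (\<lambda>z. 0)"
      using f(2) cb(2) bump_fn_outside[OF t(1)] by (metis mult_eq_0_iff subsetD)
    finally show ?thesis by simp
  qed
  ultimately have "((\<lambda>t. integral (cbox a b) (\<lambda>z. f z * ?K t z)) has_real_derivative 0) (at t)"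
    using t at_within_open[of t ?U] by simp
  then show ?thesis
    by (rule has_field_derivative_transform_within_open[where S="?U"]) (use t box in auto)
qed

lemma weighted_mean_const:
  assumes "0 < s" "s < R" "0 < t" "t < R"
  shows "weighted_mean s = weighted_mean t"
proof -
  have "weighted_mean s = weighted_mean t" if "s < t" "0 < s" "t < R" for s t
  proof (rule DERIV_isconst2[OF that(1), symmetric])
    show "continuous_on {s..t} weighted_mean"
      using that by (intro continuous_at_imp_continuous_on ballI DERIV_isCont[OF weighted_mean_deriv]) auto
  qed (use that weighted_mean_deriv in auto)
  then show ?thesis using assms by (metis linorder_less_linear)
qed

end

definition bump_mass :: "'a::euclidean_space itself \<Rightarrow> real" where
  "bump_mass _ = integral UNIV (bump_fn 2 (0::'a) 1)"

lemma bump_fn_translate: "bump_fn m c r (c + z) = bump_fn m 0 r z"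
  by (simp add: bump_fn_def)

lemma integral_supported_pos:
  fixes h :: "'a::euclidean_space \<Rightarrow> real"
  assumes "bounded S" "continuous_on UNIV h" "\<And>z. z \<notin> S \<Longrightarrow> h z = 0" "\<And>z. h z \<ge> 0" "h x > 0"
  shows "integral UNIV h > 0"
proof -
  have "bounded (ball x 1 \<union> S)" using assms(1) by auto
  then obtain a where a: "ball x 1 \<union> S \<subseteq> cbox (-a) a" using bounded_subset_cbox_symmetric by blast
  have "ball x 1 \<subseteq> interior (cbox (-a) a)" using a by (intro interior_maximal) auto
  then have ne: "box (-a) a \<noteq> {}" by (metis centre_in_ball empty_iff interior_cbox subsetD zero_less_one)
  have eq: "integral (cbox (-a) a) h = integral UNIV h"
    by (rule integral_cbox_eq_UNIV[OF assms(3)]) (use a in auto)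
  have c: "continuous_on (cbox (-a) a) h" using assms(2) continuous_on_subset by blast
  have "x \<in> cbox (-a) a" using a by (metis UnCI centre_in_ball subsetD zero_less_one)
  then have "integral (cbox (-a) a) h \<noteq> 0"
    using integral_cbox_eq_0_iff[OF c ne] assms(4,5) by force
  moreover have "integral (cbox (-a) a) h \<ge> 0"
    using integral_nonneg[OF integrable_continuous[OF c]] assms(4) by simp
  ultimately show ?thesis using eq by linarith
qed

lemma bump_mass_pos: "bump_mass TYPE('a::euclidean_space) > 0"
  unfolding bump_mass_def
  by (rule integral_supported_pos[of "cball 0 1" _ 0])
    (auto intro!: bump_fn_outside bump_fn_nonneg bump_fn_pos continuous_on_bump_fn)

lemma integrable_bump_fn: "r > 0 \<Longrightarrow> bump_fn m (c::'a::euclidean_space) r integrable_on UNIV"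
  by (rule integrable_on_supported[of "cball c r"]) (auto intro!: bump_fn_outside continuous_on_bump_fn)

text \<open>The scaling of the mass is not a change of variables here: it is the constancy of
  weighted means for the harmonic function 1, at the radii \<open>t\<close> and 1.\<close>

lemma integral_bump_fn:
  fixes x :: "'a::euclidean_space"
  assumes t: "t > 0"
  shows "inverse t ^ DIM('a) * integral UNIV (bump_fn 2 x t) = bump_mass TYPE('a)"
proof -
  have h: "open (UNIV :: 'a set)" "harmonic_on UNIV (\<lambda>_::'a. 1)" "cball x (t + 2) \<subseteq> UNIV"
    by (auto intro: harmonic_on_const)
  have "weighted_mean (\<lambda>_. 1) x t = weighted_mean (\<lambda>_. 1) x 1"
    by (rule weighted_mean_const[OF h]) (use t in auto)
  then have "inverse t ^ DIM('a) * integral UNIV (bump_fn 2 x t) = integral UNIV (bump_fn 2 x 1)"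
    by (simp add: weighted_mean_def[OF h])
  also have "\<dots> = integral UNIV (\<lambda>z. bump_fn 2 x 1 (x + z))"
    by (rule integral_translate[symmetric, of "cball x 1"]) (auto intro: bump_fn_outside)
  finally show ?thesis by (simp add: bump_fn_translate bump_mass_def)
qed

text \<open>The weighted mean is constant in the radius, so it may be evaluated at a small radius
  \<open>s\<close>, where continuity of \<open>f\<close> at \<open>x\<close> puts it within
  \<open>e * bump_mass\<close> of \<open>bump_mass * f x\<close>.\<close>

theorem mean_value_property:
  fixes x :: "'a::euclidean_space"
  assumes W: "open W" "harmonic_on W f" "cball x R \<subseteq> W" and t: "0 < t" "t < R"
  shows "integral UNIV (\<lambda>z. f z * bump_fn 2 x t z) = t ^ DIM('a) * bump_mass TYPE('a) * f x"
proof -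
  let ?n = "DIM('a)" and ?\<phi> = "weighted_mean f x" and ?c = "bump_mass TYPE('a)"
  have cf: "continuous_on W f" using W(2) by (rule harmonic_on_imp_continuous_on)
  have x: "x \<in> W" using W(3) t by auto
  have int: "(\<lambda>z. f z * bump_fn 2 x s z) integrable_on UNIV" if "0 < s" "s < R" for s
  proof (rule integrable_on_supported[of "cball x s"])
    have "cball x s \<subseteq> W" using W(3) that(2) subset_cball[of s R x] by auto
    then show "continuous_on UNIV (\<lambda>z. f z * bump_fn 2 x s z)"
      by (intro continuous_on_supported_mult[OF W(1) cf closed_cball])
        (use that in \<open>auto intro!: continuous_on_bump_fn bump_fn_outside\<close>)
  qed (use that in \<open>auto intro!: bump_fn_outside\<close>)
  have \<phi>: "?\<phi> s = inverse s ^ ?n * integral UNIV (\<lambda>z. f z * bump_fn 2 x s z)" for s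
  proof -
    have "?\<phi> s = integral UNIV (\<lambda>z. (inverse s ^ ?n) *\<^sub>R (f z * bump_fn 2 x s z))"
      unfolding weighted_mean_def[OF W] by (rule arg_cong[where f="integral UNIV"]) auto
    then show ?thesis by simp
  qed
  have "\<bar>?\<phi> t - ?c * f x\<bar> \<le> e * ?c" if e: "e > 0" for e
  proof -
    have "isCont f x" using cf W(1) x by (simp add: continuous_on_eq_continuous_at)
    then obtain d where d: "d > 0" "\<And>z. dist z x < d \<Longrightarrow> dist (f z) (f x) < e"
      using e unfolding continuous_at_eps_delta by (metis dist_norm)
    define s where "s = min d R / 2"
    have s: "0 < s" "s < d" "s < R" using d(1) t by (auto simp: s_def)
    have "integral UNIV (\<lambda>z. (f z - f x) * bump_fn 2 x s z)
      = integral UNIV (\<lambda>z. f z * bump_fn 2 x s z - f x *\<^sub>R bump_fn 2 x s z)"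
      by (rule arg_cong[where f="integral UNIV"]) (auto simp: algebra_simps)
    also have "\<dots> = integral UNIV (\<lambda>z. f z * bump_fn 2 x s z) - f x * integral UNIV (bump_fn 2 x s)"
      using integral_diff[OF int[OF s(1,3)] integrable_cmul[OF integrable_bump_fn[OF s(1)], of "f x" 2 x]] by simp
    finally have D: "integral UNIV (\<lambda>z. (f z - f x) * bump_fn 2 x s z)
      = integral UNIV (\<lambda>z. f z * bump_fn 2 x s z) - f x * integral UNIV (bump_fn 2 x s)" .
    have "\<bar>integral UNIV (\<lambda>z. (f z - f x) * bump_fn 2 x s z)\<bar> \<le> integral UNIV (\<lambda>z. e *\<^sub>R bump_fn 2 x s z)"
    proof (rule integral_norm_bound_integral[where 'a=real, unfolded real_norm_def])
      show "(\<lambda>z. (f z - f x) * bump_fn 2 x s z) integrable_on UNIV"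
        using integrable_diff[OF int[OF s(1,3)] integrable_cmul[OF integrable_bump_fn[OF s(1)], of "f x" 2 x]]
        by (simp add: algebra_simps)
      show "(\<lambda>z. e *\<^sub>R bump_fn 2 x s z) integrable_on UNIV"
        by (rule integrable_cmul[OF integrable_bump_fn[OF s(1)]])
      fix z
      show "\<bar>(f z - f x) * bump_fn 2 x s z\<bar> \<le> e *\<^sub>R bump_fn 2 x s z"
      proof (cases "dist z x < d")
        case True
        then have "\<bar>f z - f x\<bar> \<le> e" using d(2)[of z] by (simp add: dist_real_def)
        then show ?thesis by (simp add: abs_mult mult_right_mono bump_fn_nonneg)
      next
        case False
        then have "bump_fn 2 x s z = 0" using s by (intro bump_fn_eq_0) (auto simp: dist_commute)
        then show ?thesis by simp
      qed
    qed
    then have "\<bar>integral UNIV (\<lambda>z. f z * bump_fn 2 x s z) - f x * integral UNIV (bump_fn 2 x s)\<bar> \<le> e * integral UNIV (bump_fn 2 x s)"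
      by (simp add: D)
    then have "inverse s ^ ?n * \<bar>integral UNIV (\<lambda>z. f z * bump_fn 2 x s z) - f x * integral UNIV (bump_fn 2 x s)\<bar>
       \<le> inverse s ^ ?n * (e * integral UNIV (bump_fn 2 x s))"
      using s(1) by (intro mult_left_mono) auto
    moreover have "\<bar>inverse s ^ ?n * (integral UNIV (\<lambda>z. f z * bump_fn 2 x s z) - f x * integral UNIV (bump_fn 2 x s))\<bar>
       = inverse s ^ ?n * \<bar>integral UNIV (\<lambda>z. f z * bump_fn 2 x s z) - f x * integral UNIV (bump_fn 2 x s)\<bar>"
      unfolding abs_mult using s(1) by simp
    ultimately have "\<bar>inverse s ^ ?n * (integral UNIV (\<lambda>z. f z * bump_fn 2 x s z) - f x * integral UNIV (bump_fn 2 x s))\<bar>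
       \<le> e * (inverse s ^ ?n * integral UNIV (bump_fn 2 x s))"
      by (simp only: mult.left_commute)
    then have "\<bar>?\<phi> s - f x * (inverse s ^ ?n * integral UNIV (bump_fn 2 x s))\<bar> \<le> e * (inverse s ^ ?n * integral UNIV (bump_fn 2 x s))"
      by (simp add: \<phi> algebra_simps)
    then have "\<bar>?\<phi> s - f x * ?c\<bar> \<le> e * ?c"
      unfolding integral_bump_fn[OF s(1)] .
    moreover have "?\<phi> t = ?\<phi> s" by (rule weighted_mean_const[OF W t s(1,3)])
    ultimately show ?thesis by (simp add: mult.commute)
  qed
  then have "\<bar>?\<phi> t - ?c * f x\<bar> / ?c \<le> e" if "e > 0" for e
    using that bump_mass_pos[where 'a='a] by (simp add: divide_le_eq)
  then have "\<bar>?\<phi> t - ?c * f x\<bar> / ?c \<le> 0" by (meson field_le_epsilon add.left_neutral dense_ge)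
  then have "?\<phi> t = ?c * f x" using bump_mass_pos[where 'a='a] by (simp add: divide_le_eq)
  then show ?thesis using t by (simp add: \<phi> field_simps)
qed

subsection \<open>Smoothness\<close>

text \<open>By the mean value property at one fixed radius, \<open>f\<close> is near each point a
  constant multiple of its convolution with a smooth kernel.\<close>

lemma harmonic_on_imp_Ck_on:
  fixes f :: "'a::euclidean_space \<Rightarrow> real"
  assumes W: "open W" "harmonic_on W f"
  shows "Ck_on k W f"
proof (rule Ck_on_local[OF W(1)])
  fix x0 assume "x0 \<in> W"
  then obtain e where e: "e > 0" "cball x0 e \<subseteq> W" using W(1) open_contains_cball by blast
  \<comment> \<open>The mean value property at radius \<open>r\<close> needs a strictly larger ball
    inside \<open>W\<close>; \<open>cball x (2 * r)\<close> still lies in \<open>cball x0 e\<close>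
    for \<open>x\<close> in \<open>ball x0 r\<close>.\<close>
  define r where "r = e / 4"
  have r: "r > 0" "cball x0 (r + r) \<subseteq> W" using e subset_cball[of "r + r" e x0] by (auto simp: r_def)
  interpret convolution W f x0 r r
    by standard (use W r harmonic_on_imp_continuous_on in auto)
  let ?c = "r ^ DIM('a) * bump_mass TYPE('a)"
  have "supported (bump_fn 2 0 r)" unfolding supported_def using bump_fn_outside[OF r(1)] by blast
  then have "Ck_on k (ball x0 r) (\<lambda>x. inverse ?c * conv (bump_fn 2 0 r) x)"
    by (intro Ck_on_cmult Ck_on_conv Ck_on_bump_fn r(1)) auto
  moreover have "inverse ?c * conv (bump_fn 2 0 r) x = f x" if x: "x \<in> ball x0 r" for x
  proof -
    have "cball x (2 * r) \<subseteq> cball x0 e"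
    proof
      fix z assume "z \<in> cball x (2 * r)"
      then show "z \<in> cball x0 e" using x e(1) dist_triangle[of x0 z x] by (simp add: r_def)
    qed
    then have "integral UNIV (\<lambda>z. f z * bump_fn 2 x r z) = ?c * f x"
      using mean_value_property[OF assms, of x "2 * r" r] e r by (simp add: mult.assoc)
    moreover have "bump_fn 2 x r z = bump_fn 2 0 r (x - z)" for z
      by (simp add: bump_fn_def norm_minus_commute)
    ultimately show ?thesis using bump_mass_pos[where 'a='a] r(1) by (simp add: conv_def field_simps)
  qed
  ultimately have "Ck_on k (ball x0 r) f"
    using Ck_on_cong[OF open_ball, of x0 r "\<lambda>x. inverse ?c * conv (bump_fn 2 0 r) x" f k] by blast
  moreover have "ball x0 r \<subseteq> W" using r(1,2) by (auto simp: subset_iff)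
  ultimately show "\<exists>V. open V \<and> x0 \<in> V \<and> V \<subseteq> W \<and> Ck_on k V f"
    using r(1) by (intro exI[of _ "ball x0 r"]) auto
qed

lemma pd_sum:
  assumes "\<And>j. j \<in> I \<Longrightarrow> f j differentiable (at x)"
  shows "pd UNIV i (\<lambda>x. \<Sum>j\<in>I. f j x) x = (\<Sum>j\<in>I. pd UNIV i (f j) x)"
proof -
  have "((\<lambda>x. \<Sum>j\<in>I. f j x) has_derivative (\<lambda>v. \<Sum>j\<in>I. grad UNIV (f j) x \<bullet> v)) (at x)"
    by (intro has_derivative_sum has_derivative_grad assms)
  moreover have "grad UNIV (f j) x \<bullet> i = pd UNIV i (f j) x" if "j \<in> I" for j
    using pd_eqI[OF has_derivative_grad[OF assms[OF that]], of i] by simp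
  ultimately show ?thesis using pd_eqI by fastforce
qed

lemma harmonic_on_pd:
  assumes W: "open W" "harmonic_on W f" and i: "i \<in> Basis"
  shows "harmonic_on W (pd UNIV i f)"
proof -
  have C: "Ck_on k W f" for k by (rule harmonic_on_imp_Ck_on[OF W])
  have C2: "Ck_on k W (pd UNIV j f)" if "j \<in> Basis" for j k
    by (rule Ck_on_pd[OF W(1) C that])
  have C3: "Ck_on k W (pd UNIV l (pd UNIV j f))" if "j \<in> Basis" "l \<in> Basis" for j l k
    by (rule Ck_on_pd[OF W(1) C2[OF that(1)] that(2)])
  have "laplacian UNIV (pd UNIV i f) x = 0" if x: "x \<in> W" for x
  proof -
    have "laplacian UNIV (pd UNIV i f) x = (\<Sum>j\<in>Basis. pd UNIV i (pd UNIV j (pd UNIV j f)) x)"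
      unfolding laplacian_def
    proof (rule sum.cong[OF refl])
      fix j :: 'a assume j: "j \<in> Basis"
      have "pd UNIV j (pd UNIV j (pd UNIV i f)) x = pd UNIV j (pd UNIV i (pd UNIV j f)) x"
        by (rule pd_cong_open[OF W(1) pd_commute[OF W(1) C i j] x])
      also have "\<dots> = pd UNIV i (pd UNIV j (pd UNIV j f)) x"
        by (rule pd_commute[OF W(1) C2[OF j] i j x])
      finally show "pd UNIV j (pd UNIV j (pd UNIV i f)) x = pd UNIV i (pd UNIV j (pd UNIV j f)) x" .
    qed
    also have "\<dots> = pd UNIV i (laplacian UNIV f) x"
      unfolding laplacian_def[abs_def]
      by (rule pd_sum[symmetric]) (rule Ck_on_imp_differentiable[OF W(1) C3 x])
    also have "\<dots> = pd UNIV i (\<lambda>_. 0) x"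
      by (rule pd_cong_open[OF W(1) _ x]) (use W(2) in \<open>auto simp: harmonic_on_def\<close>)
    finally show ?thesis by (simp add: pd_eqI[OF has_derivative_const])
  qed
  then show ?thesis unfolding harmonic_on_def using C2[OF i] by blast
qed

definition ddir :: "'a::euclidean_space \<Rightarrow> ('a \<Rightarrow> real) \<Rightarrow> 'a \<Rightarrow> real" where
  "ddir e f x = grad UNIV f x \<bullet> e"

lemma ddir_eq_sum: "ddir e f x = (\<Sum>i\<in>Basis. (e \<bullet> i) * pd UNIV i f x)"
  unfolding ddir_def by (subst euclidean_inner) (simp add: grad_inner_Basis mult.commute)

lemma harmonic_on_ddir:
  assumes "open W" "harmonic_on W f"
  shows "harmonic_on W (ddir e f)"
  unfolding ddir_eq_sum[abs_def]
  by (intro harmonic_on_sum harmonic_on_cmult harmonic_on_pd assms)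

lemma harmonic_on_ddir_funpow:
  assumes "open W" "harmonic_on W f"
  shows "harmonic_on W ((ddir e ^^ k) f)"
  by (induction k) (auto intro!: harmonic_on_ddir assms)

lemma harmonic_on_imp_differentiable:
  "open W \<Longrightarrow> harmonic_on W f \<Longrightarrow> x \<in> W \<Longrightarrow> f differentiable (at x)"
  using Ck_on_2D(1) unfolding harmonic_on_def by blast

subsection \<open>Interior estimates\<close>

lemma bump_upper: "t \<le> 1 \<Longrightarrow> bump m t \<le> fact (Suc m)"
proof (cases "t \<le> 0")
  case False
  assume "t \<le> 1"
  then have "fact (Suc m) * t \<le> (fact (Suc m) :: real) * 1" by (intro mult_left_mono) auto
  then have "fact (Suc m) * \<bar>t\<bar> \<le> (fact (Suc m) :: real)" using False by (simp del: fact_Suc)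
  then show ?thesis using bump_le[of m t] by linarith
qed (simp add: bump_nonpos del: fact_Suc)

lemma bump_fn_upper: "bump_fn m c r z \<le> fact (Suc m)"
  unfolding bump_fn_def by (rule bump_upper) simp

text \<open>On the half ball the argument of the bump is at least 3/4. So the weight of twice the
  radius dominates a multiple of the indicator of a ball, which turns pointwise bounds into
  integrals of known value.\<close>

lemma bump_fn_lower:
  assumes "r > 0" "dist c z \<le> r / 2"
  shows "bump_fn 2 c r z \<ge> exp (- (4 / 3))"
proof -
  define t where "t = 1 - (norm (z - c) / r)\<^sup>2"
  have "norm (z - c) / r \<le> 1 / 2" using assms by (simp add: dist_norm norm_minus_commute field_simps)
  then have "(norm (z - c) / r)\<^sup>2 \<le> (1 / 2)\<^sup>2" using assms(1) by (intro power_mono) auto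
  then have t: "3 / 4 \<le> t" "t \<le> 1" by (auto simp: t_def power2_eq_square)
  have "exp (- (4 / 3)) \<le> exp (- 1 / t)" using t by (simp add: field_simps)
  also have "\<dots> \<le> exp (- 1 / t) / t ^ 2"
    using t by (simp add: le_divide_eq power_le_one)
  also have "\<dots> = bump_fn 2 c r z" using t by (simp add: bump_fn_def bump_def t_def)
  finally show ?thesis .
qed

lemma integral_weighted_mono:
  fixes f g :: "'a::euclidean_space \<Rightarrow> real"
  assumes "bounded S" "continuous_on UNIV f" "continuous_on UNIV g"
    "\<And>z. z \<notin> S \<Longrightarrow> f z = 0" "\<And>z. z \<notin> S \<Longrightarrow> g z = 0" "\<And>z. \<bar>f z\<bar> \<le> g z"
  shows "\<bar>integral UNIV f\<bar> \<le> integral UNIV g"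
  using integral_norm_bound_integral[of f UNIV g] integrable_on_supported[of S] assms by auto

text \<open>336 bounds the derivative of the bump of unit radius, \<open>exp (- (4 / 3))\<close> is
  the lower bound of the weight on the half ball, the power of 2 comes from doubling the radius, the
  4 from working at radius r/4, and the dimension from summing over coordinates.\<close>

definition gradient_const :: "'a::euclidean_space itself \<Rightarrow> real" where
  "gradient_const _ = real DIM('a) * (4 * (336 * 2 ^ DIM('a) / exp (- (4 / 3))))"

text \<open>Apply the mean value property to the harmonic function \<open>pd UNIV i f\<close> at
  radius t = r/4 and integrate by parts, so that the derivative falls on the weight. The result is
  compared with the weight of radius 2t, whose integral is known.\<close>

lemma pd_estimate:
  fixes f :: "'a::euclidean_space \<Rightarrow> real"
  assumes W: "open W" "harmonic_on W f" and r: "r > 0" "cball x r \<subseteq> W"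
    and B: "\<And>z. z \<in> cball x r \<Longrightarrow> \<bar>f z\<bar> \<le> B" and i: "i \<in> Basis"
  shows "\<bar>pd UNIV i f x\<bar> \<le> 4 * (336 * 2 ^ DIM('a) / exp (- (4 / 3))) / r * B"
proof -
  define t where "t = r / 4"
  have t: "t > 0" "t < r" "2 * t < r" using r by (auto simp: t_def)
  let ?n = "DIM('a)" and ?\<beta> = "exp (- (4 / 3)) :: real" and ?c = "bump_mass TYPE('a)"
  let ?\<eta> = "bump_fn 2 x t"
  have f2: "Ck_on 2 W f" using W by (simp add: harmonic_on_def)
  have f1: "Ck_on 1 W f" using Ck_on_le[OF _ f2, of 1] by simp
  have sub: "cball x t \<subseteq> W" using r(2) t subset_cball[of t r x] by auto
  have B0: "B \<ge> 0" using B[of x] r by force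
  have "t ^ ?n * ?c * pd UNIV i f x = integral UNIV (\<lambda>z. pd UNIV i f z * ?\<eta> z)"
    using mean_value_property[OF W(1) harmonic_on_pd[OF W i] r(2) t(1,2)] by simp
  also have "\<dots> = - integral UNIV (\<lambda>z. f z * pd UNIV i ?\<eta> z)"
    by (rule integration_by_parts[OF W(1) f1 compact_cball sub Ck_on_bump_fn _ i])
      (use t bump_fn_outside in auto)
  finally have 1: "t ^ ?n * ?c * pd UNIV i f x = - integral UNIV (\<lambda>z. f z * pd UNIV i ?\<eta> z)" .
  have pd0: "pd UNIV i ?\<eta> z = 0" if "z \<notin> cball x t" for z
    by (rule pd_eq_0_outside[OF closed_cball _ that]) (use bump_fn_outside t in auto)
  have "\<bar>integral UNIV (\<lambda>z. f z * pd UNIV i ?\<eta> z)\<bar> \<le> integral UNIV (\<lambda>z. (B * (336 / t / ?\<beta>)) * bump_fn 2 x (2 * t) z)"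
  proof (rule integral_weighted_mono[of "cball x (2 * t)"])
    show "continuous_on UNIV (\<lambda>z. f z * pd UNIV i ?\<eta> z)"
      by (rule continuous_on_supported_mult[OF W(1) Ck_on_imp_continuous_on[OF f2] closed_cball sub])
       (use pd0 Ck_on_2D(4)[OF open_UNIV Ck_on_bump_fn[OF t(1)] i] in auto)
    show "continuous_on UNIV (\<lambda>z. (B * (336 / t / ?\<beta>)) * bump_fn 2 x (2 * t) z)"
      using t by (intro continuous_intros continuous_on_bump_fn) auto
  next
    fix z assume "z \<notin> cball x (2 * t)"
    then show "f z * pd UNIV i ?\<eta> z = 0" "(B * (336 / t / ?\<beta>)) * bump_fn 2 x (2 * t) z = 0"
      using t pd0[of z] bump_fn_outside[of "2 * t" z x 2] by auto
  next
    fix z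
    show "\<bar>f z * pd UNIV i ?\<eta> z\<bar> \<le> (B * (336 / t / ?\<beta>)) * bump_fn 2 x (2 * t) z"
    proof (cases "z \<in> cball x t")
      case False
      then show ?thesis using pd0 B0 t bump_fn_nonneg[of 2 x "2 * t" z] by simp
    next
      case True
      have "\<bar>(z - x) \<bullet> i\<bar> \<le> t"
        using Basis_le_norm[OF i, of "z - x"] True by (simp add: dist_norm norm_minus_commute)
      then have a: "\<bar>- 2 / t\<^sup>2 * ((z - x) \<bullet> i)\<bar> \<le> 2 / t"
        using t by (simp add: abs_mult field_simps power2_eq_square)
      have "\<bar>bump_fn 4 x t z - 2 * bump_fn 3 x t z\<bar> \<le> \<bar>bump_fn 4 x t z\<bar> + 2 * \<bar>bump_fn 3 x t z\<bar>" by linarith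
      also have "\<dots> \<le> fact (Suc 4) + 2 * fact (Suc 3)"
        using bump_fn_upper[of 4 x t z] bump_fn_upper[of 3 x t z] bump_fn_nonneg[of 4 x t z] bump_fn_nonneg[of 3 x t z]
        by (simp del: fact_Suc)
      also have "\<dots> = 168" by (simp add: fact_numeral)
      finally have b: "\<bar>bump_fn 4 x t z - 2 * bump_fn 3 x t z\<bar> \<le> 168" .
      have n: "(2::nat) + 2 = 4" "(2::nat) + 1 = 3" by auto
      have "\<bar>pd UNIV i ?\<eta> z\<bar> = \<bar>bump_fn 4 x t z - 2 * bump_fn 3 x t z\<bar> * \<bar>- 2 / t\<^sup>2 * ((z - x) \<bullet> i)\<bar>"
        using pd_bump_fn[OF t(1), of i 2 x z, unfolded n] by (simp add: abs_mult)
      also have "\<dots> \<le> 168 * (2 / t)" using a b by (intro mult_mono) auto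
      finally have c: "\<bar>pd UNIV i ?\<eta> z\<bar> \<le> 336 / t" by simp
      have d: "1 \<le> bump_fn 2 x (2 * t) z / ?\<beta>"
        using bump_fn_lower[of "2 * t" x z] True t by (simp add: le_divide_eq)
      have "\<bar>f z\<bar> \<le> B" using B[of z] True t by auto
      then have "\<bar>f z * pd UNIV i ?\<eta> z\<bar> \<le> B * (336 / t)"
        unfolding abs_mult using c B0 by (intro mult_mono) auto
      also have "\<dots> \<le> B * (336 / t) * (bump_fn 2 x (2 * t) z / ?\<beta>)"
        using mult_left_mono[OF d, of "B * (336 / t)"] B0 t by simp
      finally show ?thesis by simp
    qed
  qed auto
  also have "\<dots> = (B * (336 / t / ?\<beta>)) * ((2 * t) ^ ?n * ?c)"
    using integral_bump_fn[of "2 * t" x] t by (simp add: field_simps)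
  finally have 2: "\<bar>integral UNIV (\<lambda>z. f z * pd UNIV i ?\<eta> z)\<bar> \<le> (B * (336 / t / ?\<beta>)) * ((2 * t) ^ ?n * ?c)" .
  have tc: "t ^ ?n * ?c > 0" using t bump_mass_pos[where 'a='a] by simp
  have "t ^ ?n * ?c * \<bar>pd UNIV i f x\<bar> = \<bar>t ^ ?n * ?c * pd UNIV i f x\<bar>"
    unfolding abs_mult[of "t ^ ?n * ?c"] abs_of_pos[OF tc] ..
  also have "\<dots> \<le> (B * (336 / t / ?\<beta>)) * ((2 * t) ^ ?n * ?c)"
    unfolding 1 abs_minus_cancel by (rule 2)
  also have "\<dots> = t ^ ?n * ?c * ((B * (336 / t / ?\<beta>)) * 2 ^ ?n)"
    by (simp add: power_mult_distrib algebra_simps)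
  finally have "\<bar>pd UNIV i f x\<bar> \<le> (B * (336 / t / ?\<beta>)) * 2 ^ ?n"
    unfolding mult_le_cancel_left_pos[OF tc] .
  also have "\<dots> = 4 * (336 * 2 ^ DIM('a) / ?\<beta>) / r * B" by (simp add: t_def mult.commute)
  finally show ?thesis .
qed

lemma ddir_estimate:
  fixes f :: "'a::euclidean_space \<Rightarrow> real"
  assumes W: "open W" "harmonic_on W f" and r: "r > 0" "cball x r \<subseteq> W"
    and B: "\<And>z. z \<in> cball x r \<Longrightarrow> \<bar>f z\<bar> \<le> B" and e: "norm e = 1"
  shows "\<bar>ddir e f x\<bar> \<le> gradient_const TYPE('a) / r * B"
proof -
  let ?C = "4 * (336 * 2 ^ DIM('a) / exp (- (4 / 3))) / r * B"
  have "\<bar>ddir e f x\<bar> \<le> (\<Sum>i\<in>Basis. \<bar>(e \<bullet> i) * pd UNIV i f x\<bar>)"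
    unfolding ddir_eq_sum by (rule sum_abs)
  also have "\<dots> \<le> (\<Sum>i\<in>(Basis :: 'a set). ?C)"
  proof (rule sum_mono)
    fix i :: 'a assume i: "i \<in> Basis"
    have "\<bar>e \<bullet> i\<bar> * \<bar>pd UNIV i f x\<bar> \<le> 1 * ?C"
      using Basis_le_norm[OF i, of e] e pd_estimate[OF W r B i] by (intro mult_mono) auto
    then show "\<bar>(e \<bullet> i) * pd UNIV i f x\<bar> \<le> ?C" by (simp add: abs_mult)
  qed
  also have "\<dots> = gradient_const TYPE('a) / r * B" by (simp add: gradient_const_def)
  finally show ?thesis .
qed

text \<open>The weight of radius \<open>s\<close> at \<open>x\<close> is at most 6/exp(-4/3) times
  the weight of radius \<open>4 * s\<close> at \<open>y\<close>: points of \<open>cball x s\<close>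
  are within \<open>2 * s\<close> of \<open>y\<close>, where \<open>bump_fn_lower\<close> applies,
  and 6 = 3! bounds \<open>bump 2\<close>. The ratio of the radii contributes the power of
  4.\<close>

lemma harnack_local:
  fixes f :: "'a::euclidean_space \<Rightarrow> real"
  assumes W: "open W" "harmonic_on W f" and s: "s > 0" "cball y (5 * s) \<subseteq> W"
    and pos: "\<And>z. z \<in> W \<Longrightarrow> f z \<ge> 0" and x: "dist y x \<le> s"
  shows "f x \<le> 6 / exp (- (4 / 3)) * 4 ^ DIM('a) * f y"
proof -
  let ?n = "DIM('a)" and ?\<beta> = "exp (- (4 / 3)) :: real" and ?c = "bump_mass TYPE('a)"
  have cf: "continuous_on W f" by (rule harmonic_on_imp_continuous_on[OF W(2)])
  have s1: "cball x (2 * s) \<subseteq> cball y (5 * s)"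
  proof
    fix z assume "z \<in> cball x (2 * s)"
    then show "z \<in> cball y (5 * s)" using x s(1) dist_triangle[of y z x] by simp
  qed
  have sx: "cball x s \<subseteq> W" and sy: "cball y (4 * s) \<subseteq> W" "cball x s \<subseteq> cball y (4 * s)"
  proof -
    show "cball x s \<subseteq> W" using s1 s subset_cball[of s "2 * s" x] by auto
    show "cball y (4 * s) \<subseteq> W" using s subset_cball[of "4 * s" "5 * s" y] by auto
    show "cball x s \<subseteq> cball y (4 * s)"
    proof
      fix z assume "z \<in> cball x s"
      then show "z \<in> cball y (4 * s)" using x s(1) dist_triangle[of y z x] by simp
    qed
  qed
  have "s ^ ?n * ?c * f x = integral UNIV (\<lambda>z. f z * bump_fn 2 x s z)"
    by (rule mean_value_property[OF W, symmetric, of _ "2 * s"]) (use s1 s in auto)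
  also have "\<dots> \<le> \<bar>\<dots>\<bar>" by simp
  also have "\<dots> \<le> integral UNIV (\<lambda>z. (6 / ?\<beta>) * (f z * bump_fn 2 y (4 * s) z))"
  proof (rule integral_weighted_mono[of "cball y (4 * s)"])
    show "continuous_on UNIV (\<lambda>z. f z * bump_fn 2 x s z)"
      by (rule continuous_on_supported_mult[OF W(1) cf closed_cball sx])
        (use s in \<open>auto intro!: continuous_on_bump_fn bump_fn_outside\<close>)
    show "continuous_on UNIV (\<lambda>z. (6 / ?\<beta>) * (f z * bump_fn 2 y (4 * s) z))"
      by (intro continuous_on_mult_left continuous_on_supported_mult[OF W(1) cf closed_cball sy(1)])
        (use s in \<open>auto intro!: continuous_on_bump_fn bump_fn_outside\<close>)
  next
    fix z assume z: "z \<notin> cball y (4 * s)"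
    have "z \<notin> cball x s" using z sy(2) by blast
    then show "f z * bump_fn 2 x s z = 0" using s(1) bump_fn_outside[of s z x 2] by simp
    show "(6 / ?\<beta>) * (f z * bump_fn 2 y (4 * s) z) = 0"
      using z s(1) bump_fn_outside[of "4 * s" z y 2] by auto
  next
    fix z
    show "\<bar>f z * bump_fn 2 x s z\<bar> \<le> (6 / ?\<beta>) * (f z * bump_fn 2 y (4 * s) z)"
    proof (cases "z \<in> cball x s")
      case False
      then have 0: "bump_fn 2 x s z = 0" using bump_fn_outside s by auto
      have "f z * bump_fn 2 y (4 * s) z \<ge> 0"
      proof (cases "z \<in> cball y (4 * s)")
        case True
        then show ?thesis using pos[of z] sy(1) bump_fn_nonneg[of 2 y "4 * s" z] by auto
      next
        case False
        then show ?thesis using bump_fn_outside[of "4 * s" z y 2] s by auto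
      qed
      then show ?thesis using 0 by simp
    next
      case True
      then have f0: "f z \<ge> 0" using sx pos by auto
      have "dist y z \<le> (4 * s) / 2" using True x dist_triangle[of y z x] by simp
      then have "1 \<le> bump_fn 2 y (4 * s) z / ?\<beta>"
        using bump_fn_lower[of "4 * s" y z] s by (simp add: le_divide_eq)
      moreover have "bump_fn 2 x s z \<le> 6" using bump_fn_upper[of 2 x s z] by (simp add: fact_numeral)
      ultimately have "bump_fn 2 x s z \<le> 6 * (bump_fn 2 y (4 * s) z / ?\<beta>)" by linarith
      then have "f z * bump_fn 2 x s z \<le> f z * (6 * (bump_fn 2 y (4 * s) z / ?\<beta>))"
        using f0 by (rule mult_left_mono)
      moreover have "f z * bump_fn 2 x s z \<ge> 0" using f0 by (intro mult_nonneg_nonneg bump_fn_nonneg)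
      ultimately show ?thesis by (simp add: mult.commute mult.left_commute)
    qed
  qed auto
  also have "\<dots> = 6 / ?\<beta> * integral UNIV (\<lambda>z. f z * bump_fn 2 y (4 * s) z)" by simp
  also have "integral UNIV (\<lambda>z. f z * bump_fn 2 y (4 * s) z) = (4 * s) ^ ?n * ?c * f y"
    by (rule mean_value_property[OF W s(2)]) (use s in auto)
  finally have "(s ^ ?n * ?c) * f x \<le> (s ^ ?n * ?c) * (6 / ?\<beta> * 4 ^ ?n * f y)"
    by (simp add: power_mult_distrib algebra_simps)
  moreover have "s ^ ?n * ?c > 0" using s bump_mass_pos[where 'a='a] by simp
  ultimately show ?thesis by (simp only: mult_le_cancel_left_pos)
qed

subsection \<open>Unique continuation\<close>

lemma gradient_const_ge_1: "gradient_const TYPE('a::euclidean_space) \<ge> 1"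
proof -
  have "1 \<le> real DIM('a) * 1" using DIM_positive[where 'a='a] by linarith
  moreover have "(1::real) \<le> 4 * (336 * 2 ^ DIM('a) / exp (- (4 / 3)))"
  proof -
    have "exp (- (4 / 3) :: real) \<le> 1" by simp
    moreover have "(1::real) \<le> 4 * 336 * 2 ^ DIM('a)"
    proof -
      have "(1::real) \<le> 2 ^ DIM('a)" by (rule one_le_power) simp
      then show ?thesis by linarith
    qed
    ultimately have "exp (- (4 / 3) :: real) \<le> 4 * 336 * 2 ^ DIM('a)" by (rule order_trans)
    then show ?thesis by (simp add: le_divide_eq)
  qed
  ultimately show ?thesis unfolding gradient_const_def
    using mult_mono[of 1 "real DIM('a)" 1 "4 * (336 * 2 ^ DIM('a) / exp (- (4 / 3)))"] by simp
qed

text \<open>Each of the \<open>k\<close> differentiations costs a distance R/(2k), so after all of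
  them half of the radius is left. This equal division gives the growth k^k, comparable to k! up to
  a geometric factor.\<close>

lemma ddir_funpow_estimate:
  fixes f :: "'a::euclidean_space \<Rightarrow> real" and k :: nat
  assumes W: "open W" "harmonic_on W f" and R: "R > 0" "cball x R \<subseteq> W"
    and B: "\<And>z. z \<in> cball x R \<Longrightarrow> \<bar>f z\<bar> \<le> B" and e: "norm e = 1" and k: "k > 0"
  shows "j \<le> k \<Longrightarrow> z \<in> cball x (R - j * (R / (2 * k))) \<Longrightarrow>
    \<bar>(ddir e ^^ j) f z\<bar> \<le> (gradient_const TYPE('a) / (R / (2 * k))) ^ j * B"
proof (induction j arbitrary: z)
  case 0
  then show ?case using B by simp
next
  case (Suc j)
  let ?r = "R / (2 * k)" and ?C = "gradient_const TYPE('a)"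
  have r: "?r > 0" using R k by simp
  have sub: "cball z ?r \<subseteq> cball x (R - j * ?r)"
  proof
    fix y assume y: "y \<in> cball z ?r"
    have "real (Suc j) * ?r = real j * ?r + ?r"
      by (simp only: of_nat_Suc distrib_right mult_1_left add.commute)
    then show "y \<in> cball x (R - j * ?r)" using y Suc.prems(2) dist_triangle[of x y z] by simp
  qed
  have "cball x (R - j * ?r) \<subseteq> W" using r R(2) subset_cball[of "R - j * ?r" R x] by (meson diff_le_eq le_add_same_cancel1 less_imp_le mult_nonneg_nonneg of_nat_0_le_iff subset_trans)
  then have "cball z ?r \<subseteq> W" using sub by blast
  then have "\<bar>ddir e ((ddir e ^^ j) f) z\<bar> \<le> ?C / ?r * ((?C / ?r) ^ j * B)"
    by (intro ddir_estimate[OF W(1) harmonic_on_ddir_funpow[OF W] r _ _ e] Suc.IH)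
      (use sub Suc.prems(1) in auto)
  then show ?case by simp
qed

text \<open>k^k / k! is one term of the exponential series at k.\<close>

lemma power_self_le_fact: "real k ^ k \<le> exp 1 ^ k * fact k"
proof -
  have s: "(\<lambda>n. real k ^ n /\<^sub>R fact n) sums exp (real k)" by (rule exp_converges)
  have "(\<Sum>n\<in>{k}. real k ^ n /\<^sub>R fact n) \<le> (\<Sum>n. real k ^ n /\<^sub>R fact n)"
    by (rule sum_le_suminf) (use s in \<open>auto simp: sums_iff\<close>)
  then have "real k ^ k / fact k \<le> exp (real k)" using s by (simp add: sums_iff divide_inverse mult.commute)
  then show ?thesis by (simp add: divide_le_eq exp_of_nat_mult[symmetric])
qed

text \<open>All derivatives vanish at \<open>x\<close>, so Taylor's formula along the segment to
  \<open>y\<close> leaves only the remainder. By the derivative estimates it decays geometrically.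
  The radius obtained does not depend on \<delta>, which is what unique continuation
  exploits.\<close>

lemma harmonic_on_zero_ball:
  fixes f :: "'a::euclidean_space \<Rightarrow> real"
  assumes W: "open W" "harmonic_on W f" and R: "R > 0" "cball x R \<subseteq> W"
    and \<delta>: "\<delta> > 0" "\<And>z. z \<in> ball x \<delta> \<Longrightarrow> f z = 0"
    and y: "dist x y < R / (8 * gradient_const TYPE('a))"
  shows "f y = 0"
proof (cases "y = x")
  case True
  then show ?thesis using \<delta> by simp
next
  case False
  let ?C = "gradient_const TYPE('a)"
  define h where "h = dist x y"
  define e where "e = (y - x) /\<^sub>R h"
  have h: "h > 0" "h < R / (8 * ?C)" using False y by (auto simp: h_def)
  have C: "?C \<ge> 1" by (rule gradient_const_ge_1)
  have e: "norm e = 1" using h(1) by (simp add: e_def h_def dist_norm norm_minus_commute)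
  have ye: "y = x + h *\<^sub>R e" using h(1) by (simp add: e_def)
  have hR: "h \<le> R / 2"
  proof -
    have "R / (8 * ?C) \<le> R / 2" using C R by (intro divide_left_mono) auto
    then show ?thesis using h by linarith
  qed
  obtain B where B: "\<And>z. z \<in> cball x R \<Longrightarrow> \<bar>f z\<bar> \<le> B"
  proof -
    have "compact (f ` cball x R)"
      using harmonic_on_imp_continuous_on[OF W(2)] R(2) continuous_on_subset
      by (intro compact_continuous_image) auto
    then have "bounded (f ` cball x R)" by (rule compact_imp_bounded)
    then obtain B where "\<And>y. y \<in> f ` cball x R \<Longrightarrow> norm y \<le> B" unfolding bounded_iff by blast
    then show ?thesis using that[of B] by (metis image_eqI real_norm_def)
  qed
  have z: "(ddir e ^^ j) f z = 0" if "z \<in> ball x \<delta>" for j z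
    using that
  proof (induction j arbitrary: z)
    case (Suc j)
    have "pd UNIV i ((ddir e ^^ j) f) z = 0" for i
    proof -
      have "pd UNIV i ((ddir e ^^ j) f) z = pd UNIV i (\<lambda>_. 0) z"
        by (rule pd_cong_open[OF open_ball Suc.IH Suc.prems])
      then show ?thesis by (simp add: pd_eqI[OF has_derivative_const])
    qed
    then show ?case using ddir_eq_sum[of e "(ddir e ^^ j) f" z] by simp
  qed (use \<delta> in auto)
  let ?q = "3 / 4 :: real"
  have bound: "\<bar>f y\<bar> \<le> B * ?q ^ k" if k: "k > 0" for k
  proof -
    let ?d = "\<lambda>m t. (ddir e ^^ m) f (x + t *\<^sub>R e)"
    have der: "DERIV (?d m) t :> ?d (Suc m) t" if "0 \<le> t" "t \<le> h" for m t
    proof -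
      have "dist x (x + t *\<^sub>R e) \<le> R" using that e hR R by (simp add: dist_norm)
      then have "x + t *\<^sub>R e \<in> W" using R(2) by auto
      then have "(ddir e ^^ m) f differentiable (at (x + t *\<^sub>R e))"
        by (rule harmonic_on_imp_differentiable[OF W(1) harmonic_on_ddir_funpow[OF W]])
      from has_real_derivative_line[OF has_derivative_grad[OF this]]
      show ?thesis by (simp add: ddir_def)
    qed
    obtain t where t: "0 < t" "t < h"
      "?d 0 h = (\<Sum>m<k. ?d m 0 / fact m * h ^ m) + ?d k t / fact k * h ^ k"
      using Maclaurin[OF h(1) k, of ?d "?d 0"] der by auto
    have "(\<Sum>m<k. ?d m 0 / fact m * h ^ m) = 0" using z[of x] \<delta> by simp
    then have fy: "f y = ?d k t / fact k * h ^ k" using t(3) ye by simp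
    have "dist x (x + t *\<^sub>R e) \<le> R / 2" using t e hR by (simp add: dist_norm)
    then have "x + t *\<^sub>R e \<in> cball x (R - k * (R / (2 * k)))" using k by simp
    then have "\<bar>?d k t\<bar> \<le> (?C / (R / (2 * k))) ^ k * B"
      using ddir_funpow_estimate[OF W R B e k, of k "x + t *\<^sub>R e"] by simp
    then have le: "\<bar>?d k t\<bar> / fact k * h ^ k \<le> ((?C / (R / (2 * k))) ^ k * B) / fact k * h ^ k"
      using h(1) by (intro mult_right_mono divide_right_mono) auto
    have "\<bar>f y\<bar> = \<bar>?d k t\<bar> / fact k * h ^ k"
      unfolding fy using h(1) by (simp add: abs_mult)
    also have "\<dots> \<le> ((?C / (R / (2 * k))) ^ k * B) / fact k * h ^ k" by (rule le)
    also have "\<dots> = B * ((2 * ?C * h / R) ^ k * (real k ^ k / fact k))"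
      by (simp add: power_mult_distrib power_divide field_simps)
    also have "\<dots> \<le> B * ((2 * ?C * h / R) ^ k * exp 1 ^ k)"
    proof -
      have "B \<ge> 0" using B[of x] R(1) by force
      moreover have "real k ^ k / fact k \<le> exp 1 ^ k" using power_self_le_fact[of k] by (simp add: divide_le_eq)
      ultimately show ?thesis using C h R by (intro mult_left_mono) auto
    qed
    also have "\<dots> = B * (2 * ?C * h / R * exp 1) ^ k" by (simp only: power_mult_distrib)
    also have "\<dots> \<le> B * ?q ^ k"
    proof (intro mult_left_mono power_mono)
      show "B \<ge> 0" using B[of x] R(1) by force
      \<comment> \<open>The factor 8 in the radius is chosen here: 1/4 times e is at most
        3/4.\<close>
      have "2 * ?C * h / R \<le> 1 / 4" using h(2) C R by (simp add: field_simps)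
      then have "2 * ?C * h / R * exp 1 \<le> 1 / 4 * 3"
        using exp_le C h R by (intro mult_mono) auto
      then show "2 * ?C * h / R * exp 1 \<le> ?q" by simp
    qed (use C h R in auto)
    finally show ?thesis .
  qed
  have "(\<lambda>k. B * ?q ^ k) \<longlonglongrightarrow> B * 0"
    by (intro tendsto_mult_left LIMSEQ_realpow_zero) auto
  then have "\<bar>f y\<bar> \<le> B * 0"
    by (rule Lim_bounded2[where N=1]) (use bound in auto)
  then show ?thesis by simp
qed

text \<open>The interior \<open>Z\<close> of the zero set is relatively closed: near a limit point
  \<open>z\<close> of \<open>Z\<close> all centers admit the same radius \<rho>, hence the same zero
  radius \<open>s\<close>, so a center within \<open>s\<close> of \<open>z\<close> has
  \<open>z\<close> in its zero ball.\<close>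

theorem harmonic_on_unique_continuation:
  fixes f :: "'a::euclidean_space \<Rightarrow> real"
  assumes W: "open W" "connected W" "harmonic_on W f"
    and \<delta>: "\<delta> > 0" "ball x0 \<delta> \<subseteq> W" "\<And>z. z \<in> ball x0 \<delta> \<Longrightarrow> f z = 0"
    and x: "x \<in> W"
  shows "f x = 0"
proof -
  let ?C = "gradient_const TYPE('a)"
  define Z where "Z = interior {z \<in> W. f z = 0}"
  have C: "?C \<ge> 1" by (rule gradient_const_ge_1)
  have cl: "z \<in> Z" if z: "z \<in> W" "z \<in> closure Z" for z
  proof -
    obtain r where r: "r > 0" "cball z r \<subseteq> W" using W(1) z(1) open_contains_cball by blast
    define \<rho> where "\<rho> = r / 2"
    define s where "s = \<rho> / (8 * ?C)"
    have \<rho>: "\<rho> > 0" using r by (simp add: \<rho>_def)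
    have s: "s > 0" "s \<le> \<rho>" using \<rho> C by (auto simp: s_def divide_le_eq)
    obtain x1 where x1: "x1 \<in> Z" "dist x1 z < s" using z(2) s(1) closure_approachable by blast
    have "cball x1 \<rho> \<subseteq> cball z r"
    proof
      fix y assume "y \<in> cball x1 \<rho>"
      then show "y \<in> cball z r" using x1(2) s(2) dist_triangle[of z y x1] by (simp add: \<rho>_def dist_commute)
    qed
    then have sub: "cball x1 \<rho> \<subseteq> W" using r(2) by blast
    have "open Z" by (simp add: Z_def)
    then obtain d where d: "d > 0" "ball x1 d \<subseteq> Z" using x1(1) open_contains_ball by blast
    have "f y = 0" if "y \<in> ball x1 d" for y using that d(2) interior_subset unfolding Z_def by fastforce
    then have "f y = 0" if "y \<in> ball x1 s" for y
      using harmonic_on_zero_ball[OF W(1,3) \<rho> sub d(1)] that by (simp add: s_def)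
    moreover have "ball x1 s \<subseteq> W" using sub s(2) by (auto simp: subset_iff)
    ultimately have "ball x1 s \<subseteq> Z" unfolding Z_def by (intro interior_maximal) auto
    then show ?thesis using x1(2) by auto
  qed
  have "Z \<inter> W = {} \<or> (W \<inter> - closure Z) \<inter> W = {}"
    by (rule connectedD[OF W(2)]) (use cl W(1) in \<open>auto simp: Z_def intro: closure_subset[THEN subsetD]\<close>)
  moreover have "x0 \<in> Z"
    unfolding Z_def by (rule interiorI[OF open_ball, of _ x0 \<delta>]) (use \<delta> in auto)
  moreover have "x0 \<in> W" using \<delta> by auto
  ultimately have "x \<in> closure Z" using x by blast
  then have "x \<in> Z" using cl x by blast
  then show ?thesis using interior_subset unfolding Z_def by blast
qed

section \<open>Maximum principles\<close>

text \<open>\<open>g\<close> and \<open>l\<close> are gradient and Laplacian of \<open>f\<close> at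
  \<open>x\<close>. Only a gradient near \<open>x\<close> that is differentiable at \<open>x\<close>
  is required. This is all a maximum principle uses, and it gives product and chain rules with
  explicit values.\<close>

definition has_lap :: "('a::euclidean_space \<Rightarrow> real) \<Rightarrow> 'a \<Rightarrow> 'a \<Rightarrow> real \<Rightarrow> bool" where
  "has_lap f x g l \<longleftrightarrow> (\<exists>D G. (\<forall>\<^sub>F y in nhds x. (f has_derivative (\<lambda>v. D y \<bullet> v)) (at y)) \<and>
     (D has_derivative G) (at x) \<and> D x = g \<and> (\<Sum>i\<in>Basis. G i \<bullet> i) = l)"

lemma has_lap_derivative: "has_lap f x g l \<Longrightarrow> (f has_derivative (\<lambda>v. g \<bullet> v)) (at x)"
  unfolding has_lap_def by (auto dest: eventually_nhds_x_imp_x)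

lemma has_lap_cong:
  assumes "has_lap f x g l" "\<forall>\<^sub>F y in nhds x. f y = h y"
  shows "has_lap h x g l"
proof -
  obtain D G where D: "\<forall>\<^sub>F y in nhds x. (f has_derivative (\<lambda>v. D y \<bullet> v)) (at y)"
    "(D has_derivative G) (at x)" "D x = g" "(\<Sum>i\<in>Basis. G i \<bullet> i) = l"
    using assms(1) unfolding has_lap_def by blast
  obtain U where U: "open U" "x \<in> U" "\<And>y. y \<in> U \<Longrightarrow> f y = h y"
    using assms(2) unfolding eventually_nhds by blast
  have "\<forall>\<^sub>F y in nhds x. y \<in> U" using U(1,2) by (rule eventually_nhds_in_open)
  then have "\<forall>\<^sub>F y in nhds x. (h has_derivative (\<lambda>v. D y \<bullet> v)) (at y)"
    using D(1) by eventually_elim (use has_derivative_cong_open[of U f h] U in blast)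
  then show ?thesis unfolding has_lap_def using D by blast
qed

lemma has_lap_Ck_on:
  assumes W: "open W" "Ck_on 2 W f" "x \<in> W"
  shows "has_lap f x (grad UNIV f x) (laplacian UNIV f x)"
proof -
  note f = Ck_on_2D[OF W(1,2)]
  have 1: "\<forall>\<^sub>F y in nhds x. (f has_derivative (\<lambda>v. grad UNIV f y \<bullet> v)) (at y)"
    using eventually_nhds_in_open[OF W(1,3)]
    by eventually_elim (rule has_derivative_grad[OF f(1)])
  have 2: "(grad UNIV f has_derivative (\<lambda>v. \<Sum>i\<in>Basis. (grad UNIV (pd UNIV i f) x \<bullet> v) *\<^sub>R i)) (at x)"
    unfolding grad_def[of UNIV f, abs_def]
    by (intro has_derivative_sum has_derivative_scaleR_left has_derivative_grad f(2) W(3))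
  have "(\<Sum>j\<in>Basis. (\<Sum>i\<in>Basis. (grad UNIV (pd UNIV i f) x \<bullet> j) *\<^sub>R i) \<bullet> j) = laplacian UNIV f x"
    unfolding laplacian_def by (rule sum.cong) (simp_all add: grad_inner_Basis)
  then show ?thesis unfolding has_lap_def using 1 2 by blast
qed

lemma has_lap_add:
  assumes "has_lap f x g l" "has_lap f' x g' l'"
  shows "has_lap (\<lambda>x. f x + f' x) x (g + g') (l + l')"
proof -
  obtain D G where D: "\<forall>\<^sub>F y in nhds x. (f has_derivative (\<lambda>v. D y \<bullet> v)) (at y)"
    "(D has_derivative G) (at x)" "D x = g" "(\<Sum>i\<in>Basis. G i \<bullet> i) = l"
    using assms(1) unfolding has_lap_def by blast
  obtain D' G' where D': "\<forall>\<^sub>F y in nhds x. (f' has_derivative (\<lambda>v. D' y \<bullet> v)) (at y)"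
    "(D' has_derivative G') (at x)" "D' x = g'" "(\<Sum>i\<in>Basis. G' i \<bullet> i) = l'"
    using assms(2) unfolding has_lap_def by blast
  have "\<forall>\<^sub>F y in nhds x. ((\<lambda>x. f x + f' x) has_derivative (\<lambda>v. (D y + D' y) \<bullet> v)) (at y)"
    using D(1) D'(1) by eventually_elim (auto simp: inner_add_left intro: has_derivative_add)
  moreover have "((\<lambda>y. D y + D' y) has_derivative (\<lambda>v. G v + G' v)) (at x)"
    by (intro has_derivative_add D D')
  moreover have "(\<Sum>i\<in>Basis. (G i + G' i) \<bullet> i) = l + l'"
    using D D' by (simp add: inner_add_left sum.distrib)
  ultimately show ?thesis unfolding has_lap_def using D(3) D'(3)
    by (intro exI[of _ "\<lambda>y. D y + D' y"] exI[of _ "\<lambda>v. G v + G' v"]) auto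
qed

lemma has_lapI:
  assumes "\<forall>\<^sub>F y in nhds x. (f has_derivative (\<lambda>v. D y \<bullet> v)) (at y)"
    "(D has_derivative G) (at x)" "D x = g" "(\<Sum>i\<in>Basis. G i \<bullet> i) = l"
  shows "has_lap f x g l"
  using assms unfolding has_lap_def by blast

lemma has_lap_const: "has_lap (\<lambda>_. c) x 0 0"
proof (rule has_lapI[where D="\<lambda>_. 0" and G="\<lambda>_. 0"])
  show "\<forall>\<^sub>F y in nhds x. ((\<lambda>_. c) has_derivative (\<lambda>v. 0 \<bullet> v)) (at y)"
    by (rule always_eventually) (simp only: inner_zero_left has_derivative_const simp_thms)
qed auto

lemma has_lap_mult:
  assumes "has_lap f x g l" "has_lap f' x g' l'"
  shows "has_lap (\<lambda>x. f x * f' x) x (f x *\<^sub>R g' + f' x *\<^sub>R g) (f x * l' + f' x * l + 2 * (g \<bullet> g'))"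
proof -
  obtain D G where D: "\<forall>\<^sub>F y in nhds x. (f has_derivative (\<lambda>v. D y \<bullet> v)) (at y)"
    "(D has_derivative G) (at x)" "D x = g" "(\<Sum>i\<in>Basis. G i \<bullet> i) = l"
    using assms(1) unfolding has_lap_def by blast
  obtain D' G' where D': "\<forall>\<^sub>F y in nhds x. (f' has_derivative (\<lambda>v. D' y \<bullet> v)) (at y)"
    "(D' has_derivative G') (at x)" "D' x = g'" "(\<Sum>i\<in>Basis. G' i \<bullet> i) = l'"
    using assms(2) unfolding has_lap_def by blast
  let ?E = "\<lambda>y. f y *\<^sub>R D' y + f' y *\<^sub>R D y"
  let ?H = "\<lambda>v. (f x *\<^sub>R G' v + (g \<bullet> v) *\<^sub>R g') + (f' x *\<^sub>R G v + (g' \<bullet> v) *\<^sub>R g)"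
  have "\<forall>\<^sub>F y in nhds x. ((\<lambda>x. f x * f' x) has_derivative (\<lambda>v. ?E y \<bullet> v)) (at y)"
    using D(1) D'(1)
  proof eventually_elim
    case (elim y)
    have "((\<lambda>x. f x * f' x) has_derivative (\<lambda>v. f y * (D' y \<bullet> v) + (D y \<bullet> v) * f' y)) (at y)"
      by (rule has_derivative_mult[OF elim])
    moreover have "(\<lambda>v. ?E y \<bullet> v) = (\<lambda>v. f y * (D' y \<bullet> v) + (D y \<bullet> v) * f' y)"
      by (rule ext) (simp add: inner_add_left)
    ultimately show ?case by simp
  qed
  moreover have "(?E has_derivative ?H) (at x)"
    using has_derivative_add[OF has_derivative_scaleR[OF has_lap_derivative[OF assms(1)] D'(2)]
       has_derivative_scaleR[OF has_lap_derivative[OF assms(2)] D(2)]] D(3) D'(3) by simp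
  moreover have "(\<Sum>i\<in>Basis. ?H i \<bullet> i) = f x * l' + f' x * l + 2 * (g \<bullet> g')"
  proof -
    have "(\<Sum>i\<in>Basis. ?H i \<bullet> i) = f x * (\<Sum>i\<in>Basis. G' i \<bullet> i) + f' x * (\<Sum>i\<in>Basis. G i \<bullet> i)
       + ((\<Sum>i\<in>Basis. (g \<bullet> i) * (g' \<bullet> i)) + (\<Sum>i\<in>Basis. (g' \<bullet> i) * (g \<bullet> i)))"
      by (simp add: inner_add_left sum.distrib sum_distrib_left algebra_simps)
    also have "(\<Sum>i\<in>Basis. (g \<bullet> i) * (g' \<bullet> i)) = g \<bullet> g'" by (rule euclidean_inner[symmetric])
    also have "(\<Sum>i\<in>Basis. (g' \<bullet> i) * (g \<bullet> i)) = g \<bullet> g'" by (subst inner_commute) (rule euclidean_inner[symmetric])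
    finally show ?thesis using D(4) D'(4) by simp
  qed
  ultimately show ?thesis unfolding has_lap_def using D(3) D'(3)
    by (intro exI[of _ ?E] exI[of _ ?H]) auto
qed

lemma has_lap_cmult: "has_lap f x g l \<Longrightarrow> has_lap (\<lambda>x. c * f x) x (c *\<^sub>R g) (c * l)"
  using has_lap_mult[OF has_lap_const[of c x], of f g l] by simp

lemma has_lap_sum:
  assumes "\<And>i. i \<in> I \<Longrightarrow> has_lap (f i) x (g i) (l i)"
  shows "has_lap (\<lambda>x. \<Sum>i\<in>I. f i x) x (\<Sum>i\<in>I. g i) (\<Sum>i\<in>I. l i)"
  using assms by (induction I rule: infinite_finite_induct) (auto intro!: has_lap_add has_lap_const)

lemma has_lap_compose:
  fixes h :: "real \<Rightarrow> real"
  assumes f: "has_lap f x g l"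
    and h: "\<forall>\<^sub>F t in nhds (f x). (h has_real_derivative h' t) (at t)" "(h' has_real_derivative h'') (at (f x))"
  shows "has_lap (\<lambda>x. h (f x)) x (h' (f x) *\<^sub>R g) (h' (f x) * l + h'' * (g \<bullet> g))"
proof -
  obtain D G where D: "\<forall>\<^sub>F y in nhds x. (f has_derivative (\<lambda>v. D y \<bullet> v)) (at y)"
    "(D has_derivative G) (at x)" "D x = g" "(\<Sum>i\<in>Basis. G i \<bullet> i) = l"
    using f unfolding has_lap_def by blast
  have "isCont f x" using has_lap_derivative[OF f] has_derivative_continuous by blast
  then have "filterlim f (nhds (f x)) (nhds x)"
    by (simp add: isCont_def tendsto_at_iff_tendsto_nhds)
  then have "\<forall>\<^sub>F y in nhds x. (h has_real_derivative h' (f y)) (at (f y))"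
    using h(1) unfolding filterlim_iff by blast
  then have 1: "\<forall>\<^sub>F y in nhds x. ((\<lambda>x. h (f x)) has_derivative (\<lambda>v. (h' (f y) *\<^sub>R D y) \<bullet> v)) (at y)"
    using D(1)
  proof eventually_elim
    case (elim y)
    show ?case
      using has_derivative_compose[OF elim(2) elim(1)[unfolded has_field_derivative_def]] by simp
  qed
  have "((\<lambda>x. h' (f x)) has_derivative (\<lambda>v. h'' * (g \<bullet> v))) (at x)"
    using has_derivative_compose[OF has_lap_derivative[OF f] h(2)[unfolded has_field_derivative_def]] by simp
  from has_derivative_scaleR[OF this D(2)]
  have 2: "((\<lambda>y. h' (f y) *\<^sub>R D y) has_derivative (\<lambda>v. h' (f x) *\<^sub>R G v + (h'' * (g \<bullet> v)) *\<^sub>R g)) (at x)"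
    by (simp add: D(3))
  have "(\<Sum>i\<in>Basis. (h' (f x) *\<^sub>R G i + (h'' * (g \<bullet> i)) *\<^sub>R g) \<bullet> i)
    = h' (f x) * (\<Sum>i\<in>Basis. G i \<bullet> i) + h'' * (\<Sum>i\<in>Basis. (g \<bullet> i) * (g \<bullet> i))"
    by (simp add: inner_add_left sum.distrib sum_distrib_left mult.assoc)
  also have "\<dots> = h' (f x) * l + h'' * (g \<bullet> g)" unfolding D(4) euclidean_inner[of g g] ..
  finally have "(\<Sum>i\<in>Basis. (h' (f x) *\<^sub>R G i + (h'' * (g \<bullet> i)) *\<^sub>R g) \<bullet> i) = h' (f x) * l + h'' * (g \<bullet> g)" .
  from has_lapI[OF 1 2 _ this] show ?thesis by (simp add: D(3))
qed

lemma has_lap_norm_power2: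
  fixes x c :: "'a::euclidean_space"
  shows "has_lap (\<lambda>x. (norm (x - c))\<^sup>2) x (2 *\<^sub>R (x - c)) (2 * DIM('a))"
proof -
  have "((\<lambda>x. (norm (x - c))\<^sup>2) has_derivative (\<lambda>v. (2 *\<^sub>R (y - c)) \<bullet> v)) (at y)" for y
    unfolding power2_norm_eq_inner by (auto intro!: derivative_eq_intros simp: inner_commute)
  moreover have "((\<lambda>y. 2 *\<^sub>R (y - c)) has_derivative (\<lambda>v. 2 *\<^sub>R v)) (at x)"
    by (auto intro!: derivative_eq_intros)
  moreover have "(\<Sum>i\<in>(Basis :: 'a set). (2 *\<^sub>R i) \<bullet> i) = real (2 * DIM('a))" by simp
  ultimately show ?thesis
    by (intro has_lapI[where D="\<lambda>y. 2 *\<^sub>R (y - c)" and G="\<lambda>v. 2 *\<^sub>R v"] always_eventually allI refl)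
qed

text \<open>Were a diagonal entry of the Hessian positive, the derivative along that axis, which is
  0 at \<open>x\<close>, would be positive just after it, and \<open>f\<close> would increase along
  the axis.\<close>

lemma has_lap_local_max:
  assumes f: "has_lap f x g l" and max: "\<forall>\<^sub>F y in nhds x. f y \<le> f x"
  shows "g = 0" and "l \<le> 0"
proof -
  obtain D G where D: "\<forall>\<^sub>F y in nhds x. (f has_derivative (\<lambda>v. D y \<bullet> v)) (at y)"
    "(D has_derivative G) (at x)" "D x = g" "(\<Sum>i\<in>Basis. G i \<bullet> i) = l"
    using f unfolding has_lap_def by blast
  obtain d where d: "d > 0" "\<And>y. dist y x < d \<Longrightarrow> (f has_derivative (\<lambda>v. D y \<bullet> v)) (at y) \<and> f y \<le> f x"
    using eventually_conj[OF D(1) max] unfolding eventually_nhds_metric by blast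
  let ?p = "\<lambda>e t. f (x + t *\<^sub>R e)"
  have p: "(?p e has_real_derivative D (x + t *\<^sub>R e) \<bullet> e) (at t)" "?p e t \<le> ?p e 0"
    if "norm e = 1" "\<bar>t\<bar> < d" for e t
    using has_real_derivative_line[OF d(2)[THEN conjunct1]] d(2) that by (auto simp: dist_norm)
  have g0: "g \<bullet> i = 0" if i: "i \<in> Basis" for i
  proof -
    have "D (x + 0 *\<^sub>R i) \<bullet> i = 0"
      by (rule DERIV_local_max[OF p(1) d(1)]) (use p(2) i d(1) in auto)
    then show ?thesis by (simp add: D(3))
  qed
  then show "g = 0" by (simp add: euclidean_eq_iff[of g 0])
  have "G i \<bullet> i \<le> 0" if i: "i \<in> Basis" for i
  proof (rule ccontr)
    assume "\<not> G i \<bullet> i \<le> 0"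
    then have pos: "G i \<bullet> i > 0" by simp
    have "(D has_derivative G) (at (x + 0 *\<^sub>R i))" using D(2) by simp
    then have "((\<lambda>y. D y \<bullet> i) has_derivative (\<lambda>v. G v \<bullet> i)) (at (x + 0 *\<^sub>R i))"
      by (rule has_derivative_inner_left)
    from has_real_derivative_line[OF this, of UNIV]
    have "((\<lambda>t. D (x + t *\<^sub>R i) \<bullet> i) has_real_derivative G i \<bullet> i) (at 0)" .
    from DERIV_pos_inc_right[OF this pos] obtain s where
      s: "s > 0" "\<And>h. 0 < h \<Longrightarrow> h < s \<Longrightarrow> D (x + h *\<^sub>R i) \<bullet> i > 0"
      using g0[OF i] D(3) by auto
    define h where "h = min s d / 2"
    have h: "0 < h" "h < s" "h < d" using s(1) d(1) by (auto simp: h_def)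
    have "?p i 0 < ?p i h"
    proof (rule DERIV_pos_imp_increasing_open[OF h(1)])
      fix t assume "0 < t" "t < h"
      then show "\<exists>y. (?p i has_real_derivative y) (at t) \<and> 0 < y"
        using p(1)[of i t] s(2)[of t] h i by auto
    next
      show "continuous_on {0..h} (?p i)"
      proof (intro continuous_at_imp_continuous_on ballI)
        fix t assume "t \<in> {0..h}"
        then show "isCont (?p i) t" using i h by (intro DERIV_isCont[OF p(1)]) auto
      qed
    qed
    then show False using p(2)[of i h] i h by simp
  qed
  then show "l \<le> 0" using D(4) sum_nonpos[of Basis "\<lambda>i. G i \<bullet> i"] by simp
qed

text \<open>Adding a small multiple of |x|^2 makes the Laplacian strictly positive, which excludes
  an interior maximum. The multiple is small enough not to close the gap between \<open>f x\<close>
  and \<open>m\<close>.\<close>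

theorem harmonic_on_le_frontier:
  fixes f :: "'a::euclidean_space \<Rightarrow> real"
  assumes U: "open U" "bounded U" and f: "continuous_on (closure U) f" "harmonic_on U f"
    and m: "\<And>x. x \<in> frontier U \<Longrightarrow> f x \<le> m" and x: "x \<in> U"
  shows "f x \<le> m"
proof (rule ccontr)
  assume "\<not> f x \<le> m"
  then have fx: "f x > m" by simp
  have "bounded (closure U)" using U(2) by (rule bounded_closure)
  then obtain R where R: "\<And>z. z \<in> closure U \<Longrightarrow> norm z \<le> R" unfolding bounded_iff by blast
  define e where "e = (f x - m) / (2 * (R\<^sup>2 + 1))"
  have e: "e > 0" "e * R\<^sup>2 < f x - m"
  proof -
    have "R\<^sup>2 + 1 > 0" by (simp add: add_nonneg_pos)
    then show "e > 0" using fx by (simp add: e_def)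
    have "e * (2 * (R\<^sup>2 + 1)) = f x - m" using \<open>R\<^sup>2 + 1 > 0\<close> by (simp add: e_def)
    moreover have "e * R\<^sup>2 < e * (2 * (R\<^sup>2 + 1))" using \<open>e > 0\<close>
      by (intro mult_strict_left_mono) (auto intro: add_nonneg_pos)
    ultimately show "e * R\<^sup>2 < f x - m" by simp
  qed
  let ?g = "\<lambda>x. f x + e * (norm (x - 0))\<^sup>2"
  have comp: "compact (closure U)" using U(2) by (simp add: compact_closure)
  have cont: "continuous_on (closure U) ?g" by (intro continuous_intros f)
  have xc: "x \<in> closure U" using x closure_subset by blast
  then have ne: "closure U \<noteq> {}" by force
  obtain p where p: "p \<in> closure U" "\<And>z. z \<in> closure U \<Longrightarrow> ?g z \<le> ?g p"
    using continuous_attains_sup[OF comp ne cont] by metis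
  have "f x \<le> ?g x" using e(1) by simp
  also have "\<dots> \<le> ?g p" by (rule p(2)[OF xc])
  finally have gp: "f x \<le> ?g p" .
  have "p \<notin> frontier U"
  proof
    assume "p \<in> frontier U"
    then have "f p \<le> m" by (rule m)
    moreover have "e * (norm (p - 0))\<^sup>2 \<le> e * R\<^sup>2"
      using R[OF p(1)] e(1) by (intro mult_left_mono power_mono) auto
    ultimately show False using gp e(2) by linarith
  qed
  then have pU: "p \<in> U" using p(1) U(1) by (simp add: frontier_def interior_open)
  have "has_lap f p (grad UNIV f p) (laplacian UNIV f p)"
    using f(2) U(1) pU unfolding harmonic_on_def by (intro has_lap_Ck_on) auto
  then have "has_lap f p (grad UNIV f p) 0" using f(2) pU by (simp add: harmonic_on_def)
  from has_lap_add[OF this has_lap_cmult[OF has_lap_norm_power2[of 0 p], of e]]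
  have "has_lap ?g p (grad UNIV f p + e *\<^sub>R 2 *\<^sub>R (p - 0)) (0 + e * (2 * DIM('a)))" by simp
  moreover have "\<forall>\<^sub>F y in nhds p. ?g y \<le> ?g p"
    using eventually_nhds_in_open[OF U(1) pU] by eventually_elim (use p(2) closure_subset in blast)
  ultimately have "0 + e * (2 * DIM('a)) \<le> 0" by (rule has_lap_local_max(2))
  then show False using e(1) DIM_positive[where 'a='a] by (simp add: mult_le_0_iff)
qed

section \<open>Hopf's lemma and the strong maximum principle\<close>

lemma hopf_barrier:
  fixes x y :: "'a::euclidean_space" and a c :: real
  shows "has_lap (\<lambda>x. exp (- a * (norm (x - y))\<^sup>2) - c) x
    ((- a * exp (- a * (norm (x - y))\<^sup>2)) *\<^sub>R 2 *\<^sub>R (x - y))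
    (exp (- a * (norm (x - y))\<^sup>2) * (4 * a\<^sup>2 * (norm (x - y))\<^sup>2 - 2 * DIM('a) * a))"
proof -
  have 1: "\<forall>\<^sub>F t in nhds s. ((\<lambda>t. exp (- a * t) - c) has_real_derivative - a * exp (- a * t)) (at t)" for s :: real
    by (rule always_eventually) (auto intro!: derivative_eq_intros)
  have 2: "((\<lambda>t. - a * exp (- a * t)) has_real_derivative a\<^sup>2 * exp (- a * s)) (at s)" for s :: real
    by (auto intro!: derivative_eq_intros simp: power2_eq_square)
  have 3: "(2 *\<^sub>R (x - y)) \<bullet> (2 *\<^sub>R (x - y)) = 4 * (norm (x - y))\<^sup>2"
    by (simp only: inner_scaleR_left inner_scaleR_right power2_norm_eq_inner)
  show ?thesis
    using has_lap_compose[OF has_lap_norm_power2[of y x] 1 2] unfolding 3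
    by (simp add: algebra_simps)
qed

text \<open>On the annulus between the radii r/2 and r, \<open>f\<close> plus a small multiple of
  the exponential barrier \<open>?h\<close> is a strict subsolution, and it is at most
  \<open>m\<close> on both bounding spheres. So it is at most \<open>m\<close> on the annulus, and
  \<open>f\<close> lies below \<open>m\<close> by the linear growth of the barrier away from
  \<open>p\<close>.\<close>

theorem hopf_lemma:
  fixes f :: "'a::euclidean_space \<Rightarrow> real" and b :: "'a \<Rightarrow> 'a"
  assumes r: "r > 0" and p: "dist y p = r" and c: "continuous_on (cball y r) f"
    and less: "\<And>x. x \<in> ball y r \<Longrightarrow> f x < m" and fp: "f p = m"
    and L: "\<And>x. x \<in> ball y r \<Longrightarrow> \<exists>g l. has_lap f x g l \<and> l + b x \<bullet> g \<ge> 0"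
    and b: "\<And>x. x \<in> ball y r \<Longrightarrow> norm (b x) \<le> \<beta>"
  shows "\<exists>k>0. \<forall>t. 0 < t \<and> t < 1 / 2 \<longrightarrow> f (p + t *\<^sub>R (y - p)) \<le> m - k * t"
proof -
  let ?n = "real DIM('a)"
  have \<beta>: "\<beta> \<ge> 0" by (rule order_trans[OF norm_ge_zero b[of y]]) (use r in simp)
  \<comment> \<open>In the annulus 4 |x - y|^2 exceeds r^2, so this \<open>a\<close> makes 4 a |x -
    y|^2 larger than the dimension term and the drift term together.\<close>
  define a where "a = (2 * ?n + 2 * \<beta> * r + 1) / r\<^sup>2"
  have a: "a > 0" "a * r\<^sup>2 = 2 * ?n + 2 * \<beta> * r + 1"
    using r \<beta> by (auto simp: a_def intro!: divide_pos_pos add_nonneg_pos)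
  let ?h = "\<lambda>x. exp (- a * (norm (x - y))\<^sup>2) - exp (- a * r\<^sup>2)"
  have le: "f x \<le> m" if "x \<in> cball y r" for x
    by (rule continuous_le_on_closure[of "ball y r" f]) (use c less that r in \<open>auto intro: less_imp_le\<close>)
  have "continuous_on (cball y (r / 2)) f" using c by (rule continuous_on_subset) (use r in auto)
  moreover have "cball y (r / 2) \<noteq> {}" using r by simp
  ultimately obtain z0 where z0: "z0 \<in> cball y (r / 2)" "\<And>z. z \<in> cball y (r / 2) \<Longrightarrow> f z \<le> f z0"
    using continuous_attains_sup[OF compact_cball] by metis
  define \<mu> where "\<mu> = f z0"
  have \<mu>: "\<mu> < m" unfolding \<mu>_def by (rule less) (use z0(1) r in auto)
  \<comment> \<open>Since \<open>?h\<close> is at most 1, this keeps \<open>f + e * ?h\<close>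
    strictly below \<open>m\<close> on the inner sphere.\<close>
  define e where "e = (m - \<mu>) / 2"
  have e: "e > 0" using \<mu> by (simp add: e_def)
  let ?F = "\<lambda>x. f x + e * ?h x"
  have hle: "?h x \<le> 1" for x
  proof -
    have "exp (- a * (norm (x - y))\<^sup>2) \<le> 1" using a(1) by simp
    moreover have "exp (- a * r\<^sup>2) \<ge> 0" by simp
    ultimately show ?thesis by linarith
  qed
  let ?A = "cball y r - ball y (r / 2)"
  have comp: "compact ?A" by (intro compact_diff compact_cball open_ball)
  have cont: "continuous_on ?A ?F" by (intro continuous_intros continuous_on_subset[OF c]) auto
  have "p \<in> ?A" using p r by auto
  then have ne: "?A \<noteq> {}" by force
  obtain q where q: "q \<in> ?A" "\<And>x. x \<in> ?A \<Longrightarrow> ?F x \<le> ?F q"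
    using continuous_attains_sup[OF comp ne cont] by metis
  have Fq: "?F q \<le> m"
  proof (rule ccontr)
    assume "\<not> ?F q \<le> m"
    then have gt: "?F q > m" by simp
    have q1: "dist y q \<noteq> r"
    proof
      assume "dist y q = r"
      then have h0: "?h q = 0" by (simp add: dist_norm norm_minus_commute)
      show False using gt le[of q] q(1) unfolding h0 by simp
    qed
    have q2: "dist y q \<noteq> r / 2"
    proof
      assume "dist y q = r / 2"
      then have "f q \<le> \<mu>" unfolding \<mu>_def by (intro z0(2)) simp
      moreover have "e * ?h q \<le> e * 1" using hle e by (intro mult_left_mono) auto
      ultimately have "?F q \<le> \<mu> + e * 1" by (rule add_mono)
      also have "\<dots> < m" using \<mu> by (simp add: e_def field_simps)
      finally show False using gt by simp
    qed
    have qb: "q \<in> ball y r" "dist y q > r / 2" using q(1) q1 q2 by auto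
    obtain g l where gl: "has_lap f q g l" "l + b q \<bullet> g \<ge> 0" using L[OF qb(1)] by blast
    let ?E = "exp (- a * (norm (q - y))\<^sup>2)" and ?d = "norm (q - y)"
    have "has_lap ?F q (g + e *\<^sub>R ((- a * ?E) *\<^sub>R 2 *\<^sub>R (q - y)))
      (l + e * (?E * (4 * a\<^sup>2 * ?d\<^sup>2 - 2 * DIM('a) * a)))"
      by (rule has_lap_add[OF gl(1) has_lap_cmult[OF hopf_barrier]])
    moreover have "\<forall>\<^sub>F x in nhds q. ?F x \<le> ?F q"
    proof -
      have "open (ball y r - cball y (r / 2))" by (intro open_Diff) auto
      then have "\<forall>\<^sub>F x in nhds q. x \<in> ball y r - cball y (r / 2)"
        using qb by (intro eventually_nhds_in_open) auto
      then show ?thesis by eventually_elim (rule q(2), auto)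
    qed
    ultimately have 0: "g + e *\<^sub>R ((- a * ?E) *\<^sub>R 2 *\<^sub>R (q - y)) = 0"
      "l + e * (?E * (4 * a\<^sup>2 * ?d\<^sup>2 - 2 * DIM('a) * a)) \<le> 0"
      by (rule has_lap_local_max)+
    have d: "r / 2 < ?d" "?d < r" using qb by (auto simp: dist_norm norm_minus_commute)
    have "\<bar>b q \<bullet> (q - y)\<bar> \<le> norm (b q) * ?d" by (rule Cauchy_Schwarz_ineq2)
    also have "\<dots> \<le> \<beta> * r" using b[OF qb(1)] d \<beta> by (intro mult_mono) auto
    finally have bq: "b q \<bullet> (q - y) \<le> \<beta> * r" by simp
    have "(r / 2)\<^sup>2 < ?d\<^sup>2" using d r by (intro power_strict_mono) auto
    then have "a * r\<^sup>2 < a * (4 * ?d\<^sup>2)" using a(1) by (simp add: power_divide)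
    then have "2 * ?n + 2 * (b q \<bullet> (q - y)) < a * (4 * ?d\<^sup>2)" using a(2) bq by linarith
    then have "0 < a * (4 * ?d\<^sup>2) - 2 * ?n - 2 * (b q \<bullet> (q - y))" by linarith
    then have "0 < e * ?E * a * (a * (4 * ?d\<^sup>2) - 2 * ?n - 2 * (b q \<bullet> (q - y)))"
      using e a(1) by (intro mult_pos_pos) auto
    also have "\<dots> = (e * (?E * (4 * a\<^sup>2 * ?d\<^sup>2 - 2 * DIM('a) * a))) + b q \<bullet> (e *\<^sub>R ((- a * ?E) *\<^sub>R 2 *\<^sub>R (q - y)))"
      by (simp add: algebra_simps power2_eq_square)
    also have "\<dots> \<le> - l - b q \<bullet> g"
    proof -
      have "b q \<bullet> (g + e *\<^sub>R ((- a * ?E) *\<^sub>R 2 *\<^sub>R (q - y))) = 0" unfolding 0(1) by simp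
      then have bg: "b q \<bullet> g + b q \<bullet> (e *\<^sub>R ((- a * ?E) *\<^sub>R 2 *\<^sub>R (q - y))) = 0"
        by (simp only: inner_add_right)
      have "Y + Z \<le> - L - G" if "G + Z = 0" "L + Y \<le> 0" for L Y G Z :: real
        using that by linarith
      from this[OF bg 0(2)] show ?thesis .
    qed
    finally show False using gl(2) by linarith
  qed
  define k where "k = e * exp (- a * r\<^sup>2) * (a * r\<^sup>2)"
  have k: "k > 0" unfolding k_def using e a(1) r by (intro mult_pos_pos) auto
  have "f (p + t *\<^sub>R (y - p)) \<le> m - k * t" if t: "0 < t" "t < 1 / 2" for t
  proof -
    let ?x = "p + t *\<^sub>R (y - p)"
    have "?x - y = (1 - t) *\<^sub>R (p - y)" by (simp add: algebra_simps)
    then have n: "norm (?x - y) = (1 - t) * r" using t p by (simp add: dist_norm norm_minus_commute)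
    have "(1 - t) * r \<le> 1 * r" "1 / 2 * r \<le> (1 - t) * r" using t r by (intro mult_right_mono; simp)+
    then have "?x \<in> ?A" using n r by (simp add: dist_norm norm_minus_commute)
    then have F: "?F ?x \<le> m" using q(2) Fq by fastforce
    \<comment> \<open>On the segment the distance to \<open>y\<close> is (1 - t) r, so the exponents
      of the two terms of \<open>?h\<close> differ by a r^2 (2t - t^2), bounded below linearly in
      t.\<close>
    have "t \<le> 2 * t - t\<^sup>2"
      using t mult_left_mono[of t 1 t] by (simp add: power2_eq_square)
    then have "a * r\<^sup>2 * t \<le> a * r\<^sup>2 * (2 * t - t\<^sup>2)"
      by (rule mult_left_mono) (use a(1) in simp)
    also have "\<dots> \<le> exp (a * r\<^sup>2 * (2 * t - t\<^sup>2)) - 1" using exp_ge_add_one_self[of "a * r\<^sup>2 * (2 * t - t\<^sup>2)"] by linarith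
    finally have "exp (- a * r\<^sup>2) * (a * r\<^sup>2 * t) \<le> exp (- a * r\<^sup>2) * (exp (a * r\<^sup>2 * (2 * t - t\<^sup>2)) - 1)"
      by (intro mult_left_mono) auto
    also have "\<dots> = ?h ?x"
      unfolding n right_diff_distrib exp_add[symmetric] by (simp add: algebra_simps power2_eq_square)
    finally have "e * (exp (- a * r\<^sup>2) * (a * r\<^sup>2 * t)) \<le> e * ?h ?x" using e by (intro mult_left_mono) auto
    then show ?thesis using F by (simp add: k_def algebra_simps)
  qed
  then show ?thesis using k by blast
qed

lemma one_sided_derivative_le:
  fixes f :: "'a::real_normed_vector \<Rightarrow> real"
  assumes d: "(f has_derivative D) (at p within S)" and s: "s > 0"
    and le: "\<And>t. 0 < t \<Longrightarrow> t < s \<Longrightarrow> p + t *\<^sub>R v \<in> S \<and> f (p + t *\<^sub>R v) \<le> f p - k * t"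
  shows "D v \<le> - k"
proof -
  have lin: "linear D" using d has_derivative_linear by blast
  let ?T = "{0<..<s}"
  have "((\<lambda>t. p + t *\<^sub>R v) has_derivative (\<lambda>t. t *\<^sub>R v)) (at 0 within ?T)"
    by (auto intro!: derivative_eq_intros)
  moreover have "(f has_derivative D) (at (p + 0 *\<^sub>R v) within (\<lambda>t. p + t *\<^sub>R v) ` ?T)"
  proof -
    have "(\<lambda>t. p + t *\<^sub>R v) ` ?T \<subseteq> S" using le by force
    then show ?thesis using has_derivative_subset[OF d] by simp
  qed
  ultimately have "((\<lambda>t. f (p + t *\<^sub>R v)) has_derivative (\<lambda>t. D (t *\<^sub>R v))) (at 0 within ?T)"
    using has_derivative_in_compose[of "\<lambda>t. p + t *\<^sub>R v" _ 0 ?T f D] by simp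
  then have "((\<lambda>t. f (p + t *\<^sub>R v)) has_real_derivative D v) (at 0 within ?T)"
    by (simp add: has_field_derivative_def linear_scale[OF lin] mult.commute[of _ "D v"])
  then have lim: "((\<lambda>t. (f (p + t *\<^sub>R v) - f p) / t) \<longlongrightarrow> D v) (at 0 within ?T)"
    by (simp add: has_field_derivative_iff)
  have "\<forall>\<^sub>F t in at 0 within ?T. (f (p + t *\<^sub>R v) - f p) / t \<le> - k"
    unfolding eventually_at_filter
    by (rule always_eventually) (use le in \<open>auto simp: divide_le_eq algebra_simps\<close>)
  moreover have "at 0 within ?T \<noteq> bot"
    using s by (simp add: at_within_eq_bot_iff)
  ultimately show ?thesis using tendsto_upperbound[OF lim] by blast
qed

text \<open>If \<open>f z < m\<close>, take the point \<open>p\<close> nearest to \<open>z\<close>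
  where \<open>f = m\<close>. The ball about \<open>z\<close> through \<open>p\<close> contradicts
  Hopf's lemma, because the gradient vanishes at the interior maximum \<open>p\<close>. Restricting
  \<open>z\<close> to the half ball keeps that ball inside \<open>ball x0 R\<close>.\<close>

theorem strong_maximum_principle:
  fixes f :: "'a::euclidean_space \<Rightarrow> real" and b :: "'a \<Rightarrow> 'a"
  assumes L: "\<And>x. x \<in> ball x0 R \<Longrightarrow> \<exists>g l. has_lap f x g l \<and> l + b x \<bullet> g \<ge> 0"
    and b: "\<And>x. x \<in> ball x0 R \<Longrightarrow> norm (b x) \<le> \<beta>"
    and le: "\<And>x. x \<in> ball x0 R \<Longrightarrow> f x \<le> m" and fx0: "f x0 = m"
    and z: "z \<in> ball x0 (R / 2)"
  shows "f z = m"
proof (rule ccontr)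
  assume ne: "f z \<noteq> m"
  have "dist x0 z < R / 2" using z by simp
  then have R: "R > 0" using zero_le_dist[of x0 z] by linarith
  have sub: "cball z (R / 2) \<subseteq> ball x0 R"
  proof
    fix y assume "y \<in> cball z (R / 2)"
    then show "y \<in> ball x0 R" using z dist_triangle[of x0 y z] by simp
  qed
  have c: "continuous_on (ball x0 R) f"
  proof (intro continuous_at_imp_continuous_on ballI)
    fix x assume "x \<in> ball x0 R"
    then obtain g l where "has_lap f x g l" using L by blast
    then show "isCont f x" using has_lap_derivative has_derivative_continuous by blast
  qed
  let ?S = "{x \<in> cball z (R / 2). f x = m}"
  have "closed ?S"
    by (rule continuous_closed_preimage_constant) (use continuous_on_subset[OF c sub] in auto)
  moreover have "x0 \<in> ?S" using z fx0 by (simp add: dist_commute)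
  ultimately obtain p where p: "p \<in> ?S" "\<And>x. x \<in> ?S \<Longrightarrow> dist z p \<le> dist z x"
    using distance_attains_inf[of ?S z] by blast
  define r where "r = dist z p"
  have r: "r > 0" "r \<le> R / 2" using p(1) ne by (auto simp: r_def)
  have bsub: "cball z r \<subseteq> ball x0 R" using sub r by auto
  have less: "f x < m" if x: "x \<in> ball z r" for x
  proof -
    have "f x \<noteq> m" using p(2)[of x] x r by (auto simp: r_def)
    moreover have "f x \<le> m" using le[of x] bsub x ball_subset_cball[of z r] by blast
    ultimately show ?thesis by simp
  qed
  obtain k where k: "k > 0" "\<And>t. 0 < t \<Longrightarrow> t < 1 / 2 \<Longrightarrow> f (p + t *\<^sub>R (z - p)) \<le> m - k * t"
  proof -
    have "\<exists>k>0. \<forall>t. 0 < t \<and> t < 1 / 2 \<longrightarrow> f (p + t *\<^sub>R (z - p)) \<le> m - k * t"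
    proof (rule hopf_lemma[OF r(1) _ continuous_on_subset[OF c bsub] less])
      show "dist z p = r" by (simp add: r_def)
      show "f p = m" using p(1) by simp
      fix x assume "x \<in> ball z r"
      then have "x \<in> ball x0 R" using bsub ball_subset_cball[of z r] by blast
      then show "\<exists>g l. has_lap f x g l \<and> l + b x \<bullet> g \<ge> 0" "norm (b x) \<le> \<beta>" by (fact L b)+
    qed
    then show ?thesis using that by blast
  qed
  have pb: "p \<in> ball x0 R" using p(1) sub by blast
  then obtain g l where gl: "has_lap f p g l" using L by blast
  have "\<forall>\<^sub>F y in nhds p. f y \<le> f p"
    using eventually_nhds_in_open[OF open_ball pb] by eventually_elim (use le p(1) in auto)
  then have g: "g = 0" by (rule has_lap_local_max(1)[OF gl])
  have "g \<bullet> (z - p) \<le> - k"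
    by (rule one_sided_derivative_le[OF has_lap_derivative[OF gl], of "1 / 2"]) (use k p(1) in auto)
  then show False using g k by simp
qed

lemma has_lap_laplacian:
  assumes "has_lap f x g l"
  shows "laplacian UNIV f x = l" "grad UNIV f x = g"
proof -
  obtain D G where D: "\<forall>\<^sub>F y in nhds x. (f has_derivative (\<lambda>v. D y \<bullet> v)) (at y)"
    "(D has_derivative G) (at x)" "D x = g" "(\<Sum>i\<in>Basis. G i \<bullet> i) = l"
    using assms(1) unfolding has_lap_def by blast
  then obtain U where U: "open U" "x \<in> U" "\<And>y. y \<in> U \<Longrightarrow> (f has_derivative (\<lambda>v. D y \<bullet> v)) (at y)"
    unfolding eventually_nhds by blast
  have "pd UNIV i (pd UNIV i f) x = G i \<bullet> i" for i
  proof -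
    have "pd UNIV i (pd UNIV i f) x = pd UNIV i (\<lambda>y. D y \<bullet> i) x"
      by (rule pd_cong_open[OF U(1) _ U(2)]) (rule pd_eqI[OF U(3)])
    also have "\<dots> = G i \<bullet> i" by (rule pd_eqI[OF has_derivative_inner_left[OF D(2)]])
    finally show ?thesis .
  qed
  then show "laplacian UNIV f x = l" using D(4) by (simp add: laplacian_def)
  show "grad UNIV f x = g" using grad_eqI[OF U(3)[OF U(2)]] D(3) by simp
qed

section \<open>The P-function\<close>

text \<open>The gradient is taken within \<open>M\<close>, so that the function is also meaningful
  at points of the boundary of \<Omega> that belong to \<open>M\<close>.\<close>

definition pfun :: "'a::euclidean_space set \<Rightarrow> ('a \<Rightarrow> real) \<Rightarrow> 'a \<Rightarrow> real" where
  "pfun M u x = (norm (grad M u x))\<^sup>2 * u x powr (- (2 * (real DIM('a) - 1) / (real DIM('a) - 2)))"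

text \<open>Row \<open>i\<close> of the trace-free Hessian of w = u^(-2/(n-2)), divided by -2/(n-2)
  u^(-n/(n-2)); its trace vanishes because u is harmonic.\<close>

definition ptensor :: "('a::euclidean_space \<Rightarrow> real) \<Rightarrow> 'a \<Rightarrow> 'a \<Rightarrow> 'a" where
  "ptensor u x i = grad UNIV (pd UNIV i u) x
     - (real DIM('a) / (real DIM('a) - 2) * pd UNIV i u x / u x) *\<^sub>R grad UNIV u x
     + ((norm (grad UNIV u x))\<^sup>2 / ((real DIM('a) - 2) * u x)) *\<^sub>R i"

lemma norm_grad_power2: "(norm (grad M f x))\<^sup>2 = (\<Sum>i\<in>Basis. pd M i f x * pd M i f x)"
  by (subst power2_norm_eq_inner, subst euclidean_inner) (simp add: grad_inner_Basis)

lemma pfun_open: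
  assumes "open W" "x \<in> W" "W \<subseteq> M"
  shows "pfun M u x = pfun UNIV u x"
  using grad_open[OF assms] by (simp add: pfun_def)

text \<open>\<open>S\<close>, \<open>Y\<close> and \<open>Q\<close> are |Du|^2, D^2u(Du, Du) and
  |D^2u|^2. The cross term of the Hessian with the identity is a multiple of the Laplacian of
  \<open>u\<close> and drops out.\<close>

lemma sum_norm_ptensor:
  fixes u :: "'a::euclidean_space \<Rightarrow> real"
  assumes W: "open W" "harmonic_on W u" and x: "x \<in> W" and n: "n = real DIM('a)" "n > 2"
    and S: "S = grad UNIV u x \<bullet> grad UNIV u x"
    and Y: "Y = (\<Sum>i\<in>Basis. pd UNIV i u x * (grad UNIV (pd UNIV i u) x \<bullet> grad UNIV u x))"
    and Q: "Q = (\<Sum>i\<in>Basis. grad UNIV (pd UNIV i u) x \<bullet> grad UNIV (pd UNIV i u) x)"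
  shows "(\<Sum>i\<in>Basis. (norm (ptensor u x i))\<^sup>2) = Q - 2 * (n / (n - 2)) * Y / u x
     + ((n / (n - 2))\<^sup>2 + n / (n - 2)\<^sup>2 - 2 * (n / (n - 2)) / (n - 2)) * (S / u x)\<^sup>2"
proof -
  let ?g = "grad UNIV u x"
  define k where "k = 1 / (n - 2)"
  define w where "w = 1 / u x"
  define c1 where "c1 = n * k * w"
  define c2 where "c2 = S * k * w"
  have T: "ptensor u x i = grad UNIV (pd UNIV i u) x - (c1 * pd UNIV i u x) *\<^sub>R ?g + c2 *\<^sub>R i" for i
    by (simp add: ptensor_def c1_def c2_def k_def w_def S n power2_norm_eq_inner)
  have nT: "(norm (ptensor u x i))\<^sup>2 = grad UNIV (pd UNIV i u) x \<bullet> grad UNIV (pd UNIV i u) x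
      + c1\<^sup>2 * S * (pd UNIV i u x * pd UNIV i u x) + c2\<^sup>2
      - 2 * c1 * (pd UNIV i u x * (grad UNIV (pd UNIV i u) x \<bullet> ?g))
      + 2 * c2 * pd UNIV i (pd UNIV i u) x - 2 * c1 * c2 * (pd UNIV i u x * pd UNIV i u x)"
    if i: "i \<in> Basis" for i
  proof -
    have e: "grad UNIV (pd UNIV i u) x \<bullet> i = pd UNIV i (pd UNIV i u) x" "?g \<bullet> i = pd UNIV i u x" "i \<bullet> i = 1"
      using i by (auto simp: grad_inner_Basis)
    show ?thesis unfolding T power2_norm_eq_inner S using e
      by (simp add: algebra_simps inner_commute power2_eq_square)
  qed
  have SS: "S = (\<Sum>i\<in>Basis. pd UNIV i u x * pd UNIV i u x)"
    using norm_grad_power2[of UNIV u x] by (simp add: S power2_norm_eq_inner)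
  have lap: "(\<Sum>i\<in>Basis. pd UNIV i (pd UNIV i u) x) = 0"
    using W(2) x by (simp add: harmonic_on_def laplacian_def)
  have "(\<Sum>i\<in>Basis. (norm (ptensor u x i))\<^sup>2) = Q + c1\<^sup>2 * S * S + n * c2\<^sup>2 - 2 * c1 * Y + 2 * c2 * 0 - 2 * c1 * c2 * S"
    unfolding Q Y n(1)
    by (simp add: nT sum.distrib sum_subtractf sum_distrib_left[symmetric] lap SS[symmetric])
  also have "\<dots> = Q - 2 * (n / (n - 2)) * Y / u x
     + ((n / (n - 2))\<^sup>2 + n / (n - 2)\<^sup>2 - 2 * (n / (n - 2)) / (n - 2)) * (S / u x)\<^sup>2"
  proof -
    have e: "n / (n - 2) = n * k" "n / (n - 2)\<^sup>2 = n * k\<^sup>2" "S / u x = S * w"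
      "\<And>z. z / (n - 2) = z * k" "\<And>z. z / u x = z * w"
      by (simp_all add: k_def w_def power2_eq_square)
    show ?thesis unfolding e c1_def c2_def by (simp add: power2_eq_square algebra_simps)
  qed
  finally show ?thesis .
qed

text \<open>Completing the square: the drift \<open>2 Du / u\<close> turns the Laplacian of the P-function into the squared norm of a tensor.\<close>

lemma pfun_subsolution:
  fixes u :: "'a::euclidean_space \<Rightarrow> real"
  assumes W: "open W" "harmonic_on W u" and pos: "\<And>x. x \<in> W \<Longrightarrow> u x > 0" and x: "x \<in> W" and dim: "DIM('a) \<ge> 3"
  shows "\<exists>g l. has_lap (pfun UNIV u) x g l \<and> l + ((2 / u x) *\<^sub>R grad UNIV u x) \<bullet> g =
     2 * u x powr (- (2 * (real DIM('a) - 1) / (real DIM('a) - 2))) * (\<Sum>i\<in>Basis. (norm (ptensor u x i))\<^sup>2)"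
proof -
  define n where "n = real DIM('a)"
  have n: "n > 2" using dim by (simp add: n_def)
  define q where "q = 2 * (n - 1) / (n - 2)"
  define U where "U = u x"
  have U: "U > 0" using pos[OF x] by (simp add: U_def)
  let ?g = "grad UNIV u x" and ?D = "\<lambda>i. grad UNIV (pd UNIV i u) x" and ?p = "\<lambda>i. pd UNIV i u x"
  define S where "S = ?g \<bullet> ?g"
  define Y where "Y = (\<Sum>i\<in>Basis. ?p i * (?D i \<bullet> ?g))"
  define Q where "Q = (\<Sum>i\<in>Basis. ?D i \<bullet> ?D i)"
  have lu: "has_lap u x ?g 0"
    using has_lap_Ck_on[OF W(1) _ x, of u] W(2) x by (simp add: harmonic_on_def)
  have lp: "has_lap (pd UNIV i u) x (?D i) 0" if "i \<in> Basis" for i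
    using has_lap_Ck_on[OF W(1) _ x, of "pd UNIV i u"] harmonic_on_pd[OF W that] x by (simp add: harmonic_on_def)
  define F where "F = (\<Sum>i\<in>Basis. ?p i *\<^sub>R ?D i + ?p i *\<^sub>R ?D i)"
  have 1: "has_lap (\<lambda>y. \<Sum>i\<in>Basis. pd UNIV i u y * pd UNIV i u y) x F (\<Sum>i\<in>Basis. ?p i * 0 + ?p i * 0 + 2 * (?D i \<bullet> ?D i))"
    unfolding F_def by (intro has_lap_sum has_lap_mult lp)
  have Fg: "F \<bullet> ?g = 2 * Y" unfolding F_def Y_def
    by (simp add: inner_sum_left inner_add_left sum.distrib)
  have ev: "\<forall>\<^sub>F t in nhds U. ((\<lambda>t. t powr (- q)) has_real_derivative - q * t powr (- q - 1)) (at t)"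
  proof -
    have "\<forall>\<^sub>F t in nhds U. t \<in> {0<..}" using U by (intro eventually_nhds_in_open) auto
    then show ?thesis by eventually_elim (rule has_real_derivative_powr, simp)
  qed
  have d2: "((\<lambda>t. - q * t powr (- q - 1)) has_real_derivative - q * ((- q - 1) * U powr (- q - 1 - 1))) (at U)"
    using U by (intro DERIV_cmult has_real_derivative_powr)
  have 2: "has_lap (\<lambda>y. u y powr (- q)) x ((- q * U powr (- q - 1)) *\<^sub>R ?g)
     ((- q * U powr (- q - 1)) * 0 + (- q * ((- q - 1) * U powr (- q - 1 - 1))) * (?g \<bullet> ?g))"
    using has_lap_compose[OF lu, of "\<lambda>t. t powr (- q)" "\<lambda>t. - q * t powr (- q - 1)"] ev d2 unfolding U_def by blast
  define a where "a = U powr (- q)"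
  have p1: "U powr (- q - 1) = a / U"
    using U powr_diff[of U "- q" 1] by (simp add: a_def)
  then have pw: "U powr (- q - 1) = a / U" "U powr (- q - 1 - 1) = a / U\<^sup>2"
    using U powr_diff[of U "- q - 1" 1] by (simp_all add: power2_eq_square)
  have fx: "(\<Sum>i\<in>Basis. ?p i * ?p i) = S"
    using norm_grad_power2[of UNIV u x] by (simp add: S_def power2_norm_eq_inner)
  have P: "pfun UNIV u = (\<lambda>y. (\<Sum>i\<in>Basis. pd UNIV i u y * pd UNIV i u y) * u y powr (- q))"
    by (rule ext) (simp add: pfun_def norm_grad_power2 q_def n_def)
  define G where "G = S *\<^sub>R ((- q * (a / U)) *\<^sub>R ?g) + a *\<^sub>R F"
  define L where "L = S * ((- q * (a / U)) * 0 + (- q * ((- q - 1) * (a / U\<^sup>2))) * S) + a * (2 * Q) + 2 * (F \<bullet> ((- q * (a / U)) *\<^sub>R ?g))"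
  have 3: "has_lap (pfun UNIV u) x G L"
    using has_lap_mult[OF 1 2] unfolding P[symmetric] fx pw G_def L_def Q_def S_def[symmetric] U_def[symmetric] a_def[symmetric]
    by (simp add: sum_distrib_left)
  have L1: "L + ((2 / U) *\<^sub>R ?g) \<bullet> G = 2 * a * (Q - 2 * (q - 1) * Y / U + q * (q - 1) / 2 * (S / U)\<^sup>2)"
  proof -
    have gG: "?g \<bullet> G = S * (- q * (a / U)) * S + a * (2 * Y)"
      using Fg by (simp add: G_def inner_add_right inner_diff_right S_def inner_commute)
    have FF: "F \<bullet> ((- q * (a / U)) *\<^sub>R ?g) = (- q * (a / U)) * (2 * Y)" using Fg by simp
    have "L + ((2 / U) *\<^sub>R ?g) \<bullet> G = L + 2 / U * (S * (- q * (a / U)) * S + a * (2 * Y))"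
      by (simp only: inner_scaleR_left gG)
    moreover have "z / U = z * inverse U" "z / U\<^sup>2 = z * inverse U * inverse U" for z
      by (simp_all add: divide_inverse power2_eq_square)
    ultimately have e1: "L + ((2 / U) *\<^sub>R ?g) \<bullet> G = L + 2 * inverse U * (S * (- q * (a * inverse U)) * S + a * (2 * Y))"
      and e2: "L = S * ((- q * (a * inverse U)) * 0 + (- q * ((- q - 1) * (a * inverse U * inverse U))) * S)
        + a * (2 * Q) + 2 * ((- q * (a * inverse U)) * (2 * Y))"
      and e3: "2 * a * (Q - 2 * (q - 1) * Y / U + q * (q - 1) / 2 * (S / U)\<^sup>2)
        = 2 * a * (Q - 2 * (q - 1) * Y * inverse U + q * (q - 1) / 2 * (S * inverse U)\<^sup>2)"
      unfolding L_def FF by (simp_all only:)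
    show ?thesis unfolding e1 e3 unfolding e2
      by (simp add: power2_eq_square algebra_simps add_divide_distrib diff_divide_distrib)
  qed
  \<comment> \<open>With this value both coefficients in \<open>L1\<close> agree with those of
    \<open>sum_norm_ptensor\<close>.\<close>
  have q1: "q - 1 = n / (n - 2)" using n by (simp add: q_def field_simps)
  have q2: "q * (q - 1) / 2 = (n / (n - 2))\<^sup>2 + n / (n - 2)\<^sup>2 - 2 * (n / (n - 2)) / (n - 2)"
  proof -
    define k where "k = 1 / (n - 2)"
    have e: "n / (n - 2) = n * k" "n / (n - 2)\<^sup>2 = n * k\<^sup>2" "2 * (n * k) / (n - 2) = 2 * (n * k) * k" "q = 2 * (n - 1) * k"
      by (simp_all add: k_def q_def power2_eq_square)
    show ?thesis unfolding q1 unfolding e by (simp add: power2_eq_square field_simps)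
  qed
  have "L + ((2 / U) *\<^sub>R ?g) \<bullet> G = 2 * a * (\<Sum>i\<in>Basis. (norm (ptensor u x i))\<^sup>2)"
    unfolding L1 sum_norm_ptensor[OF W x n_def n S_def Y_def Q_def] q2 unfolding q1 U_def ..
  then show ?thesis using 3 unfolding a_def U_def q_def n_def by blast
qed

text \<open>At a local maximum of P the gradient of P vanishes and its Laplacian is nonpositive, so
  the nonnegative right-hand side of \<open>pfun_subsolution\<close> must be 0.\<close>

lemma ptensor_eq_0:
  fixes u :: "'a::euclidean_space \<Rightarrow> real"
  assumes W: "open W" "harmonic_on W u" and pos: "\<And>x. x \<in> W \<Longrightarrow> u x > 0" and x: "x \<in> W" and dim: "DIM('a) \<ge> 3"
    and max: "\<forall>\<^sub>F y in nhds x. pfun UNIV u y \<le> pfun UNIV u x" and i: "i \<in> Basis"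
  shows "ptensor u x i = 0"
proof -
  obtain g l where gl: "has_lap (pfun UNIV u) x g l" "l + ((2 / u x) *\<^sub>R grad UNIV u x) \<bullet> g =
     2 * u x powr (- (2 * (real DIM('a) - 1) / (real DIM('a) - 2))) * (\<Sum>i\<in>Basis. (norm (ptensor u x i))\<^sup>2)"
    using pfun_subsolution[OF W pos x dim] by blast
  have "g = 0" "l \<le> 0" using has_lap_local_max[OF gl(1) max] by auto
  then have "u x powr (- (2 * (real DIM('a) - 1) / (real DIM('a) - 2))) * (\<Sum>i\<in>Basis. (norm (ptensor u x i))\<^sup>2) \<le> 0"
    using gl(2) unfolding \<open>g = 0\<close> inner_zero_right by linarith
  moreover have "u x powr (- (2 * (real DIM('a) - 1) / (real DIM('a) - 2))) > 0" using pos[OF x] by simp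
  ultimately have "(\<Sum>i\<in>Basis. (norm (ptensor u x i))\<^sup>2) \<le> 0" by (simp add: mult_le_0_iff not_le[symmetric])
  then have "(\<Sum>i\<in>Basis. (norm (ptensor u x i))\<^sup>2) = 0" by (simp add: sum_nonneg order_antisym)
  then show ?thesis using i by (simp add: sum_nonneg_eq_0_iff)
qed

text \<open>
  With constant P-function \<open>m\<close> the field \<open>u powr (- n / (n - 2)) * Du\<close> has derivative \<open>- m / (n - 2)\<close> times the
  identity, so it equals \<open>- m / (n - 2) * (x - x0)\<close> for some \<open>x0\<close>; taking norms gives \<open>u\<close>.
\<close>

lemma pfun_constant_imp_model:
  fixes u :: "'a::euclidean_space \<Rightarrow> real"
  assumes W: "open W" "harmonic_on W u" and pos: "\<And>x. x \<in> W \<Longrightarrow> u x > 0" and dim: "DIM('a) \<ge> 3"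
    and sub: "ball x1 r \<subseteq> W" and r: "r > 0" and m: "m > 0" "\<And>x. x \<in> ball x1 r \<Longrightarrow> pfun UNIV u x = m"
  shows "\<exists>x0. \<forall>y\<in>ball x1 r. u y = (m / (real DIM('a) - 2)\<^sup>2 * (norm (y - x0))\<^sup>2) powr (- ((real DIM('a) - 2) / 2))"
proof -
  define n where "n = real DIM('a)"
  have n: "n > 2" using dim by (simp add: n_def)
  define \<alpha> where "\<alpha> = n / (n - 2)"
  define \<beta> where "\<beta> = 1 / (n - 2)"
  have \<beta>: "\<beta> > 0" using n by (simp add: \<beta>_def)
  have q: "2 * (n - 1) / (n - 2) = \<alpha> + 1" using n by (simp add: \<alpha>_def field_simps)
  let ?g = "grad UNIV u"
  let ?V = "\<lambda>y. u y powr (- \<alpha>) *\<^sub>R ?g y + (\<beta> * m) *\<^sub>R y"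
  have u2: "Ck_on 2 W u" using W by (simp add: harmonic_on_def)
  have S: "(norm (?g y))\<^sup>2 = m * u y powr (\<alpha> + 1)" if "y \<in> ball x1 r" for y
  proof -
    have "(norm (?g y))\<^sup>2 * u y powr (- (\<alpha> + 1)) = m" using m(2)[OF that] q by (simp add: pfun_def n_def)
    moreover have "u y powr (- (\<alpha> + 1)) * u y powr (\<alpha> + 1) = 1"
      using pos[of y] that sub by (subst powr_add[symmetric]) auto
    ultimately show ?thesis by (metis mult.assoc mult.right_neutral)
  qed
  have dV: "(?V has_derivative (\<lambda>v. 0)) (at y)" if y: "y \<in> ball x1 r" for y
  proof -
    have yW: "y \<in> W" using y sub by blast
    have uy: "u y > 0" using pos[OF yW] .
    have T: "ptensor u y i = 0" if "i \<in> Basis" for i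
    proof (rule ptensor_eq_0[OF W pos yW dim _ that])
      show "\<forall>\<^sub>F z in nhds y. pfun UNIV u z \<le> pfun UNIV u y"
        using eventually_nhds_in_open[OF open_ball y] by eventually_elim (use m(2) y in auto)
    qed
    define A where "A = \<alpha> / u y"
    define B where "B = \<beta> * (norm (?g y))\<^sup>2 / u y"
    \<comment> \<open>The vanishing tensor is the equation that D^2u is A times the square of Du
      minus B times the identity.\<close>
    have D: "grad UNIV (pd UNIV i u) y = (A * pd UNIV i u y) *\<^sub>R ?g y - B *\<^sub>R i" if "i \<in> Basis" for i
      using T[OF that] unfolding ptensor_def A_def B_def \<alpha>_def \<beta>_def n_def
      by (simp add: algebra_simps)
    have dg: "(?g has_derivative (\<lambda>v. (A * (?g y \<bullet> v)) *\<^sub>R ?g y - B *\<^sub>R v)) (at y)"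
    proof -
      have "(?g has_derivative (\<lambda>v. \<Sum>i\<in>Basis. (grad UNIV (pd UNIV i u) y \<bullet> v) *\<^sub>R i)) (at y)"
        unfolding grad_def[of UNIV u, abs_def]
        by (intro has_derivative_sum has_derivative_scaleR_left has_derivative_grad Ck_on_2D(2)[OF W(1) u2 yW])
      moreover have "(\<Sum>i\<in>Basis. (grad UNIV (pd UNIV i u) y \<bullet> v) *\<^sub>R i) = (A * (?g y \<bullet> v)) *\<^sub>R ?g y - B *\<^sub>R v" for v
      proof (rule euclidean_eqI)
        fix j :: 'a assume j: "j \<in> Basis"
        have "(\<Sum>i\<in>Basis. (grad UNIV (pd UNIV i u) y \<bullet> v) *\<^sub>R i) \<bullet> j = grad UNIV (pd UNIV j u) y \<bullet> v"
          using j by simp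
        also have "\<dots> = ((A * (?g y \<bullet> v)) *\<^sub>R ?g y - B *\<^sub>R v) \<bullet> j"
          unfolding D[OF j] using j by (simp add: inner_diff_left grad_inner_Basis inner_commute[of j])
        finally show "(\<Sum>i\<in>Basis. (grad UNIV (pd UNIV i u) y \<bullet> v) *\<^sub>R i) \<bullet> j = ((A * (?g y \<bullet> v)) *\<^sub>R ?g y - B *\<^sub>R v) \<bullet> j" .
      qed
      ultimately show ?thesis by simp
    qed
    have du: "((\<lambda>y. u y powr (- \<alpha>)) has_derivative (\<lambda>v. (- \<alpha> * u y powr (- \<alpha> - 1)) * (?g y \<bullet> v))) (at y)"
      using has_derivative_compose[OF has_derivative_grad[OF Ck_on_2D(1)[OF W(1) u2 yW]]
          has_real_derivative_powr[OF uy, of "- \<alpha>", unfolded has_field_derivative_def]] by simp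
    have "(?V has_derivative (\<lambda>v. (u y powr (- \<alpha>) *\<^sub>R ((A * (?g y \<bullet> v)) *\<^sub>R ?g y - B *\<^sub>R v)
        + ((- \<alpha> * u y powr (- \<alpha> - 1)) * (?g y \<bullet> v)) *\<^sub>R ?g y) + (\<beta> * m) *\<^sub>R v)) (at y)"
      by (intro has_derivative_add has_derivative_scaleR du dg has_derivative_scaleR_right has_derivative_ident)
    moreover have "(u y powr (- \<alpha>) *\<^sub>R ((A * (?g y \<bullet> v)) *\<^sub>R ?g y - B *\<^sub>R v)
        + ((- \<alpha> * u y powr (- \<alpha> - 1)) * (?g y \<bullet> v)) *\<^sub>R ?g y) + (\<beta> * m) *\<^sub>R v = 0" for v
    proof -
      have p1: "u y powr (- \<alpha> - 1) = u y powr (- \<alpha>) / u y" using uy by (simp add: powr_diff)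
      have "u y powr (- \<alpha>) * B = \<beta> * m"
      proof -
        have "u y powr (- \<alpha>) * B = \<beta> * m * (u y powr (- \<alpha>) * u y powr (\<alpha> + 1) / u y)"
          unfolding B_def S[OF y] by simp
        also have "u y powr (- \<alpha>) * u y powr (\<alpha> + 1) = u y" using uy by (simp add: powr_add[symmetric])
        finally show ?thesis using uy by simp
      qed
      moreover have "u y powr (- \<alpha>) * (A * (?g y \<bullet> v)) + (- \<alpha> * u y powr (- \<alpha> - 1)) * (?g y \<bullet> v) = 0"
        unfolding p1 A_def by simp
      ultimately show ?thesis
        by (simp add: scaleR_diff_right scaleR_left_distrib[symmetric] del: scaleR_left_distrib)
    qed
    ultimately show ?thesis by simp
  qed
  have "\<exists>c. \<forall>y\<in>ball x1 r. ?V y = c"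
    by (rule has_derivative_zero_constant[OF convex_ball]) (use dV has_derivative_at_withinI in blast)
  then obtain c where c: "\<And>y. y \<in> ball x1 r \<Longrightarrow> ?V y = c" by blast
  define x0 where "x0 = c /\<^sub>R (\<beta> * m)"
  have "\<beta> * m \<noteq> 0" using \<beta> m(1) by simp
  from right_inverse[OF this] have x0: "(\<beta> * m) *\<^sub>R x0 = c" unfolding x0_def scaleR_scaleR by (simp only: scaleR_one)
  have "u y = (m / (n - 2)\<^sup>2 * (norm (y - x0))\<^sup>2) powr (- ((n - 2) / 2))" if y: "y \<in> ball x1 r" for y
  proof -
    have uy: "u y > 0" using pos[of y] y sub by blast
    have "u y powr (- \<alpha>) *\<^sub>R ?g y = c - (\<beta> * m) *\<^sub>R y" using c[OF y] by (simp add: algebra_simps)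
    also have "\<dots> = (\<beta> * m) *\<^sub>R (x0 - y)" by (simp only: scaleR_diff_right x0)
    finally have "(norm (u y powr (- \<alpha>) *\<^sub>R ?g y))\<^sup>2 = (norm ((\<beta> * m) *\<^sub>R (x0 - y)))\<^sup>2" by simp
    then have "(u y powr (- \<alpha>))\<^sup>2 * (norm (?g y))\<^sup>2 = (\<beta> * m)\<^sup>2 * (norm (y - x0))\<^sup>2"
      by (simp add: power_mult_distrib norm_minus_commute)
    then have "m * ((u y powr (- \<alpha>))\<^sup>2 * u y powr (\<alpha> + 1)) = m * (\<beta>\<^sup>2 * m * (norm (y - x0))\<^sup>2)"
      unfolding S[OF y] by (simp add: power2_eq_square algebra_simps)
    then have "(u y powr (- \<alpha>))\<^sup>2 * u y powr (\<alpha> + 1) = \<beta>\<^sup>2 * m * (norm (y - x0))\<^sup>2"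
      using m(1) by simp
    moreover have "(u y powr (- \<alpha>))\<^sup>2 * u y powr (\<alpha> + 1) = u y powr (1 - \<alpha>)"
      by (simp add: power2_eq_square powr_add[symmetric])
    ultimately have e: "u y powr (1 - \<alpha>) = m / (n - 2)\<^sup>2 * (norm (y - x0))\<^sup>2"
      by (simp add: \<beta>_def power2_eq_square)
    have "(1 - \<alpha>) * (- ((n - 2) / 2)) = 1" using n by (simp add: \<alpha>_def field_simps)
    then have "u y = (u y powr (1 - \<alpha>)) powr (- ((n - 2) / 2))" using uy by (simp add: powr_powr)
    then show ?thesis unfolding e .
  qed
  then show ?thesis unfolding n_def by blast
qed

text \<open>This is a multiple of |x - x0|^(2-n). Writing it as a power of the squared distance
  keeps the inner function polynomial, so that differentiability can only fail at
  \<open>x0\<close>.\<close>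

lemma harmonic_on_model:
  fixes x0 :: "'a::euclidean_space"
  assumes C: "C > 0"
  shows "harmonic_on (- {x0}) (\<lambda>x. (C * (norm (x - x0))\<^sup>2) powr (- ((real DIM('a) - 2) / 2)))"
proof -
  define n where "n = real DIM('a)"
  define p where "p = - ((n - 2) / 2)"
  let ?s = "\<lambda>x. C * ((x - x0) \<bullet> (x - x0))"
  \<comment> \<open>\<open>?F m\<close> is the \<open>m\<close>-th derivative of t^p.\<close>
  let ?F = "\<lambda>m t. (\<Prod>j<m. (p - real j)) * t powr (p - real m)"
  have o: "open (- {x0})" by (intro open_Compl) simp
  have s: "Ck_on k (- {x0}) ?s" for k
  proof -
    have "Ck_on k (- {x0}) (\<lambda>x. \<Sum>i\<in>Basis. ((x - x0) \<bullet> i) * ((x - x0) \<bullet> i))"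
      by (intro Ck_on_sum Ck_on_mult Ck_on_inner o)
    then have "Ck_on k (- {x0}) (\<lambda>x. (x - x0) \<bullet> (x - x0))" by (subst euclidean_inner)
    then show ?thesis by (rule Ck_on_cmult[OF o])
  qed
  have F: "(?F m has_real_derivative ?F (Suc m) (?s x)) (at (?s x))" if "x \<in> - {x0}" for m x
  proof -
    have "?s x > 0" using C that by simp
    from DERIV_cmult[OF has_real_derivative_powr[OF this], of "\<Prod>j<m. (p - real j)" "p - real m"]
    show ?thesis by (simp add: algebra_simps)
  qed
  have "Ck_on 2 (- {x0}) (\<lambda>x. ?F 0 (?s x))"
    by (rule Ck_on_compose_real[where F="?F" and m=0, OF o s F])
  then have "Ck_on 2 (- {x0}) (\<lambda>x. (C * (norm (x - x0))\<^sup>2) powr p)"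
    by (simp add: power2_norm_eq_inner)
  moreover have "laplacian UNIV (\<lambda>x. (C * (norm (x - x0))\<^sup>2) powr p) x = 0" if x: "x \<in> - {x0}" for x
  proof -
    define t where "t = C * (norm (x - x0))\<^sup>2"
    have t: "t > 0" using C x by (simp add: t_def)
    have ev: "\<forall>\<^sub>F t in nhds t. ((\<lambda>t. t powr p) has_real_derivative p * t powr (p - 1)) (at t)"
      using eventually_nhds_in_open[of "{0<..}" t] t
      by (auto elim!: eventually_mono intro!: has_real_derivative_powr)
    have d2: "((\<lambda>t. p * t powr (p - 1)) has_real_derivative p * ((p - 1) * t powr (p - 1 - 1))) (at t)"
      using t by (intro DERIV_cmult has_real_derivative_powr)
    have "has_lap (\<lambda>x. (C * (norm (x - x0))\<^sup>2) powr p) x ((p * t powr (p - 1)) *\<^sub>R (C *\<^sub>R 2 *\<^sub>R (x - x0)))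
      ((p * t powr (p - 1)) * (C * (2 * DIM('a))) + p * ((p - 1) * t powr (p - 1 - 1)) * ((C *\<^sub>R 2 *\<^sub>R (x - x0)) \<bullet> (C *\<^sub>R 2 *\<^sub>R (x - x0))))"
      using has_lap_compose[OF has_lap_cmult[OF has_lap_norm_power2[of x0 x], of C], of "\<lambda>t. t powr p" "\<lambda>t. p * t powr (p - 1)"] ev d2
      unfolding t_def by blast
    from has_lap_laplacian(1)[OF this]
    have "laplacian UNIV (\<lambda>x. (C * (norm (x - x0))\<^sup>2) powr p) x
       = (p * t powr (p - 1)) * (C * (2 * n)) + p * ((p - 1) * t powr (p - 1 - 1)) * (4 * C * t)"
      by (simp add: n_def t_def power2_norm_eq_inner algebra_simps)
    also have "t powr (p - 1 - 1) = t powr (p - 1) / t" using t powr_diff[of t "p - 1" 1] by simp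
    also have "(p * t powr (p - 1)) * (C * (2 * n)) + p * ((p - 1) * (t powr (p - 1) / t)) * (4 * C * t)
      = p * C * t powr (p - 1) * (2 * n + 4 * (p - 1))"
      using t by (simp add: field_simps)
    \<comment> \<open>This equation is what determines the exponent \<open>p\<close>.\<close>
    also have "2 * n + 4 * (p - 1) = 0" by (simp add: p_def field_simps)
    finally show ?thesis by simp
  qed
  ultimately show ?thesis unfolding harmonic_on_def p_def n_def by blast
qed

section \<open>Positive harmonic functions near an isolated singularity\<close>

text \<open>A chain of 32 steps along the chord. The condition on the inner product keeps the chord
  at distance at least \<rho>/2 from the origin. Each step has length at most \<rho>/16, so the
  local inequality needs balls of radius 5\<rho>/16, and these avoid the origin.\<close>

lemma harnack_segment:
  fixes f :: "'a::euclidean_space \<Rightarrow> real"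
  assumes W: "open W" "harmonic_on W f" and pos: "\<And>z. z \<in> W \<Longrightarrow> f z \<ge> 0"
    and sub: "ball 0 (2 * \<rho>) - {0} \<subseteq> W" and \<rho>: "\<rho> > 0"
    and xy: "norm x = \<rho>" "norm y = \<rho>" "x \<bullet> y \<ge> 0"
    and H: "H = 6 / exp (- (4 / 3)) * 4 ^ DIM('a)"
  shows "f x \<le> H ^ 32 * f y"
proof -
  define z where "z k = x + (real k / 32) *\<^sub>R (y - x)" for k :: nat
  have zn: "\<rho> / 2 \<le> norm (z k)" "norm (z k) \<le> \<rho>" if "k \<le> 32" for k
  proof -
    define s where "s = real k / 32"
    have s: "0 \<le> s" "s \<le> 1" using that by (auto simp: s_def)
    have ze: "z k = (1 - s) *\<^sub>R x + s *\<^sub>R y" by (simp add: z_def s_def algebra_simps)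
    have "norm (z k) \<le> norm ((1 - s) *\<^sub>R x) + norm (s *\<^sub>R y)" unfolding ze by (rule norm_triangle_ineq)
    also have "\<dots> = (1 - s) * \<rho> + s * \<rho>" using s xy by simp
    also have "\<dots> = \<rho>" by (simp add: algebra_simps)
    finally show "norm (z k) \<le> \<rho>" .
    have "(norm (z k))\<^sup>2 = (1 - s)\<^sup>2 * \<rho>\<^sup>2 + s\<^sup>2 * \<rho>\<^sup>2 + 2 * (s * (1 - s) * (x \<bullet> y))"
    proof -
      have "x \<bullet> x = \<rho>\<^sup>2" "y \<bullet> y = \<rho>\<^sup>2" using xy(1,2) by (simp_all flip: power2_norm_eq_inner)
      then show ?thesis unfolding ze power2_norm_eq_inner inner_add_left inner_add_right inner_scaleR_left inner_scaleR_right
        inner_commute[of y x] by (simp add: power2_eq_square algebra_simps)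
    qed
    moreover have "s * (1 - s) * (x \<bullet> y) \<ge> 0" using s xy(3) by simp
    moreover have "(1 - s)\<^sup>2 * \<rho>\<^sup>2 + s\<^sup>2 * \<rho>\<^sup>2 \<ge> (\<rho> / 2)\<^sup>2"
    proof -
      have "1 / 4 \<le> (1 - s)\<^sup>2 + s\<^sup>2" using zero_le_power2[of "2 * s - 1"] by (simp add: power2_eq_square algebra_simps)
      then have "1 / 4 * \<rho>\<^sup>2 \<le> ((1 - s)\<^sup>2 + s\<^sup>2) * \<rho>\<^sup>2" by (rule mult_right_mono) simp
      then show ?thesis by (simp add: power_divide distrib_right)
    qed
    ultimately have "(\<rho> / 2)\<^sup>2 \<le> (norm (z k))\<^sup>2" by linarith
    then show "\<rho> / 2 \<le> norm (z k)" by (rule power2_le_imp_le) simp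
  qed
  have H0: "H \<ge> 0" by (simp add: H)
  have step: "f (z k) \<le> H * f (z (Suc k))" if k: "Suc k \<le> 32" for k
    unfolding H
  proof (rule harnack_local[OF W, of "\<rho> / 16"])
    show "cball (z (Suc k)) (5 * (\<rho> / 16)) \<subseteq> W"
    proof
      fix w assume "w \<in> cball (z (Suc k)) (5 * (\<rho> / 16))"
      then have d: "norm (z (Suc k) - w) \<le> 5 * (\<rho> / 16)" by (simp add: dist_norm)
      have "norm (z (Suc k)) \<le> norm w + norm (z (Suc k) - w)" "norm w \<le> norm (z (Suc k)) + norm (z (Suc k) - w)"
        using norm_triangle_ineq[of w "z (Suc k) - w"] norm_triangle_ineq4[of "z (Suc k)" "z (Suc k) - w"] by auto
      then have "0 < norm w" "norm w < 2 * \<rho>" using zn[OF k] d \<rho> by linarith+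
      then show "w \<in> W" using sub by auto
    qed
    have e: "z (Suc k) - z k = (1 / 32) *\<^sub>R (y - x)"
      unfolding z_def by (simp add: algebra_simps add_divide_distrib)
    have "norm (y - x) \<le> 2 * \<rho>" using norm_triangle_ineq4[of y x] xy by simp
    then show "dist (z (Suc k)) (z k) \<le> \<rho> / 16" unfolding dist_norm e by simp
  qed (use \<rho> pos in auto)
  have "k \<le> 32 \<Longrightarrow> f x \<le> H ^ k * f (z k)" for k
  proof (induction k)
    case 0
    then show ?case by (simp add: z_def)
  next
    case (Suc k)
    then have "f x \<le> H ^ k * f (z k)" by simp
    also have "\<dots> \<le> H ^ k * (H * f (z (Suc k)))" using step[OF Suc.prems] H0 by (intro mult_left_mono) auto
    finally show ?case by (simp add: ac_simps)
  qed
  from this[of 32] show ?thesis by (simp add: z_def)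
qed

text \<open>The chord between nearly antipodal points passes too close to the origin. In dimension
  at least 3 there is a point of the sphere orthogonal to both, and two chords through it
  do.\<close>

lemma harnack_sphere:
  fixes f :: "'a::euclidean_space \<Rightarrow> real"
  assumes W: "open W" "harmonic_on W f" and pos: "\<And>z. z \<in> W \<Longrightarrow> f z \<ge> 0"
    and sub: "ball 0 (2 * \<rho>) - {0} \<subseteq> W" and \<rho>: "\<rho> > 0"
    and xy: "norm x = \<rho>" "norm y = \<rho>" and dim: "DIM('a) \<ge> 3"
    and H: "H = 6 / exp (- (4 / 3)) * 4 ^ DIM('a)"
  shows "f x \<le> H ^ 64 * f y"
proof -
  have "dim {x, y} \<le> card {x, y}" by (rule dim_le_card') simp
  also have "\<dots> \<le> 2" by (simp add: card_insert_if)
  finally have "dim {x, y} < DIM('a)" using dim by simp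
  then obtain w where w: "w \<noteq> 0" "\<And>v. v \<in> span {x, y} \<Longrightarrow> orthogonal w v"
    using orthogonal_to_subspace_exists by blast
  define z where "z = (\<rho> / norm w) *\<^sub>R w"
  have z: "norm z = \<rho>" "x \<bullet> z \<ge> 0" "z \<bullet> y \<ge> 0"
    using w(1) w(2)[of x] w(2)[of y] \<rho> by (auto simp: z_def span_base orthogonal_def inner_commute[of x])
  have "f x \<le> H ^ 32 * f z" by (rule harnack_segment[OF W pos sub \<rho> xy(1) z(1,2) H])
  also have "\<dots> \<le> H ^ 32 * (H ^ 32 * f y)"
    using harnack_segment[OF W pos sub \<rho> z(1) xy(2) z(3) H] by (intro mult_left_mono) (auto simp: H)
  finally show ?thesis by (simp add: power_add[symmetric] mult.assoc[symmetric])
qed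

lemma harmonic_on_le_punctured_aux:
  fixes f :: "'a::euclidean_space \<Rightarrow> real"
  assumes U: "open \<Omega>" "bounded \<Omega>" "0 \<in> \<Omega>" and f: "continuous_on (closure \<Omega> - {0}) f" "harmonic_on (\<Omega> - {0}) f"
    and m: "\<And>x. x \<in> frontier \<Omega> \<Longrightarrow> f x \<le> m" and \<rho>: "0 < \<rho>" "\<And>x. x \<in> \<Omega> \<Longrightarrow> norm x = \<rho> \<Longrightarrow> f x \<le> m"
    and z: "z \<in> \<Omega>" "\<rho> < norm z"
  shows "f z \<le> m"
proof (rule harmonic_on_le_frontier[where U="\<Omega> - cball 0 \<rho>" and f=f and m=m and x=z])
  let ?U = "\<Omega> - cball 0 \<rho>"
  show o: "open ?U" using U(1) by (intro open_Diff) auto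
  show "bounded ?U" using U(2) by (rule bounded_subset) auto
  have cl: "closure ?U \<subseteq> closure \<Omega> - ball 0 \<rho>"
    by (rule closure_minimal) (auto intro: closure_subset[THEN subsetD] closed_Diff)
  then show "continuous_on (closure ?U) f" by (intro continuous_on_subset[OF f(1)]) (use \<rho> in auto)
  show "harmonic_on ?U f" by (rule harmonic_on_subset[OF o _ f(2)]) (use \<rho> in auto)
  show "z \<in> ?U" using z by simp
  fix x assume "x \<in> frontier ?U"
  then have x: "x \<in> closure ?U" "x \<notin> ?U" using o by (auto simp: frontier_def interior_open)
  show "f x \<le> m"
  proof (cases "x \<in> \<Omega>")
    case True
    then have "norm x = \<rho>" using x cl by force
    then show ?thesis using True \<rho>(2) by blast
  next
    case False
    then have "x \<in> frontier \<Omega>" using x(1) cl U(1) by (auto simp: frontier_def interior_open)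
    then show ?thesis by (rule m)
  qed
qed

text \<open>A bounded singularity does not affect the maximum principle: subtracting a small
  multiple of the fundamental solution makes the function small on a tiny sphere about 0, and the
  multiple then tends to 0.\<close>

lemma harmonic_on_le_punctured:
  fixes f :: "'a::euclidean_space \<Rightarrow> real"
  assumes U: "open \<Omega>" "bounded \<Omega>" "0 \<in> \<Omega>" and f: "continuous_on (closure \<Omega> - {0}) f" "harmonic_on (\<Omega> - {0}) f"
    and m: "\<And>x. x \<in> frontier \<Omega> \<Longrightarrow> f x \<le> m" and B: "\<And>x. x \<in> \<Omega> - {0} \<Longrightarrow> f x \<le> B"
    and dim: "DIM('a) \<ge> 3" and z: "z \<in> \<Omega> - {0}"
  shows "f z \<le> m"
proof (rule field_le_epsilon)
  let ?p = "- ((real DIM('a) - 2) / 2)"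
  let ?\<Phi> = "\<lambda>x :: 'a. (1 * (norm (x - 0))\<^sup>2) powr ?p"
  fix e' :: real assume e': "e' > 0"
  define e where "e = e' / ?\<Phi> z"
  have \<Phi>z: "?\<Phi> z > 0" using z by simp
  have e: "e > 0" using e' \<Phi>z by (simp add: e_def)
  have p: "?p < 0" using dim by simp
  have lim: "((\<lambda>t::real. t powr ?p) \<longlongrightarrow> 0) at_top"
    using tendsto_neg_powr[OF p filterlim_ident] by simp
  \<comment> \<open>\<rho> is chosen so small that the fundamental solution is at least
    \<open>c\<close> on the sphere of radius \<rho>. There \<open>e * ?\<Phi>\<close> exceeds
    \<open>B - m\<close>, which brings the difference below \<open>m\<close>.\<close>
  define c where "c = (\<bar>B - m\<bar> + 1) / e"
  have c: "c > 0" using e by (simp add: c_def)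
  define \<rho> where "\<rho> = min (norm z / 2) (sqrt (c powr (1 / ?p)))"
  have "\<rho> \<le> norm z / 2" by (simp add: \<rho>_def)
  moreover have "norm z > 0" using z by simp
  ultimately have "\<rho> < norm z" by linarith
  moreover have "\<rho> > 0" using c z by (simp add: \<rho>_def)
  ultimately have \<rho>: "\<rho> > 0" "\<rho> < norm z" by blast+
  have c\<rho>: "c \<le> (\<rho>\<^sup>2) powr ?p"
  proof -
    have "\<rho>\<^sup>2 \<le> (sqrt (c powr (1 / ?p)))\<^sup>2" using \<rho> by (intro power_mono) (auto simp: \<rho>_def)
    also have "\<dots> = c powr (1 / ?p)" by simp
    finally have "\<rho>\<^sup>2 \<le> c powr (1 / ?p)" .
    then have "(c powr (1 / ?p)) powr ?p \<le> (\<rho>\<^sup>2) powr ?p" using \<rho> p by (intro powr_mono2') auto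
    moreover have "(c powr (1 / ?p)) powr ?p = c"
    proof -
      have "(c powr (1 / r)) powr r = c" if "r < 0" for r
        using c that by (simp add: powr_powr)
      from this[OF p] show ?thesis .
    qed
    ultimately show ?thesis by simp
  qed
  have o: "open (\<Omega> - {0})" using U(1) by (intro open_Diff) auto
  have h: "harmonic_on (\<Omega> - {0}) ?\<Phi>"
    by (rule harmonic_on_subset[OF o _ harmonic_on_model[of 1 0]]) auto
  have "f z - e * ?\<Phi> z \<le> m"
  proof (rule harmonic_on_le_punctured_aux[OF U _ _ _ \<rho>(1) _ _ \<rho>(2)])
    show "continuous_on (closure \<Omega> - {0}) (\<lambda>x. f x - e * ?\<Phi> x)"
      by (intro continuous_intros f) auto
    show "harmonic_on (\<Omega> - {0}) (\<lambda>x. f x - e * ?\<Phi> x)"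
      by (intro harmonic_on_diff harmonic_on_cmult f h o)
    show "f x - e * ?\<Phi> x \<le> m" if "x \<in> frontier \<Omega>" for x
    proof -
      have "e * ?\<Phi> x \<ge> 0" using e by simp
      then show ?thesis using m[OF that] by linarith
    qed
    show "f x - e * ?\<Phi> x \<le> m" if "x \<in> \<Omega>" "norm x = \<rho>" for x
    proof -
      have "f x \<le> B" using B[of x] that \<rho> by force
      moreover have "e * c \<le> e * ?\<Phi> x" using c\<rho> e that by (intro mult_left_mono) auto
      moreover have "e * c = \<bar>B - m\<bar> + 1" using e by (simp add: c_def)
      ultimately show ?thesis by linarith
    qed
    show "z \<in> \<Omega>" using z by simp
  qed
  moreover have "e * ?\<Phi> z = e'" using \<Phi>z by (simp add: e_def)
  ultimately show "f z \<le> m + e'" by linarith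
qed

text \<open>If \<open>u\<close> does not tend to infinity at 0, it takes values at most some
  \<open>B\<close> at points arbitrarily close to 0. Harnack's inequality bounds it on the whole
  spheres through these points, and the maximum principle outside them bounds it everywhere. The
  singularity is then harmless and gives \<open>u \<le> c\<close>; the converse inequality comes
  from the positivity of \<open>u\<close>.\<close>

theorem positive_harmonic_singularity:
  fixes u :: "'a::euclidean_space \<Rightarrow> real"
  assumes U: "open \<Omega>" "bounded \<Omega>" "0 \<in> \<Omega>" and f: "continuous_on (closure \<Omega> - {0}) u" "harmonic_on (\<Omega> - {0}) u"
    and c: "\<And>x. x \<in> frontier \<Omega> \<Longrightarrow> u x = c" and pos: "\<And>x. x \<in> \<Omega> - {0} \<Longrightarrow> u x > 0" and dim: "DIM('a) \<ge> 3"
  shows "(\<forall>x\<in>\<Omega> - {0}. u x = c) \<or> (\<forall>B. \<exists>r>0. \<forall>x. 0 < norm x \<and> norm x < r \<longrightarrow> u x > B)"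
    and "\<And>x. x \<in> \<Omega> - {0} \<Longrightarrow> c \<le> u x"
proof -
  have o: "open (\<Omega> - {0})" using U(1) by (intro open_Diff) auto
  have ge: "c \<le> u x" if x: "x \<in> \<Omega> - {0}" for x
  proof -
    have "(-1) * u x \<le> - c"
      by (rule harmonic_on_le_punctured[OF U _ harmonic_on_cmult[OF o f(2)] _ _ dim x, of "-1" "-c" 0])
        (use c pos less_imp_le in \<open>auto intro!: continuous_intros f(1)\<close>)
    then show ?thesis by simp
  qed
  show "\<And>x. x \<in> \<Omega> - {0} \<Longrightarrow> c \<le> u x" by (rule ge)
  show "(\<forall>x\<in>\<Omega> - {0}. u x = c) \<or> (\<forall>B. \<exists>r>0. \<forall>x. 0 < norm x \<and> norm x < r \<longrightarrow> u x > B)"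
  proof (rule ccontr)
    assume neg: "\<not> ?thesis"
    then obtain B where "\<not> (\<exists>r>0. \<forall>x. 0 < norm x \<and> norm x < r \<longrightarrow> u x > B)" by blast
    then have B: "\<exists>x. 0 < norm x \<and> norm x < r \<and> u x \<le> B" if "r > 0" for r
      using that by (meson not_less)
    obtain R where R: "R > 0" "ball 0 R \<subseteq> \<Omega>" using U open_contains_ball by blast
    define H :: real where "H = 6 / exp (- (4 / 3)) * 4 ^ DIM('a)"
    have "u z \<le> max c (H ^ 64 * B)" if z: "z \<in> \<Omega> - {0}" for z
    proof -
      have "min (R / 2) (norm z) > 0" using R z by auto
      then obtain x where x: "0 < norm x" "norm x < min (R / 2) (norm z)" "u x \<le> B" using B by blast
      show ?thesis
      proof (rule harmonic_on_le_punctured_aux[OF U f _ x(1)])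
        show "z \<in> \<Omega>" "norm x < norm z" using z x by auto
        show "u y \<le> max c (H ^ 64 * B)" if "y \<in> frontier \<Omega>" for y using c[OF that] by simp
        show "u y \<le> max c (H ^ 64 * B)" if "y \<in> \<Omega>" "norm y = norm x" for y
        proof -
          have "ball 0 (2 * norm x) - {0} \<subseteq> \<Omega> - {0}" using x R by (auto simp: subset_iff)
          then have "u y \<le> H ^ 64 * u x"
            by (intro harnack_sphere[OF o f(2) _ _ x(1) that(2) refl dim H_def]) (use pos less_imp_le in auto)
          also have "\<dots> \<le> H ^ 64 * B" using x by (intro mult_left_mono) (auto simp: H_def)
          finally show ?thesis by simp
        qed
      qed
    qed
    then have "u z \<le> c" if "z \<in> \<Omega> - {0}" for z
      by (intro harmonic_on_le_punctured[OF U f _ _ dim that, of _ "max c (H ^ 64 * B)"]) (use c in auto)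
    then have "\<forall>x\<in>\<Omega> - {0}. u x = c" using ge by (meson order_antisym)
    then show False using neg by blast
  qed
qed

section \<open>Distributional solutions\<close>

lemma test_function_bump_fn:
  assumes "r > 0" "cball x r \<subseteq> \<Omega>"
  shows "test_function \<Omega> (bump_fn 0 x r)"
proof -
  have "{y. bump_fn 0 x r y \<noteq> 0} \<subseteq> cball x r" using bump_fn_outside[OF assms(1)] by blast
  then have s: "closure {y. bump_fn 0 x r y \<noteq> 0} \<subseteq> cball x r" by (rule closure_minimal) simp
  then have "compact (closure {y. bump_fn 0 x r y \<noteq> 0})"
    using bounded_subset[OF bounded_cball s] by (simp add: compact_eq_bounded_closed)
  then show ?thesis unfolding test_function_def smooth_on_def
    using Ck_on_bump_fn[OF assms(1)] s assms(2) by blast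
qed

text \<open>Passes from the Lebesgue integral in the distributional equation to the integral used in
  Green's identity.\<close>

lemma set_lebesgue_integral_supported:
  fixes h :: "'a::euclidean_space \<Rightarrow> real"
  assumes S: "compact S" "S \<subseteq> \<Omega>" and h: "continuous_on UNIV h" "\<And>z. z \<notin> S \<Longrightarrow> h z = 0"
  shows "(LINT z:\<Omega>|lborel. h z) = integral UNIV h"
proof -
  have e1: "(\<lambda>z. indicator S z *\<^sub>R h z) = h" using h(2) by (auto simp: indicator_def fun_eq_iff)
  have e2: "(\<lambda>z. indicator \<Omega> z *\<^sub>R h z) = h" using h(2) S(2) by (auto simp: indicator_def fun_eq_iff)
  have "integrable lborel (\<lambda>z. indicator S z *\<^sub>R h z)"
    by (rule borel_integrable_compact[OF S(1)]) (rule continuous_on_subset[OF h(1)], simp)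
  then have "integral UNIV h = integral\<^sup>L lborel h" unfolding e1 by (rule integral_lborel)
  then show ?thesis unfolding set_lebesgue_integral_def e2 by simp
qed

text \<open>As \<open>u\<close> is C^2, Green's identity turns the weak equation into orthogonality
  of its continuous Laplacian to all bumps. A nonzero value would give a bump on which the Laplacian
  has a fixed sign.\<close>

lemma weak_harmonic_imp_harmonic:
  fixes u :: "'a::euclidean_space \<Rightarrow> real"
  assumes V: "open V" "V \<subseteq> \<Omega>" "Ck_on 2 V u"
    and weak: "\<And>\<phi>. test_function \<Omega> \<phi> \<Longrightarrow> closure {x. \<phi> x \<noteq> 0} \<subseteq> V \<Longrightarrow> (LINT x:\<Omega>|lborel. u x * laplacian UNIV \<phi> x) = 0"
  shows "harmonic_on V u"
proof -
  have lapc: "continuous_on V (laplacian UNIV u)"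
    unfolding laplacian_def[abs_def] using Ck_on_2D(5)[OF V(1,3)] by (intro continuous_on_sum) auto
  have int0: "integral UNIV (\<lambda>z. laplacian UNIV u z * bump_fn 0 x r z) = 0" if r: "r > 0" "cball x r \<subseteq> V" for x r
  proof -
    have out: "bump_fn 0 x r z = 0" if "z \<notin> cball x r" for z using bump_fn_outside[OF r(1) that] .
    have "{y. bump_fn 0 x r y \<noteq> 0} \<subseteq> cball x r" using out by blast
    then have s: "closure {y. bump_fn 0 x r y \<noteq> 0} \<subseteq> cball x r" by (rule closure_minimal) simp
    have lo: "laplacian UNIV (bump_fn 0 x r) z = 0" if "z \<notin> cball x r" for z
      using laplacian_cong_open[of "- cball x r" "bump_fn 0 x r" "\<lambda>_. 0" z] out that by (simp add: laplacian_const open_Compl)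
    have c: "continuous_on UNIV (\<lambda>z. u z * laplacian UNIV (bump_fn 0 x r) z)"
    proof (rule continuous_on_supported_mult[OF V(1) _ closed_cball r(2)])
      show "continuous_on V u" using Ck_on_imp_continuous_on[OF V(3)] .
      show "continuous_on UNIV (laplacian UNIV (bump_fn 0 x r))"
        unfolding laplacian_def[abs_def]
        using Ck_on_2D(5)[OF open_UNIV Ck_on_bump_fn[OF r(1)]] by (intro continuous_on_sum) auto
    qed (rule lo)
    have "integral UNIV (\<lambda>z. u z * laplacian UNIV (bump_fn 0 x r) z) = (LINT z:\<Omega>|lborel. u z * laplacian UNIV (bump_fn 0 x r) z)"
      by (rule set_lebesgue_integral_supported[symmetric, OF compact_cball _ c]) (use r V(2) lo in auto)
    also have "\<dots> = 0"
      by (rule weak[OF test_function_bump_fn[OF r(1)]]) (use s r V(2) in auto)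
    finally show ?thesis
      using green[OF V(1,3) compact_cball r(2) Ck_on_bump_fn[OF r(1)] out] by simp
  qed
  have le: "s * laplacian UNIV u x \<le> 0" if x: "x \<in> V" and s: "s \<in> {1, -1}" for x s
  proof (rule ccontr)
    assume "\<not> s * laplacian UNIV u x \<le> 0"
    then have gt: "s * laplacian UNIV u x > 0" by simp
    have "isCont (\<lambda>y. s * laplacian UNIV u y) x"
      using continuous_on_mult_left[OF lapc, of s] V(1) x by (simp add: continuous_on_eq_continuous_at)
    then have "((\<lambda>y. s * laplacian UNIV u y) \<longlongrightarrow> s * laplacian UNIV u x) (nhds x)"
      unfolding isCont_def using tendsto_at_iff_tendsto_nhds[of "\<lambda>y. s * laplacian UNIV u y" x] by simp
    then have "\<forall>\<^sub>F y in nhds x. s * laplacian UNIV u y > 0" using gt by (rule order_tendstoD(1))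
    then have "\<forall>\<^sub>F y in nhds x. s * laplacian UNIV u y > 0 \<and> y \<in> V"
      using eventually_nhds_in_open[OF V(1) x] by (rule eventually_conj)
    then obtain d where d: "d > 0" "\<And>y. dist y x < d \<Longrightarrow> s * laplacian UNIV u y > 0 \<and> y \<in> V"
      unfolding eventually_nhds_metric by blast
    define r where "r = d / 2"
    have r: "r > 0" "cball x r \<subseteq> V" using d by (auto simp: r_def dist_commute)
    have "integral UNIV (\<lambda>z. s * laplacian UNIV u z * bump_fn 0 x r z) > 0"
    proof (rule integral_supported_pos[of "cball x r" _ x])
      show "continuous_on UNIV (\<lambda>z. s * laplacian UNIV u z * bump_fn 0 x r z)"
        by (rule continuous_on_supported_mult[OF V(1) _ closed_cball r(2)])
          (use r in \<open>auto intro!: continuous_intros lapc continuous_on_bump_fn bump_fn_outside\<close>)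
      show "0 \<le> s * laplacian UNIV u z * bump_fn 0 x r z" for z
      proof (cases "z \<in> cball x r")
        case True
        then have "s * laplacian UNIV u z > 0" using d by (auto simp: r_def dist_commute)
        then show ?thesis using bump_fn_nonneg[of 0 x r z] by simp
      next
        case False
        then show ?thesis by (simp add: bump_fn_outside[OF r(1)])
      qed
    qed (use r gt bump_fn_pos[of r x x 0] in \<open>auto intro: bump_fn_outside\<close>)
    moreover have "integral UNIV (\<lambda>z. s * laplacian UNIV u z * bump_fn 0 x r z) = s * integral UNIV (\<lambda>z. laplacian UNIV u z * bump_fn 0 x r z)"
      by (simp only: mult.assoc integral_mult_right)
    ultimately show False using int0[OF r] by simp
  qed
  have "laplacian UNIV u x = 0" if "x \<in> V" for x using le[OF that, of 1] le[OF that, of "-1"] by simp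
  then show ?thesis using V(3) by (simp add: harmonic_on_def)
qed

section \<open>Mean curvature of level sets\<close>

text \<open>The spectral theorem on an invariant subspace: a maximum point of the quadratic form on
  the unit sphere is an eigenvector, and its orthogonal complement in \<open>V\<close> is again
  invariant.\<close>

lemma symmetric_orthonormal_eigenbasis:
  fixes S :: "'a::euclidean_space \<Rightarrow> 'a"
  assumes lin: "linear S"
  shows "subspace V \<Longrightarrow> (\<And>v. v \<in> V \<Longrightarrow> S v \<in> V) \<Longrightarrow> (\<And>v w. v \<in> V \<Longrightarrow> w \<in> V \<Longrightarrow> S v \<bullet> w = v \<bullet> S w) \<Longrightarrow>
    \<exists>E \<kappa>. pairwise orthogonal E \<and> (\<forall>e\<in>E. norm e = 1) \<and> span E = V \<and> (\<forall>e\<in>E. S e = \<kappa> e *\<^sub>R e)"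
proof (induction "dim V" arbitrary: V rule: less_induct)
  case less
  note V = less.prems
  show ?case
  proof (cases "V = {0}")
    case True
    then show ?thesis by (intro exI[of _ "{}"]) (auto simp: pairwise_def)
  next
    case False
    then obtain v0 where v0: "v0 \<in> V" "v0 \<noteq> 0" using subspace_0[OF V(1)] by blast
    let ?K = "V \<inter> sphere 0 1"
    have K: "compact ?K" using closed_subspace[OF V(1)] by (intro closed_Int_compact) auto
    have "v0 /\<^sub>R norm v0 \<in> ?K" using v0 subspace_scale[OF V(1)] by simp
    then have Kne: "?K \<noteq> {}" by force
    have c: "continuous_on ?K (\<lambda>v. v \<bullet> S v)"
      using linear_continuous_on[OF lin[unfolded linear_conv_bounded_linear]] by (intro continuous_intros)
    obtain e where e: "e \<in> ?K" "\<And>v. v \<in> ?K \<Longrightarrow> v \<bullet> S v \<le> e \<bullet> S e"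
      using continuous_attains_sup[OF K Kne c] by metis
    define l where "l = e \<bullet> S e"
    have eV: "e \<in> V" and en: "norm e = 1" "e \<bullet> e = 1" using e(1) by (auto simp: norm_eq_1)
    have max: "v \<bullet> S v \<le> l * (v \<bullet> v)" if v: "v \<in> V" for v
    proof (cases "v = 0")
      case True
      then show ?thesis by simp
    next
      case False
      have "v /\<^sub>R norm v \<in> ?K" using v False subspace_scale[OF V(1)] by simp
      from e(2)[OF this] have "(v \<bullet> S v) / (norm v)\<^sup>2 \<le> l"
        by (simp add: l_def linear_scale[OF lin] power2_eq_square divide_inverse ac_simps)
      then show ?thesis using False by (simp add: divide_le_eq power2_norm_eq_inner)
    qed
    have orth: "w \<bullet> S e = 0" if w: "w \<in> V" "w \<bullet> e = 0" for w
    proof -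
      define \<beta> where "\<beta> = w \<bullet> S e"
      define \<gamma> where "\<gamma> = l * (w \<bullet> w) - w \<bullet> S w"
      have q: "2 * t * \<beta> \<le> t\<^sup>2 * \<gamma>" for t :: real
      proof -
        have "e + t *\<^sub>R w \<in> V" using eV w(1) by (intro subspace_add[OF V(1)] subspace_scale[OF V(1)])
        from max[OF this] have "l + t * (e \<bullet> S w) + t * (w \<bullet> S e) + t * t * (w \<bullet> S w) \<le> l * (1 + t * t * (w \<bullet> w))"
          using en w(2) by (simp add: linear_add[OF lin] linear_scale[OF lin] inner_add_left inner_add_right inner_commute[of e w] l_def algebra_simps)
        moreover have "e \<bullet> S w = \<beta>" using V(3)[OF eV w(1)] by (simp add: \<beta>_def inner_commute)
        ultimately show ?thesis by (simp add: \<beta>_def \<gamma>_def power2_eq_square algebra_simps)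
      qed
      have "\<gamma> \<ge> 0" using q[of 1] q[of "-1"] by simp
      \<comment> \<open>The inequality \<open>q\<close> is linear in \<open>t\<close> on the left
        and quadratic on the right; this \<open>t\<close> violates it unless \<beta> = 0.\<close>
      define t where "t = \<beta> / (\<gamma> + 1)"
      have "2 * t * \<beta> \<le> t\<^sup>2 * \<gamma>" by (rule q)
      moreover have "\<beta> = t * (\<gamma> + 1)" using \<open>\<gamma> \<ge> 0\<close> by (simp add: t_def)
      ultimately have "t\<^sup>2 * (\<gamma> + 2) \<le> 0" by (simp add: power2_eq_square algebra_simps)
      then have "t = 0" using \<open>\<gamma> \<ge> 0\<close> by (simp add: mult_le_0_iff)
      then show ?thesis using \<open>\<beta> = t * (\<gamma> + 1)\<close> by (simp add: \<beta>_def)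
    qed
    have Se: "S e = l *\<^sub>R e"
    proof -
      let ?w = "S e - l *\<^sub>R e"
      have "?w \<in> V" using V(2)[OF eV] eV by (intro subspace_diff[OF V(1)] subspace_scale[OF V(1)])
      moreover have we: "?w \<bullet> e = 0" using en by (simp add: inner_diff_left inner_diff_right l_def inner_commute)
      ultimately have "?w \<bullet> S e = 0" by (rule orth)
      then have "?w \<bullet> ?w = 0" using we by (simp add: inner_diff_right)
      then show ?thesis by simp
    qed
    define V' where "V' = {v \<in> V. v \<bullet> e = 0}"
    have V': "subspace V'"
      using V(1) by (auto simp: V'_def subspace_def inner_add_left)
    have "V' \<subseteq> V" "e \<notin> V'" using en by (auto simp: V'_def)
    then have "V' \<subset> V" using eV by blast
    then have "dim V' < dim V" using V' V(1) by (intro dim_psubset) (simp add: span_eq_iff[THEN iffD2])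
    moreover have "S v \<in> V'" if "v \<in> V'" for v
      using that V(2) V(3)[OF _ eV, of v] by (simp add: V'_def Se)
    moreover have "S v \<bullet> w = v \<bullet> S w" if "v \<in> V'" "w \<in> V'" for v w
      using that V(3) by (simp add: V'_def)
    ultimately obtain E \<kappa> where E: "pairwise orthogonal E" "\<forall>e\<in>E. norm e = 1" "span E = V'" "\<forall>e\<in>E. S e = \<kappa> e *\<^sub>R e"
      using less.hyps V' by metis
    have EV: "d \<in> V'" if "d \<in> E" for d using that E(3) span_base by blast
    have "e \<notin> E" using EV en by (auto simp: V'_def)
    have 1: "pairwise orthogonal (insert e E)"
      using E(1) EV by (auto simp: pairwise_insert orthogonal_def V'_def inner_commute)
    have 2: "span (insert e E) = V"
    proof
      show "span (insert e E) \<subseteq> V"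
        using eV EV V(1) by (intro span_minimal) (auto simp: V'_def)
      show "V \<subseteq> span (insert e E)"
      proof
        fix v assume v: "v \<in> V"
        have "v - (v \<bullet> e) *\<^sub>R e \<in> V'"
          using v eV en by (auto simp: V'_def inner_diff_left intro!: subspace_diff[OF V(1)] subspace_scale[OF V(1)])
        then have "v - (v \<bullet> e) *\<^sub>R e \<in> span (insert e E)" using E(3) span_mono[of E "insert e E"] by blast
        moreover have "(v \<bullet> e) *\<^sub>R e \<in> span (insert e E)" by (intro span_scale span_base) simp
        ultimately have "(v - (v \<bullet> e) *\<^sub>R e) + (v \<bullet> e) *\<^sub>R e \<in> span (insert e E)" by (rule span_add)
        then show "v \<in> span (insert e E)" by simp
      qed
    qed
    have 3: "\<forall>d\<in>insert e E. S d = (\<kappa>(e := l)) d *\<^sub>R d" using E(4) Se \<open>e \<notin> E\<close> by auto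
    show ?thesis using 1 2 3 E(2) en(1) by (intro exI[of _ "insert e E"] exI[of _ "\<kappa>(e := l)"]) auto
  qed
qed

lemma trace_orthonormal:
  fixes G :: "'a::euclidean_space \<Rightarrow> 'a"
  assumes lin: "linear G" and B: "pairwise orthogonal B" "\<And>b. b \<in> B \<Longrightarrow> norm b = 1" "span B = UNIV" "finite B"
  shows "(\<Sum>b\<in>B. G b \<bullet> b) = (\<Sum>i\<in>Basis. G i \<bullet> i)"
proof -
  have ex: "x = (\<Sum>b\<in>B. (b \<bullet> x) *\<^sub>R b)" for x
    using orthonormal_basis_expand[of B x] B by (simp add: inner_commute)
  have p: "x \<bullet> y = (\<Sum>b\<in>B. (b \<bullet> x) * (b \<bullet> y))" for x y
  proof -
    have "x \<bullet> y = (\<Sum>b\<in>B. (b \<bullet> x) *\<^sub>R b) \<bullet> y" using ex[of x] by simp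
    then show ?thesis by (simp add: inner_sum_left)
  qed
  have "G b \<bullet> b = (\<Sum>i\<in>Basis. (b \<bullet> i) * (b \<bullet> G i))" for b
  proof -
    have "G b = G (\<Sum>i\<in>Basis. (b \<bullet> i) *\<^sub>R i)" by (simp add: euclidean_representation)
    also have "\<dots> = (\<Sum>i\<in>Basis. (b \<bullet> i) *\<^sub>R G i)" by (simp add: linear_sum[OF lin] linear_scale[OF lin])
    finally have "G b \<bullet> b = (\<Sum>i\<in>Basis. (b \<bullet> i) *\<^sub>R G i) \<bullet> b" by simp
    then show ?thesis by (simp add: inner_sum_right inner_commute[of _ b])
  qed
  then have "(\<Sum>b\<in>B. G b \<bullet> b) = (\<Sum>i\<in>Basis. \<Sum>b\<in>B. (b \<bullet> i) * (b \<bullet> G i))"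
    by (simp only: sum.swap[of _ Basis B])
  also have "\<dots> = (\<Sum>i\<in>Basis. G i \<bullet> i)" by (intro sum.cong refl, subst p[symmetric], rule inner_commute)
  finally show ?thesis .
qed

text \<open>\<open>G\<close> stands for the Hessian of \<open>u\<close>. Any principal frame
  together with the unit normal is an orthonormal basis, so zero trace turns the sum of the
  tangential entries into minus the normal one. All frames thus give the same sum, and the
  description in \<open>mean_curvature\<close> is unique.\<close>

lemma mean_curvature_eq:
  fixes u :: "'a::euclidean_space \<Rightarrow> real"
  assumes g: "g = grad M u x" "g \<noteq> 0" and lin: "linear G" and sym: "\<And>v w. G v \<bullet> w = v \<bullet> G w"
    and tr: "(\<Sum>i\<in>Basis. G i \<bullet> i) = 0"
    and S: "\<And>v. shape_operator M u x v = (- 1 / norm g) *\<^sub>R (G v - (g \<bullet> G v / (norm g)\<^sup>2) *\<^sub>R g)"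
  shows "mean_curvature M u x = (g \<bullet> G g) / norm g ^ 3"
proof -
  let ?N = "unit_normal M u x" and ?S = "shape_operator M u x"
  have N: "?N = - (g /\<^sub>R norm g)" using g by (simp add: unit_normal_def)
  have N1: "norm ?N = 1" using g(2) by (simp add: N)
  define V where "V = {v. v \<bullet> ?N = 0}"
  have Vg: "v \<in> V \<longleftrightarrow> v \<bullet> g = 0" for v using g(2) by (simp add: V_def N)
  have sV: "subspace V" unfolding subspace_def by (auto simp: Vg inner_add_left)
  have ng: "(norm g)\<^sup>2 = g \<bullet> g" by (simp add: power2_norm_eq_inner)
  have Slin: "linear ?S"
  proof (rule linearI)
    show "?S (v + w) = ?S v + ?S w" for v w
      unfolding S linear_add[OF lin] inner_add_right add_divide_distrib scaleR_add_left by (simp add: algebra_simps)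
    show "?S (c *\<^sub>R v) = c *\<^sub>R ?S v" for c v
      unfolding S linear_scale[OF lin] by (simp add: algebra_simps)
  qed
  have SV: "?S v \<in> V" for v
    unfolding Vg S using g(2) by (simp add: inner_diff_left ng inner_commute[of "G v" g])
  have Ssym: "?S v \<bullet> w = v \<bullet> ?S w" if "v \<in> V" "w \<in> V" for v w
    using that sym[of v w] unfolding Vg S by (simp add: inner_diff_left inner_diff_right inner_commute[of g w])
  obtain E \<kappa> where E: "pairwise orthogonal E" "\<forall>e\<in>E. norm e = 1" "span E = V" "\<forall>e\<in>E. ?S e = \<kappa> e *\<^sub>R e"
    using symmetric_orthonormal_eigenbasis[OF Slin sV SV Ssym] by metis
  have frame: "principal_frame M u x E \<kappa>" using E unfolding principal_frame_def V_def by blast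
  have val: "(\<Sum>e\<in>E. \<kappa> e) = (g \<bullet> G g) / norm g ^ 3" if fr: "principal_frame M u x E \<kappa>" for E \<kappa>
  proof -
    have E: "pairwise orthogonal E" "\<And>e. e \<in> E \<Longrightarrow> norm e = 1" "span E = V" "\<And>e. e \<in> E \<Longrightarrow> ?S e = \<kappa> e *\<^sub>R e"
      using fr unfolding principal_frame_def V_def by auto
    have EV: "e \<in> V" if "e \<in> E" for e using that E(3) span_base by blast
    have "0 \<notin> E" using E(2) by force
    then have fin: "finite E" using pairwise_orthogonal_independent[OF E(1)] independent_imp_finite by blast
    have NE: "?N \<notin> E" using EV[of ?N] N1 by (auto simp: V_def norm_eq_1)
    have \<kappa>: "\<kappa> e = - (G e \<bullet> e) / norm g" if "e \<in> E" for e
    proof -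
      have "\<kappa> e = ?S e \<bullet> e" using E(2,4)[OF that] by (simp add: norm_eq_1)
      then show ?thesis using EV[OF that] unfolding S Vg by (simp add: inner_diff_left inner_commute[of g e])
    qed
    have "(\<Sum>b\<in>insert ?N E. G b \<bullet> b) = (\<Sum>i\<in>Basis. G i \<bullet> i)"
    proof (rule trace_orthonormal[OF lin])
      show "pairwise orthogonal (insert ?N E)"
        using E(1) EV by (auto simp: pairwise_insert orthogonal_def V_def inner_commute)
      show "span (insert ?N E) = UNIV"
      proof -
        have "v \<in> span (insert ?N E)" for v
        proof -
          have "v - (v \<bullet> ?N) *\<^sub>R ?N \<in> V" using N1 by (simp add: V_def inner_diff_left norm_eq_1)
          then have "v - (v \<bullet> ?N) *\<^sub>R ?N \<in> span (insert ?N E)" using E(3) span_mono[of E "insert ?N E"] by blast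
          moreover have "(v \<bullet> ?N) *\<^sub>R ?N \<in> span (insert ?N E)" by (intro span_scale span_base) simp
          ultimately have "(v - (v \<bullet> ?N) *\<^sub>R ?N) + (v \<bullet> ?N) *\<^sub>R ?N \<in> span (insert ?N E)" by (rule span_add)
          then show ?thesis by simp
        qed
        then show ?thesis by blast
      qed
    qed (use E(2) N1 fin in auto)
    then have "(\<Sum>e\<in>E. G e \<bullet> e) = - (G ?N \<bullet> ?N)" using tr fin NE by simp
    also have "G ?N \<bullet> ?N = (g \<bullet> G g) / (norm g)\<^sup>2"
      unfolding N by (simp add: linear_neg[OF lin] linear_scale[OF lin] inner_commute power2_eq_square divide_inverse)
    finally have "(\<Sum>e\<in>E. G e \<bullet> e) = - ((g \<bullet> G g) / (norm g)\<^sup>2)" .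
    moreover have "(\<Sum>e\<in>E. \<kappa> e) = - (\<Sum>e\<in>E. G e \<bullet> e) / norm g"
      using \<kappa> by (simp add: sum_negf sum_divide_distrib[symmetric])
    ultimately show ?thesis by (simp add: power2_eq_square power3_eq_cube)
  qed
  show ?thesis unfolding mean_curvature_def
  proof (rule the_equality)
    show "\<exists>E \<kappa>. principal_frame M u x E \<kappa> \<and> (g \<bullet> G g) / norm g ^ 3 = (\<Sum>e\<in>E. \<kappa> e)"
      using frame val[OF frame] by metis
  qed (use val in metis)
qed

section \<open>One-sided derivatives at points accessible from a ball\<close>

text \<open>The half space of these directions \<open>v\<close> replaces a full neighbourhood of
  \<open>p\<close> when \<open>p\<close> lies on the boundary of \<open>M\<close>.\<close>

lemma ball_accessible:
  fixes p y v :: "'a::euclidean_space"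
  assumes r: "dist y p = r" and v: "v \<bullet> (y - p) > 0"
  shows "\<exists>s>0. \<forall>t. 0 < t \<and> t < s \<longrightarrow> p + t *\<^sub>R v \<in> ball y r"
proof -
  have v0: "v \<noteq> 0" using v by auto
  define s where "s = 2 * (v \<bullet> (y - p)) / (v \<bullet> v)"
  have s: "s > 0" using v v0 by (simp add: s_def)
  have "p + t *\<^sub>R v \<in> ball y r" if t: "0 < t" "t < s" for t
  proof -
    have "t * (v \<bullet> v) < 2 * (v \<bullet> (y - p))" using t v0 by (simp add: s_def pos_less_divide_eq)
    then have "t * (t * (v \<bullet> v)) < t * (2 * (v \<bullet> (y - p)))" using t by simp
    moreover have "(norm (y - (p + t *\<^sub>R v)))\<^sup>2 = (norm (y - p))\<^sup>2 + t * (t * (v \<bullet> v)) - t * (2 * (v \<bullet> (y - p)))"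
    proof -
      have "y - (p + t *\<^sub>R v) = (y - p) - t *\<^sub>R v" by simp
      then show ?thesis unfolding power2_norm_eq_inner
        by (simp add: inner_diff_left inner_diff_right inner_commute algebra_simps)
    qed
    ultimately have "(norm (y - (p + t *\<^sub>R v)))\<^sup>2 < r\<^sup>2" using r by (simp add: dist_norm)
    moreover have "r \<ge> 0" using r by auto
    ultimately have "norm (y - (p + t *\<^sub>R v)) < r" by (rule power2_less_imp_less)
    then show ?thesis by (simp add: dist_norm)
  qed
  then show ?thesis using s by blast
qed

text \<open>Identifies the derivative chosen by \<open>shape_operator\<close> with a computed one
  although \<open>p\<close> need not be interior to \<open>M\<close>. Derivatives are determined
  along directions entering the ball, and these span the space.\<close>

lemma has_derivative_unique_ball:
  fixes f :: "'a::euclidean_space \<Rightarrow> 'b::real_normed_vector"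
  assumes D: "(f has_derivative D) (at p within M)" "(f has_derivative D') (at p within M)"
    and r: "r > 0" "dist y p = r" "ball y r \<subseteq> M"
  shows "D = D'"
proof -
  have lin: "linear D" "linear D'" using D has_derivative_linear by auto
  have eq: "D v = D' v" if v: "v \<bullet> (y - p) > 0" for v
  proof -
    obtain s where s: "s > 0" "\<And>t. 0 < t \<Longrightarrow> t < s \<Longrightarrow> p + t *\<^sub>R v \<in> ball y r"
      using ball_accessible[OF r(2) v] by blast
    let ?T = "{0<..<s}"
    have im: "(\<lambda>t. p + t *\<^sub>R v) ` ?T \<subseteq> M" using s(2) r(3) by force
    have vd: "((\<lambda>t. f (p + t *\<^sub>R v)) has_vector_derivative L v) (at 0 within ?T)"
      if L: "(f has_derivative L) (at p within M)" "linear L" for L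
    proof -
      have "((\<lambda>t. p + t *\<^sub>R v) has_derivative (\<lambda>t. t *\<^sub>R v)) (at 0 within ?T)"
        by (auto intro!: derivative_eq_intros)
      moreover have "(f has_derivative L) (at (p + 0 *\<^sub>R v) within (\<lambda>t. p + t *\<^sub>R v) ` ?T)"
        using has_derivative_subset[OF L(1) im] by simp
      ultimately have "((\<lambda>t. f (p + t *\<^sub>R v)) has_derivative (\<lambda>t. L (t *\<^sub>R v))) (at 0 within ?T)"
        using has_derivative_in_compose[of "\<lambda>t. p + t *\<^sub>R v" _ 0 ?T f L] by simp
      then show ?thesis by (simp add: has_vector_derivative_def linear_scale[OF L(2)])
    qed
    have "at 0 within ?T \<noteq> bot" using s(1) by (simp add: at_within_eq_bot_iff)
    then show ?thesis using vector_derivative_unique_within[OF _ vd[OF D(1) lin(1)] vd[OF D(2) lin(2)]] by blast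
  qed
  have yp: "(y - p) \<bullet> (y - p) > 0" using r by (auto simp: inner_gt_zero_iff)
  have "D v = D' v" for v
  proof -
    \<comment> \<open>Writes \<open>v\<close> as the difference of two directions that both enter
      the ball.\<close>
    define k where "k = (\<bar>v \<bullet> (y - p)\<bar> + 1) / ((y - p) \<bullet> (y - p))"
    have "(v + k *\<^sub>R (y - p)) \<bullet> (y - p) = v \<bullet> (y - p) + (\<bar>v \<bullet> (y - p)\<bar> + 1)"
      using yp by (simp add: inner_add_left k_def)
    then have "(v + k *\<^sub>R (y - p)) \<bullet> (y - p) > 0" by linarith
    from eq[OF this] eq[OF yp] show ?thesis
      by (simp add: linear_add lin linear_scale)
  qed
  then show ?thesis by blast
qed

text \<open>The derivative is nonnegative on the open half space of directions entering the ball, so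
  it is a nonnegative multiple of the inner normal; a nonzero gradient makes the multiple
  positive.\<close>

lemma gradient_along_inner_normal:
  fixes u :: "'a::euclidean_space \<Rightarrow> real"
  assumes d: "(u has_derivative (\<lambda>v. g \<bullet> v)) (at p within M)" and g: "g \<noteq> 0"
    and r: "dist y p = r" "ball y r \<subseteq> M" "r > 0" and le: "\<And>x. x \<in> ball y r \<Longrightarrow> u x \<ge> u p"
  shows "\<exists>c>0. g = c *\<^sub>R (y - p)"
proof -
  let ?\<nu> = "y - p"
  have nn: "?\<nu> \<bullet> ?\<nu> > 0" using r by (auto simp: inner_gt_zero_iff)
  have ge: "g \<bullet> v \<ge> 0" if v: "v \<bullet> ?\<nu> > 0" for v
  proof -
    obtain s where s: "s > 0" "\<And>t. 0 < t \<Longrightarrow> t < s \<Longrightarrow> p + t *\<^sub>R v \<in> ball y r"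
      using ball_accessible[OF r(1) v] by blast
    have "((\<lambda>x. - u x) has_derivative (\<lambda>v. - (g \<bullet> v))) (at p within M)" by (rule has_derivative_minus[OF d])
    from one_sided_derivative_le[OF this s(1), of v 0]
    have "- (g \<bullet> v) \<le> - 0" using s(2) le r(2) by force
    then show ?thesis by simp
  qed
  define c where "c = (g \<bullet> ?\<nu>) / (?\<nu> \<bullet> ?\<nu>)"
  define w where "w = g - c *\<^sub>R ?\<nu>"
  have w\<nu>: "w \<bullet> ?\<nu> = 0" using nn by (simp add: w_def c_def inner_diff_left)
  have gw: "g \<bullet> w = w \<bullet> w" using w\<nu> by (simp add: w_def inner_diff_left inner_commute)
  have g\<nu>: "g \<bullet> ?\<nu> \<ge> 0" by (rule ge[OF nn])
  have "w \<bullet> w \<le> e" if e: "e > 0" for e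
  proof -
    \<comment> \<open>The direction \<open>k *\<^sub>R ?\<nu> - w\<close> enters the ball for every
      positive \<open>k\<close>, and small \<open>k\<close> bounds the tangential part
      \<open>w\<close> of the gradient.\<close>
    define k where "k = e / (g \<bullet> ?\<nu> + 1)"
    have k: "k > 0" using e g\<nu> by (simp add: k_def)
    have "(k *\<^sub>R ?\<nu> - w) \<bullet> ?\<nu> > 0" using k nn w\<nu> by (simp add: inner_diff_left)
    from ge[OF this] have "w \<bullet> w \<le> k * (g \<bullet> ?\<nu>)" using gw by (simp add: inner_diff_right)
    also have "\<dots> \<le> k * (g \<bullet> ?\<nu> + 1)" using k by (intro mult_left_mono) auto
    also have "\<dots> = e" using g\<nu> by (simp add: k_def)
    finally show ?thesis .
  qed
  then have "w \<bullet> w \<le> 0" by (meson dense_ge)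
  then have "w \<bullet> w = 0" using inner_ge_zero by (rule order_antisym)
  then have "w = 0" by simp
  then have gc: "g = c *\<^sub>R ?\<nu>" by (simp add: w_def)
  have "c \<ge> 0" using g\<nu> nn by (simp add: c_def)
  moreover have "c \<noteq> 0" using gc g by auto
  ultimately show ?thesis using gc by (intro exI[of _ c]) auto
qed

lemma continuous_on_eq_0_closure:
  fixes h :: "'a::metric_space \<Rightarrow> real"
  assumes "continuous_on M h" "W \<subseteq> M" "\<And>x. x \<in> W \<Longrightarrow> h x = 0" "p \<in> M" "p \<in> closure W"
  shows "h p = 0"
proof -
  have "closedin (top_of_set M) {x \<in> M. h x = 0}"
    using continuous_closedin_preimage_constant[OF assms(1), of 0] .
  then obtain T where T: "closed T" "{x \<in> M. h x = 0} = M \<inter> T" unfolding closedin_closed by blast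
  have "W \<subseteq> T" using assms(2,3) T(2) by blast
  then have "closure W \<subseteq> T" by (rule closure_minimal[OF _ T(1)])
  then show ?thesis using assms(4,5) T(2) by blast
qed

text \<open>Symmetry of the Hessian and its zero trace hold on \<open>W\<close> and carry over to
  \<open>p\<close> by continuity of the second derivatives within \<open>M\<close>, since the ball
  puts \<open>p\<close> into the closure of \<open>W\<close>.\<close>

lemma mean_curvature_within:
  fixes u :: "'a::euclidean_space \<Rightarrow> real"
  assumes u2: "Ck_on 2 M u" and W: "open W" "W \<subseteq> M" "harmonic_on W u"
    and p: "p \<in> M" and r: "r > 0" "dist y p = r" "ball y r \<subseteq> W" and g: "grad M u p \<noteq> 0"
  shows "\<exists>G. linear G \<and> (grad M u has_derivative G) (at p within M) \<and>
     mean_curvature M u p = (grad M u p \<bullet> G (grad M u p)) / norm (grad M u p) ^ 3 \<and> (\<forall>v w. G v \<bullet> w = v \<bullet> G w)"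
proof -
  let ?g = "grad M u"
  have C2: "u differentiable_on M" "\<And>i. i \<in> Basis \<Longrightarrow> pd M i u differentiable_on M"
    "\<And>i j. i \<in> Basis \<Longrightarrow> j \<in> Basis \<Longrightarrow> continuous_on M (pd M j (pd M i u))"
    using u2 by (auto simp: numeral_2_eq_2)
  define G where "G v = (\<Sum>i\<in>Basis. (grad M (pd M i u) p \<bullet> v) *\<^sub>R i)" for v
  have dG: "(?g has_derivative G) (at p within M)"
    unfolding grad_def[of M u, abs_def] G_def[abs_def]
    by (intro has_derivative_sum has_derivative_scaleR_left has_derivative_grad)
      (use C2(2) p in \<open>auto simp: differentiable_on_def\<close>)
  have lin: "linear G" using dG has_derivative_linear by blast
  have "p \<in> cball y r" using r(2) by simp
  then have pW: "p \<in> closure W" using closure_ball[OF r(1), of y] closure_mono[OF r(3)] by blast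
  have pd2: "pd M j (pd M i u) x = pd UNIV j (pd UNIV i u) x" if "x \<in> W" for i j x
  proof -
    have "pd M j (pd M i u) x = pd UNIV j (pd M i u) x" by (rule pd_open[OF W(1) that W(2)])
    also have "\<dots> = pd UNIV j (pd UNIV i u) x"
      by (rule pd_cong_open[OF W(1) _ that]) (rule pd_open[OF W(1) _ W(2)])
    finally show ?thesis .
  qed
  have H: "G j \<bullet> i = pd M j (pd M i u) p" if "i \<in> Basis" "j \<in> Basis" for i j
    using that by (simp add: G_def grad_inner_Basis)
  have symB: "pd M j (pd M i u) p = pd M i (pd M j u) p" if ij: "i \<in> Basis" "j \<in> Basis" for i j
  proof -
    have "pd M j (pd M i u) p - pd M i (pd M j u) p = 0"
    proof (rule continuous_on_eq_0_closure[OF _ W(2) _ p pW])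
      show "continuous_on M (\<lambda>x. pd M j (pd M i u) x - pd M i (pd M j u) x)"
        by (intro continuous_on_diff C2 ij)
      show "pd M j (pd M i u) x - pd M i (pd M j u) x = 0" if "x \<in> W" for x
        using pd_commute[OF W(1) _ ij that, of u] W(3) unfolding pd2[OF that] harmonic_on_def by simp
    qed
    then show ?thesis by simp
  qed
  have sym: "G v \<bullet> w = v \<bullet> G w" for v w
  proof -
    have e: "G v \<bullet> w = (\<Sum>j\<in>Basis. \<Sum>i\<in>Basis. (v \<bullet> j) * (w \<bullet> i) * pd M j (pd M i u) p)" for v w
    proof -
      have "G v = (\<Sum>j\<in>Basis. (v \<bullet> j) *\<^sub>R G j)"
        by (subst euclidean_representation[of v, symmetric]) (simp add: linear_sum[OF lin] linear_scale[OF lin])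
      then have "G v \<bullet> w = (\<Sum>j\<in>Basis. (v \<bullet> j) * (G j \<bullet> w))" by (simp add: inner_sum_left)
      also have "\<dots> = (\<Sum>j\<in>Basis. (v \<bullet> j) * (\<Sum>i\<in>Basis. (G j \<bullet> i) * (w \<bullet> i)))"
        by (intro sum.cong refl arg_cong2[where f=times] euclidean_inner)
      also have "\<dots> = (\<Sum>j\<in>Basis. \<Sum>i\<in>Basis. (v \<bullet> j) * (w \<bullet> i) * pd M j (pd M i u) p)"
        unfolding sum_distrib_left by (intro sum.cong refl) (simp add: H)
      finally show ?thesis .
    qed
    have "G v \<bullet> w = (\<Sum>i\<in>Basis. \<Sum>j\<in>Basis. (v \<bullet> j) * (w \<bullet> i) * pd M j (pd M i u) p)"
      unfolding e by (rule sum.swap)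
    also have "\<dots> = G w \<bullet> v"
      unfolding e by (intro sum.cong refl) (simp add: symB)
    finally show ?thesis by (simp add: inner_commute)
  qed
  have tr: "(\<Sum>i\<in>Basis. G i \<bullet> i) = 0"
  proof -
    have "(\<Sum>i\<in>Basis. pd M i (pd M i u) p) = 0"
    proof (rule continuous_on_eq_0_closure[OF _ W(2) _ p pW])
      show "continuous_on M (\<lambda>x. \<Sum>i\<in>Basis. pd M i (pd M i u) x)"
        by (intro continuous_on_sum C2)
      show "(\<Sum>i\<in>Basis. pd M i (pd M i u) x) = 0" if "x \<in> W" for x
        using W(3) that unfolding pd2[OF that] harmonic_on_def laplacian_def by simp
    qed
    then show ?thesis by (simp add: H)
  qed
  have S: "shape_operator M u p v = (- 1 / norm (?g p)) *\<^sub>R (G v - (?g p \<bullet> G v / (norm (?g p))\<^sup>2) *\<^sub>R ?g p)" for v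
  proof -
    let ?S = "\<lambda>v. (- 1 / norm (?g p)) *\<^sub>R (G v - (?g p \<bullet> G v / (norm (?g p))\<^sup>2) *\<^sub>R ?g p)"
    have dn: "((\<lambda>x. norm (?g x)) has_derivative (\<lambda>v. (?g p /\<^sub>R norm (?g p)) \<bullet> G v)) (at p within M)"
    proof -
      have "(norm has_derivative (\<lambda>w. w \<bullet> sgn (?g p))) (at (?g p))" by (rule has_derivative_norm[OF g])
      from has_derivative_compose[OF dG this] show ?thesis by (simp add: sgn_div_norm inner_commute)
    qed
    have ng: "norm (?g p) \<noteq> 0" using g by simp
    have di: "((\<lambda>x. inverse (norm (?g x))) has_derivative
        (\<lambda>v. - (inverse (norm (?g p)) * ((?g p /\<^sub>R norm (?g p)) \<bullet> G v) * inverse (norm (?g p))))) (at p within M)"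
      by (rule Deriv.has_derivative_inverse[OF ng dn])
    from has_derivative_minus[OF has_derivative_scaleR[OF di dG]]
    have "(unit_normal M u has_derivative (\<lambda>v. - (inverse (norm (?g p)) *\<^sub>R G v +
        (- (inverse (norm (?g p)) * ((?g p /\<^sub>R norm (?g p)) \<bullet> G v) * inverse (norm (?g p)))) *\<^sub>R ?g p))) (at p within M)"
      unfolding unit_normal_def[abs_def] .
    moreover have "(\<lambda>v. - (inverse (norm (?g p)) *\<^sub>R G v +
        (- (inverse (norm (?g p)) * ((?g p /\<^sub>R norm (?g p)) \<bullet> G v) * inverse (norm (?g p)))) *\<^sub>R ?g p)) = ?S"
      by (rule ext) (simp add: scaleR_diff_right divide_inverse power2_eq_square ac_simps)
    ultimately have dU: "(unit_normal M u has_derivative ?S) (at p within M)" by simp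
    then have "(unit_normal M u has_derivative shape_operator M u p) (at p within M)"
      unfolding shape_operator_def using frechet_derivative_works differentiable_def by blast
    from has_derivative_unique_ball[OF this dU r(1,2)] show ?thesis using r(3) W(2) by (metis subset_trans)
  qed
  have "mean_curvature M u p = (?g p \<bullet> G (?g p)) / norm (?g p) ^ 3"
    by (rule mean_curvature_eq[OF refl g lin sym tr S])
  then show ?thesis using lin dG sym by blast
qed

section \<open>The P-function up to the boundary of \<open>M\<close>\<close>

lemma continuous_on_grad_within:
  assumes "Ck_on 2 M u"
  shows "continuous_on M (grad M u)"
proof -
  have "continuous_on M (pd M i u)" if "i \<in> Basis" for i
    using assms that by (auto simp: numeral_2_eq_2 intro: differentiable_imp_continuous_on)
  then show ?thesis unfolding grad_def[abs_def] by (intro continuous_on_sum continuous_on_scaleR continuous_on_const)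
qed

lemma continuous_on_pfun:
  assumes "Ck_on 2 M u" "\<And>x. x \<in> M \<Longrightarrow> u x > 0"
  shows "continuous_on M (pfun M u)"
proof -
  have "u x \<noteq> 0" if "x \<in> M" for x using assms(2)[OF that] by simp
  then show ?thesis unfolding pfun_def[abs_def]
    using Ck_on_imp_continuous_on[OF assms(1)] continuous_on_grad_within[OF assms(1)]
    by (intro continuous_intros) auto
qed

lemma pfun_has_lap:
  fixes u :: "'a::euclidean_space \<Rightarrow> real"
  assumes W: "open W" "W \<subseteq> M" "harmonic_on W u" and pos: "\<And>x. x \<in> M \<Longrightarrow> u x > 0"
    and x: "x \<in> W" and dim: "DIM('a) \<ge> 3"
  shows "\<exists>g l. has_lap (pfun M u) x g l \<and> l + ((2 / u x) *\<^sub>R grad M u x) \<bullet> g \<ge> 0"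
proof -
  have posW: "u x > 0" if "x \<in> W" for x using that W(2) pos by blast
  obtain g l where gl: "has_lap (pfun UNIV u) x g l" "l + ((2 / u x) *\<^sub>R grad UNIV u x) \<bullet> g =
     2 * u x powr (- (2 * (real DIM('a) - 1) / (real DIM('a) - 2))) * (\<Sum>i\<in>Basis. (norm (ptensor u x i))\<^sup>2)"
    using pfun_subsolution[OF W(1,3) posW x dim] by blast
  have "\<forall>\<^sub>F y in nhds x. pfun UNIV u y = pfun M u y"
    using eventually_nhds_in_open[OF W(1) x] by eventually_elim (rule pfun_open[OF W(1) _ W(2), symmetric])
  then have "has_lap (pfun M u) x g l" by (rule has_lap_cong[OF gl(1)])
  moreover have "l + ((2 / u x) *\<^sub>R grad M u x) \<bullet> g \<ge> 0"
    unfolding grad_open[OF W(1) x W(2)] gl(2) by (simp add: sum_nonneg)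
  ultimately show ?thesis by blast
qed

text \<open>
  \<open>\<sigma> = 1\<close> is the case of the lower level set, \<open>\<sigma> = - 1\<close> that of the upper one. The curvature condition makes the
  derivative of the P-function along the inner normal nonnegative, against Hopf's lemma.
\<close>

lemma pfun_max_on_level_set:
  fixes u :: "'a::euclidean_space \<Rightarrow> real"
  assumes u2: "Ck_on 2 M u" and W: "open W" "W \<subseteq> M" "harmonic_on W u" and pos: "\<And>x. x \<in> M \<Longrightarrow> u x > 0"
    and p: "p \<in> M" and r: "r > 0" "dist y p = r" "ball y r \<subseteq> W" and g: "grad M u p \<noteq> 0"
    and \<sigma>: "\<sigma> \<in> {1, -1}" "\<And>x. x \<in> ball y r \<Longrightarrow> \<sigma> * u x \<ge> \<sigma> * u p"
    and curv: "\<sigma> * (mean_curvature M u p / (real DIM('a) - 1)) \<ge> \<sigma> * (norm (grad M u p) / ((real DIM('a) - 2) * u p))"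
    and max: "\<And>x. x \<in> ball y r \<Longrightarrow> pfun M u x \<le> pfun M u p" and dim: "DIM('a) \<ge> 3"
  shows "\<exists>x\<in>ball y r. pfun M u x = pfun M u p"
proof (rule ccontr)
  assume neg: "\<not> ?thesis"
  have less: "pfun M u x < pfun M u p" if "x \<in> ball y r" for x
    using max[OF that] neg that unfolding less_le by blast
  \<comment> \<open>The closed ball of half the radius touches the sphere of \<open>ball y r\<close>
    only at \<open>p\<close>, so it lies in \<open>M\<close>. This gives continuity of P and a bound
    on the drift up to its boundary, as Hopf's lemma demands.\<close>
  define y' where "y' = p + (1 / 2) *\<^sub>R (y - p)"
  define r' where "r' = r / 2"
  have r': "r' > 0" using r by (simp add: r'_def)
  have y'p: "y' - p = (1 / 2) *\<^sub>R (y - p)" by (simp add: y'_def)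
  have d': "dist y' p = r'" using r by (simp add: dist_norm y'p r'_def)
  have yy': "dist y y' = r'"
  proof -
    have "y - y' = (1 / 2) *\<^sub>R (y - p)" by (simp add: y'_def algebra_simps) (simp add: scaleR_left_distrib[symmetric] flip: scaleR_add_left)
    then show ?thesis using r by (simp add: dist_norm r'_def)
  qed
  have b': "ball y' r' \<subseteq> ball y r"
  proof
    fix x assume "x \<in> ball y' r'"
    then show "x \<in> ball y r" using dist_triangle[of y x y'] yy' by (simp add: r'_def)
  qed
  have c': "cball y' r' \<subseteq> M"
  proof -
    have "x \<in> M" if x: "x \<in> cball y' r'" for x
    proof (cases "x \<in> ball y r")
      case True
      then show ?thesis using r(3) W(2) by blast
    next
      case False
      have n1: "norm (x - y') \<le> r'" using x by (simp add: dist_norm norm_minus_commute)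
      have n2: "norm (x - y) \<ge> r" using False by (simp add: dist_norm norm_minus_commute)
      have yh: "norm (y - y') = r'" using yy' by (simp add: dist_norm)
      \<comment> \<open>parallelogram law: \<open>x - p = (x - y') + (y - y')\<close> while \<open>x - y = (x - y') - (y - y')\<close>\<close>
      have xp: "x - p = (x - y') + (y - y')" by (simp add: y'_def algebra_simps) (simp flip: scaleR_add_left)
      have "(norm (x - p))\<^sup>2 + (norm (x - y))\<^sup>2 = 2 * (norm (x - y'))\<^sup>2 + 2 * (norm (y - y'))\<^sup>2"
      proof -
        have xy: "x - y = (x - y') - (y - y')" by simp
        show ?thesis unfolding xp xy power2_norm_eq_inner
          by (simp add: inner_add_left inner_add_right inner_diff_left inner_diff_right inner_commute)
      qed
      moreover have "(norm (x - y'))\<^sup>2 \<le> r'\<^sup>2" "r\<^sup>2 \<le> (norm (x - y))\<^sup>2"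
        using n1 n2 r(1) by (auto intro: power_mono)
      moreover have "r\<^sup>2 = 4 * r'\<^sup>2" by (simp add: r'_def power2_eq_square)
      ultimately have "(norm (x - p))\<^sup>2 \<le> 0" unfolding yh by linarith
      then show ?thesis using p by simp
    qed
    then show ?thesis by blast
  qed
  let ?b = "\<lambda>x. (2 / u x) *\<^sub>R grad M u x"
  have "u x \<noteq> 0" if "x \<in> M" for x using pos[OF that] by simp
  then have "continuous_on M ?b"
    using Ck_on_imp_continuous_on[OF u2] continuous_on_grad_within[OF u2]
    by (intro continuous_intros) auto
  then have "continuous_on (cball y' r') ?b" by (rule continuous_on_subset[OF _ c'])
  then have "compact (?b ` cball y' r')" by (rule compact_continuous_image[OF _ compact_cball])
  then have "bounded (?b ` cball y' r')" by (rule compact_imp_bounded)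
  then obtain \<beta> where "\<forall>z\<in>?b ` cball y' r'. norm z \<le> \<beta>" unfolding bounded_iff by (rule exE)
  note \<beta> = this[rule_format]
  have sub': "x \<in> ball y r" "x \<in> W" "x \<in> cball y' r'" if "x \<in> ball y' r'" for x
  proof -
    show 1: "x \<in> ball y r" using that b' by (rule subsetD[rotated])
    show "x \<in> W" using 1 r(3) by (rule subsetD[rotated])
    show "x \<in> cball y' r'" using that by (rule subsetD[OF ball_subset_cball])
  qed
  have "\<exists>k>0. \<forall>t. 0 < t \<and> t < 1 / 2 \<longrightarrow> pfun M u (p + t *\<^sub>R (y' - p)) \<le> pfun M u p - k * t"
  proof (rule hopf_lemma[where f="pfun M u" and b="?b" and \<beta>=\<beta> and p=p and y=y' and r=r' and m="pfun M u p"])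
    show "r' > 0" "dist y' p = r'" "pfun M u p = pfun M u p" by (fact r' d' refl)+
    show "continuous_on (cball y' r') (pfun M u)"
      by (rule continuous_on_subset[OF continuous_on_pfun[OF u2 pos] c'])
    show "pfun M u x < pfun M u p" if "x \<in> ball y' r'" for x by (rule less[OF sub'(1)[OF that]])
    show "\<exists>g l. has_lap (pfun M u) x g l \<and> l + ?b x \<bullet> g \<ge> 0" if "x \<in> ball y' r'" for x
      by (rule pfun_has_lap[OF W pos sub'(2)[OF that] dim])
    show "norm (?b x) \<le> \<beta>" if "x \<in> ball y' r'" for x by (rule \<beta>[OF imageI[OF sub'(3)[OF that]]])
  qed
  then obtain k where k: "k > 0" "\<And>t. 0 < t \<Longrightarrow> t < 1 / 2 \<Longrightarrow> pfun M u (p + t *\<^sub>R (y' - p)) \<le> pfun M u p - k * t"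
    by blast
  obtain G where G: "linear G" "(grad M u has_derivative G) (at p within M)"
    "mean_curvature M u p = (grad M u p \<bullet> G (grad M u p)) / norm (grad M u p) ^ 3" "\<And>v w. G v \<bullet> w = v \<bullet> G w"
    using mean_curvature_within[OF u2 W p r g] by blast
  define n where "n = real DIM('a)"
  have n: "n > 2" using dim by (simp add: n_def)
  define q where "q = 2 * (n - 1) / (n - 2)"
  define a where "a = u p powr (- q)"
  let ?g = "grad M u p"
  have up: "u p > 0" using pos p by blast
  have ap: "a > 0" using up by (simp add: a_def)
  have du: "(u has_derivative (\<lambda>v. ?g \<bullet> v)) (at p within M)"
    using u2 p by (intro has_derivative_grad) (auto simp: numeral_2_eq_2 differentiable_on_def)
  have dpw: "((\<lambda>x. u x powr (- q)) has_derivative (\<lambda>v. - q * u p powr (- q - 1) * (?g \<bullet> v))) (at p within M)"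
    using has_derivative_compose[OF du has_real_derivative_powr[OF up, of "- q", unfolded has_field_derivative_def]] by simp
  have dS: "((\<lambda>x. (norm (grad M u x))\<^sup>2) has_derivative (\<lambda>v. 2 * (?g \<bullet> G v))) (at p within M)"
    unfolding power2_norm_eq_inner using has_derivative_inner[OF G(2) G(2)] by (simp add: inner_commute)
  define D where "D v = (norm ?g)\<^sup>2 * (- q * u p powr (- q - 1) * (?g \<bullet> v)) + 2 * (?g \<bullet> G v) * u p powr (- q)" for v
  have dP: "(pfun M u has_derivative D) (at p within M)"
    unfolding pfun_def[abs_def] D_def[abs_def] n_def[symmetric] q_def[symmetric]
    by (rule has_derivative_mult[OF dS dpw])
  have Dlin: "linear D" using dP has_derivative_linear by blast
  have "D (y' - p) \<le> - k"
  proof (rule one_sided_derivative_le[OF dP, of "1 / 2"])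
    fix t :: real assume t: "0 < t" "t < 1 / 2"
    have "norm (y' - (p + t *\<^sub>R (y' - p))) = (1 - t) * r'"
    proof -
      have "y' - (p + t *\<^sub>R (y' - p)) = (1 - t) *\<^sub>R (y' - p)" by (simp add: algebra_simps)
      then show ?thesis using t d' by (simp add: dist_norm)
    qed
    moreover have "(1 - t) * r' \<le> 1 * r'" using t r' by (intro mult_right_mono) auto
    ultimately have "p + t *\<^sub>R (y' - p) \<in> cball y' r'" by (simp add: dist_norm)
    then show "p + t *\<^sub>R (y' - p) \<in> M \<and> pfun M u (p + t *\<^sub>R (y' - p)) \<le> pfun M u p - k * t"
      using c' k(2) t by blast
  qed simp
  then have "D ((1 / 2) *\<^sub>R (y - p)) < 0" using k(1) unfolding y'p by simp
  then have D\<nu>: "D (y - p) < 0" unfolding linear_scale[OF Dlin] by simp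
  have "((\<lambda>x. \<sigma> * u x) has_derivative (\<lambda>v. (\<sigma> *\<^sub>R ?g) \<bullet> v)) (at p within M)"
    using has_derivative_mult_right[OF du, of \<sigma>] by simp
  moreover have "\<sigma> *\<^sub>R ?g \<noteq> 0" using g \<sigma>(1) by auto
  moreover have "ball y r \<subseteq> M" using r(3) W(2) by blast
  ultimately obtain c where c: "c > 0" "\<sigma> *\<^sub>R ?g = c *\<^sub>R (y - p)"
    using gradient_along_inner_normal[of "\<lambda>x. \<sigma> * u x" "\<sigma> *\<^sub>R ?g" p M y r] r(1,2) \<sigma>(2) by blast
  \<comment> \<open>The inner normal is a positive multiple of \<sigma> Du, so Hopf's strict sign
    passes to the derivative of P along Du.\<close>
  have "\<sigma> * D ?g = c * D (y - p)"
    using linear_scale[OF Dlin, of \<sigma> ?g] linear_scale[OF Dlin, of c "y - p"] c(2) by simp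
  then have neg2: "\<sigma> * D ?g < 0" using c(1) D\<nu> by (simp add: mult_pos_neg)
  define N where "N = norm ?g"
  define Q where "Q = ?g \<bullet> G ?g"
  have N: "N > 0" using g by (simp add: N_def)
  have pw: "u p powr (- q - 1) = a / u p" using up powr_diff[of "u p" "- q" 1] by (simp add: a_def)
  \<comment> \<open>With H = Q / N^3 the right-hand side is 2 a N^3 times H - (n-1) |Du| / ((n-2)
    u), the quantity whose sign the curvature condition prescribes.\<close>
  have DQ: "D ?g = 2 * a * (Q - N ^ 3 * ((n - 1) * (N / ((n - 2) * u p))))"
  proof -
    have gg: "?g \<bullet> ?g = N\<^sup>2" by (simp add: N_def power2_norm_eq_inner)
    have "D ?g = N\<^sup>2 * (- q * (a / u p) * N\<^sup>2) + 2 * Q * a"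
      unfolding D_def pw gg Q_def N_def a_def ..
    also have "\<dots> = 2 * a * (Q - N ^ 3 * ((n - 1) * (N / ((n - 2) * u p))))"
    proof -
      define k where "k = 1 / (n - 2)"
      define w where "w = 1 / u p"
      have e: "q = 2 * (n - 1) * k" "a / u p = a * w" "N / ((n - 2) * u p) = N * k * w"
        by (simp_all add: q_def k_def w_def)
      show ?thesis unfolding e by (simp add: power2_eq_square power3_eq_cube algebra_simps)
    qed
    finally show ?thesis .
  qed
  have "\<sigma> * ((Q / N ^ 3) / (n - 1)) \<ge> \<sigma> * (N / ((n - 2) * u p))"
    using curv unfolding G(3) n_def Q_def N_def .
  then have "(n - 1) * (\<sigma> * (N / ((n - 2) * u p))) \<le> (n - 1) * (\<sigma> * ((Q / N ^ 3) / (n - 1)))"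
    by (rule mult_left_mono) (use n in simp)
  also have "\<dots> = \<sigma> * (Q / N ^ 3)" using n by simp
  finally have "N ^ 3 * ((n - 1) * (\<sigma> * (N / ((n - 2) * u p)))) \<le> N ^ 3 * (\<sigma> * (Q / N ^ 3))"
    by (rule mult_left_mono) (use N in simp)
  also have "\<dots> = \<sigma> * Q" using N by simp
  finally have "0 \<le> \<sigma> * (Q - N ^ 3 * ((n - 1) * (N / ((n - 2) * u p))))"
    by (simp add: right_diff_distrib mult.left_commute)
  then have "0 \<le> 2 * a * (\<sigma> * (Q - N ^ 3 * ((n - 1) * (N / ((n - 2) * u p)))))" by (rule mult_nonneg_nonneg[rotated]) (use ap in simp)
  also have "\<dots> = \<sigma> * D ?g" unfolding DQ by (simp only: ac_simps)
  finally show False using neg2 by simp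
qed

text \<open>The interior ball condition for a regular level set of a C^2 function. A quadratic lower
  Taylor bound holds at \<open>p\<close>, and on a small ball with center in the gradient direction
  the linear term beats the quadratic error.\<close>

lemma inner_tangent_ball:
  fixes \<phi> :: "'a::euclidean_space \<Rightarrow> real"
  assumes V: "open V" "p \<in> V" "Ck_on 2 V \<phi>" and g: "grad UNIV \<phi> p \<noteq> 0"
  shows "\<exists>y r. r > 0 \<and> dist y p = r \<and> ball y r \<subseteq> V \<and> (\<forall>x\<in>ball y r. \<phi> x > \<phi> p)"
proof -
  let ?g = "grad UNIV \<phi>"
  define G where "G v = (\<Sum>i\<in>Basis. (grad UNIV (pd UNIV i \<phi>) p \<bullet> v) *\<^sub>R i)" for v
  have dG: "(?g has_derivative G) (at p)"
    unfolding grad_def[of UNIV \<phi>, abs_def] G_def[abs_def]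
    by (intro has_derivative_sum has_derivative_scaleR_left has_derivative_grad Ck_on_2D(2)[OF V(1,3,2)])
  obtain B where B: "B > 0" "\<And>v. norm (G v) \<le> norm v * B"
    using bounded_linear.pos_bounded[OF has_derivative_bounded_linear[OF dG]] by blast
  obtain d1 where d1: "d1 > 0" "\<And>x. norm (x - p) < d1 \<Longrightarrow> norm (?g x - ?g p - G (x - p)) \<le> 1 * norm (x - p)"
    using dG unfolding has_derivative_at_alt by (metis zero_less_one)
  obtain d2 where d2: "d2 > 0" "ball p d2 \<subseteq> V" using V(1,2) open_contains_ball by blast
  define d where "d = min d1 d2"
  have d: "d > 0" "d \<le> d1" "d \<le> d2" using d1 d2 by (auto simp: d_def)
  \<comment> \<open>\<open>B\<close> bounds the derivative of the gradient at \<open>p\<close>, and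
    1 absorbs the error of the linear approximation near \<open>p\<close>.\<close>
  define C where "C = B + 1"
  have C: "C > 0" using B by (simp add: C_def)
  have lip: "norm (?g x - ?g p) \<le> C * norm (x - p)" if "norm (x - p) < d" for x
  proof -
    have "norm (?g x - ?g p) \<le> norm (?g x - ?g p - G (x - p)) + norm (G (x - p))"
      using norm_triangle_ineq[of "?g x - ?g p - G (x - p)" "G (x - p)"] by simp
    also have "\<dots> \<le> 1 * norm (x - p) + norm (x - p) * B"
      using d1(2)[of x] that d B(2)[of "x - p"] by (intro add_mono) auto
    finally show ?thesis by (simp add: C_def algebra_simps)
  qed
  have taylor: "\<phi> x \<ge> \<phi> p + ?g p \<bullet> (x - p) - C * (norm (x - p))\<^sup>2" if x: "norm (x - p) < d" for x
  proof -
    let ?f = "\<lambda>t. \<phi> (p + t *\<^sub>R (x - p))"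
    have in_b: "norm (t *\<^sub>R (x - p)) \<le> norm (x - p)" if "0 \<le> t" "t \<le> 1" for t
      using that by (simp add: mult_left_le_one_le)
    have der: "(?f has_real_derivative ?g (p + t *\<^sub>R (x - p)) \<bullet> (x - p)) (at t)" if "0 \<le> t" "t \<le> 1" for t
    proof (rule has_real_derivative_line[OF has_derivative_grad[OF Ck_on_2D(1)[OF V(1,3)]]])
      have "norm (t *\<^sub>R (x - p)) < d2" using in_b[OF that] x d by linarith
      then show "p + t *\<^sub>R (x - p) \<in> V" using d2(2) by (auto simp: dist_norm)
    qed
    obtain t where t: "0 < t" "t < 1" "?f 1 - ?f 0 = (1 - 0) * (?g (p + t *\<^sub>R (x - p)) \<bullet> (x - p))"
      using MVT2[of 0 1 ?f, OF _ der] by auto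
    have "\<bar>(?g (p + t *\<^sub>R (x - p)) - ?g p) \<bullet> (x - p)\<bar> \<le> norm (?g (p + t *\<^sub>R (x - p)) - ?g p) * norm (x - p)"
      by (rule Cauchy_Schwarz_ineq2)
    also have "\<dots> \<le> (C * norm (x - p)) * norm (x - p)"
    proof (rule mult_right_mono)
      have "norm (?g (p + t *\<^sub>R (x - p)) - ?g p) \<le> C * norm (t *\<^sub>R (x - p))"
        using lip[of "p + t *\<^sub>R (x - p)"] in_b[of t] x t by simp
      also have "\<dots> \<le> C * norm (x - p)" using in_b[of t] t C by (intro mult_left_mono) auto
      finally show "norm (?g (p + t *\<^sub>R (x - p)) - ?g p) \<le> C * norm (x - p)" .
    qed simp
    finally have "(?g (p + t *\<^sub>R (x - p)) - ?g p) \<bullet> (x - p) \<ge> - (C * (norm (x - p))\<^sup>2)"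
      by (simp add: power2_eq_square mult.assoc)
    then show ?thesis using t(3) by (simp add: inner_diff_left)
  qed
  define N where "N = norm (?g p)"
  have N: "N > 0" using g by (simp add: N_def)
  \<comment> \<open>A point x of the ball satisfies |x - p|^2 < 2 (r/N) D\<phi>(p).(x - p), so 2 r C
    at most N makes the linear term win. The bound d/2 keeps the ball where the Taylor estimate
    holds.\<close>
  define r where "r = min (d / 2) (N / (2 * C))"
  have r: "r > 0" "2 * r \<le> d" "2 * r * C \<le> N" using d N C by (auto simp: r_def min_def field_simps)
  define y where "y = p + (r / N) *\<^sub>R ?g p"
  have yp: "y - p = (r / N) *\<^sub>R ?g p" by (simp add: y_def)
  have dy: "dist y p = r" using r N by (simp add: dist_norm yp N_def)
  have bd: "norm (x - p) < d" if "x \<in> ball y r" for x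
    using dist_triangle[of x p y] that dy r by (simp add: dist_norm norm_minus_commute)
  have "\<phi> x > \<phi> p" if x: "x \<in> ball y r" for x
  proof -
    have xp: "x \<noteq> p" using x dy by auto
    have "(norm (x - y))\<^sup>2 < r\<^sup>2" using x r by (intro power_strict_mono) (auto simp: dist_norm norm_minus_commute)
    moreover have "(norm (x - y))\<^sup>2 = (norm (x - p))\<^sup>2 - 2 * ((x - p) \<bullet> (y - p)) + (norm (y - p))\<^sup>2"
    proof -
      have "x - y = (x - p) - (y - p)" by simp
      then show ?thesis unfolding power2_norm_eq_inner by (simp add: inner_diff_left inner_diff_right inner_commute)
    qed
    moreover have "norm (y - p) = r" using dy by (simp add: dist_norm)
    ultimately have "(norm (x - p))\<^sup>2 < 2 * ((x - p) \<bullet> (y - p))" by simp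
    also have "\<dots> = 2 * (r / N) * (?g p \<bullet> (x - p))" by (simp add: yp inner_commute)
    finally have "N * (norm (x - p))\<^sup>2 < 2 * r * (?g p \<bullet> (x - p))" using N by (simp add: field_simps)
    moreover have "2 * r * C * (norm (x - p))\<^sup>2 \<le> N * (norm (x - p))\<^sup>2" using r(3) by (rule mult_right_mono) simp
    ultimately have "2 * r * (C * (norm (x - p))\<^sup>2) < 2 * r * (?g p \<bullet> (x - p))" by (simp add: mult.assoc)
    then have "C * (norm (x - p))\<^sup>2 < ?g p \<bullet> (x - p)" using r(1) by simp
    then show ?thesis using taylor[OF bd[OF x]] by linarith
  qed
  moreover have "ball y r \<subseteq> V"
  proof
    fix x assume "x \<in> ball y r"
    then have "x \<in> ball p d2" using bd d by (force simp: dist_norm norm_minus_commute)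
    then show "x \<in> V" using d2 by blast
  qed
  ultimately show ?thesis using r(1) dy by blast
qed

section \<open>Radial symmetry\<close>

lemma grad_uminus:
  assumes "f differentiable (at x)"
  shows "grad UNIV (\<lambda>x. - f x) x = - grad UNIV f x"
proof -
  have "((\<lambda>x. - f x) has_derivative (\<lambda>v. (- grad UNIV f x) \<bullet> v)) (at x)"
    using has_derivative_minus[OF has_derivative_grad[OF assms]] by simp
  then show ?thesis by (rule grad_eqI)
qed

lemma inner_tangent_ball_below:
  fixes \<phi> :: "'a::euclidean_space \<Rightarrow> real"
  assumes V: "open V" "p \<in> V" "Ck_on 2 V \<phi>" and g: "grad UNIV \<phi> p \<noteq> 0"
  shows "\<exists>y r. r > 0 \<and> dist y p = r \<and> ball y r \<subseteq> V \<and> (\<forall>x\<in>ball y r. \<phi> x < \<phi> p)"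
proof -
  have "Ck_on 2 V (\<lambda>x. - \<phi> x)" using Ck_on_cmult[OF V(1,3), of "-1"] by simp
  moreover have "grad UNIV (\<lambda>x. - \<phi> x) p \<noteq> 0"
    using g grad_uminus[OF Ck_on_2D(1)[OF V(1,3,2)]] by simp
  ultimately show ?thesis using inner_tangent_ball[OF V(1,2), of "\<lambda>x. - \<phi> x"] by simp
qed

text \<open>The common core of both problems. \<open>W\<close> is the open set on which
  \<open>u\<close> is harmonic. At points of \<open>M - W\<close> the assumption \<open>bdry\<close>
  supplies the touching ball that a nonzero gradient supplies at points of \<open>W\<close> on the
  two levels.\<close>

lemma model_solution:
  fixes u :: "'a::euclidean_space \<Rightarrow> real"
  assumes u2: "Ck_on 2 M u" and W: "open W" "W \<subseteq> M" "harmonic_on W u" "connected W"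
    and pos: "\<And>x. x \<in> M \<Longrightarrow> u x > 0" and dim: "DIM('a) \<ge> 3"
    and K: "compact {x \<in> M. a \<le> u x \<and> u x \<le> b}" and ab: "a < b"
    and ne: "\<exists>p\<in>M. u p = a" and reg: "\<And>p. p \<in> M \<Longrightarrow> u p = a \<or> u p = b \<Longrightarrow> grad M u p \<noteq> 0"
    and curv_a: "\<And>p. p \<in> M \<Longrightarrow> u p = a \<Longrightarrow>
      mean_curvature M u p / (real DIM('a) - 1) \<ge> norm (grad M u p) / ((real DIM('a) - 2) * u p)"
    and curv_b: "\<And>p. p \<in> M \<Longrightarrow> u p = b \<Longrightarrow>
      mean_curvature M u p / (real DIM('a) - 1) \<le> norm (grad M u p) / ((real DIM('a) - 2) * u p)"
    and bdry: "\<And>p. p \<in> M - W \<Longrightarrow> a \<le> u p \<Longrightarrow> u p \<le> b \<Longrightarrow> (u p = a \<or> u p = b) \<and>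
      (\<exists>y r. r > 0 \<and> dist y p = r \<and> ball y r \<subseteq> W \<and> (\<forall>x\<in>ball y r. a \<le> u x \<and> u x \<le> b))"
  shows "\<exists>C>0. \<exists>x0. \<forall>x\<in>W - {x0}. u x = (C * (norm (x - x0))\<^sup>2) powr (- ((real DIM('a) - 2) / 2))"
proof -
  let ?K = "{x \<in> M. a \<le> u x \<and> u x \<le> b}" and ?P = "pfun M u"
  have cP: "continuous_on M ?P" by (rule continuous_on_pfun[OF u2 pos])
  have u2W: "Ck_on 2 W u" using W(3) by (simp add: harmonic_on_def)
  have cu: "continuous_on W u" by (rule harmonic_on_imp_continuous_on[OF W(3)])
  obtain pa where pa: "pa \<in> M" "u pa = a" using ne by blast
  then have paK: "pa \<in> ?K" using ab by simp
  then have Kne: "?K \<noteq> {}" by (rule ex_in_conv[THEN iffD1, OF exI])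
  have "?K \<subseteq> M" by (rule Collect_restrict)
  then have "continuous_on ?K ?P" by (rule continuous_on_subset[OF cP])
  from continuous_attains_sup[OF K Kne this]
  obtain p where "p \<in> ?K" "\<forall>x\<in>?K. ?P x \<le> ?P p" by (rule bexE)
  note p = this(1) this(2)[rule_format]
  define m where "m = ?P p"
  have m: "m > 0"
  proof -
    have "?P pa > 0" using pos[OF pa(1)] reg[OF pa(1)] pa(2) by (simp add: pfun_def)
    then show ?thesis using p(2)[OF paK] by (simp add: m_def)
  qed
  \<comment> \<open>The maximum \<open>m\<close> has to be attained at a point interior to the
    region between the levels. If \<open>p\<close> is not such a point,
    \<open>pfun_max_on_level_set\<close> provides one in the touching ball.\<close>
  have "\<exists>x V. open V \<and> x \<in> V \<and> V \<subseteq> W \<and> V \<subseteq> ?K \<and> ?P x = m"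
  proof (cases "p \<in> W \<and> a < u p \<and> u p < b")
    case True
    have "open (W \<inter> u -` {a<..<b})" by (rule continuous_open_preimage[OF cu W(1)]) simp
    then show ?thesis using True W(2)
      by (intro exI[of _ p] exI[of _ "W \<inter> u -` {a<..<b}"]) (auto simp: m_def)
  next
    case False
    have pM: "p \<in> M" "a \<le> u p" "u p \<le> b" using p(1) by auto
    have "(u p = a \<or> u p = b) \<and> (\<exists>y r. r > 0 \<and> dist y p = r \<and> ball y r \<subseteq> W \<and> (\<forall>x\<in>ball y r. a \<le> u x \<and> u x \<le> b))"
    proof (cases "p \<in> W")
      case False
      then show ?thesis using bdry pM by blast
    next
      case True
      then have lev: "u p = a \<or> u p = b" using False pM by auto
      have g: "grad UNIV u p \<noteq> 0" using reg[OF pM(1) lev] grad_open[OF W(1) True W(2)] by simp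
      show ?thesis
      proof (cases "u p = a")
        case ua: True
        let ?V = "W \<inter> u -` {..<b}"
        have V: "open ?V" by (rule continuous_open_preimage[OF cu W(1)]) simp
        have "p \<in> ?V" using True ua ab by simp
        moreover have "Ck_on 2 ?V u" by (rule Ck_on_open_subset[OF V _ u2W]) blast
        ultimately obtain y r where yr: "r > 0" "dist y p = r" "ball y r \<subseteq> ?V" "\<forall>x\<in>ball y r. u x > u p"
          using inner_tangent_ball[OF V _ _ g] by blast
        then have "\<forall>x\<in>ball y r. a \<le> u x \<and> u x \<le> b" using ua by (auto simp: subset_iff less_imp_le)
        then show ?thesis using yr lev by blast
      next
        case False
        then have ub: "u p = b" using lev by simp
        let ?V = "W \<inter> u -` {a<..}"
        have V: "open ?V" by (rule continuous_open_preimage[OF cu W(1)]) simp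
        have "p \<in> ?V" using True ub ab by simp
        moreover have "Ck_on 2 ?V u" by (rule Ck_on_open_subset[OF V _ u2W]) blast
        ultimately obtain y r where yr: "r > 0" "dist y p = r" "ball y r \<subseteq> ?V" "\<forall>x\<in>ball y r. u x < u p"
          using inner_tangent_ball_below[OF V _ _ g] by blast
        then have "\<forall>x\<in>ball y r. a \<le> u x \<and> u x \<le> b" using ub by (auto simp: subset_iff less_imp_le)
        then show ?thesis using yr lev by blast
      qed
    qed
    then obtain y r where lev: "u p = a \<or> u p = b" and yr: "r > 0" "dist y p = r" "ball y r \<subseteq> W"
      and in_ab: "\<And>x. x \<in> ball y r \<Longrightarrow> a \<le> u x \<and> u x \<le> b" by blast
    have bK: "ball y r \<subseteq> ?K" using in_ab yr(3) W(2) by blast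
    have max: "?P x \<le> ?P p" if "x \<in> ball y r" for x using p(2) bK that by blast
    have "\<exists>x\<in>ball y r. ?P x = ?P p"
    proof (cases "u p = a")
      case True
      show ?thesis
        by (rule pfun_max_on_level_set[OF u2 W(1-3) pos pM(1) yr reg[OF pM(1) lev], of 1])
          (use True in_ab curv_a[OF pM(1)] max dim in auto)
    next
      case False
      then have ub: "u p = b" using lev by simp
      show ?thesis
        by (rule pfun_max_on_level_set[OF u2 W(1-3) pos pM(1) yr reg[OF pM(1) lev], of "-1"])
          (use ub in_ab curv_b[OF pM(1)] max dim in auto)
    qed
    then obtain x where x: "x \<in> ball y r" "?P x = ?P p" by (rule bexE)
    show ?thesis
      by (intro exI[of _ x] exI[of _ "ball y r"] conjI open_ball x(1) yr(3) bK) (simp add: x(2) m_def)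
  qed
  then obtain x1 V where V: "open V" "x1 \<in> V" "V \<subseteq> W" "V \<subseteq> ?K" "?P x1 = m" by (elim exE conjE)
  obtain \<rho> where \<rho>: "\<rho> > 0" "cball x1 \<rho> \<subseteq> V" using V(1,2) open_contains_cball by blast
  have bV: "ball x1 \<rho> \<subseteq> V" using \<rho>(2) ball_subset_cball by (rule subset_trans[rotated])
  let ?b = "\<lambda>x. (2 / u x) *\<^sub>R grad M u x"
  have "u x \<noteq> 0" if "x \<in> M" for x using pos[OF that] by simp
  then have "continuous_on M ?b"
    using Ck_on_imp_continuous_on[OF u2] continuous_on_grad_within[OF u2]
    by (intro continuous_intros) auto
  moreover have "cball x1 \<rho> \<subseteq> M" using \<rho>(2) V(3) W(2) by (meson subset_trans)
  ultimately have "continuous_on (cball x1 \<rho>) ?b" by (rule continuous_on_subset)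
  then have "compact (?b ` cball x1 \<rho>)" by (rule compact_continuous_image[OF _ compact_cball])
  then have "bounded (?b ` cball x1 \<rho>)" by (rule compact_imp_bounded)
  then obtain \<beta> where "\<forall>z\<in>?b ` cball x1 \<rho>. norm z \<le> \<beta>" unfolding bounded_iff by (rule exE)
  note \<beta> = this[rule_format]
  have P_const: "?P z = m" if z: "z \<in> ball x1 (\<rho> / 2)" for z
  proof (rule strong_maximum_principle[where f="?P" and b="?b" and \<beta>=\<beta> and R=\<rho> and ?x0.0=x1])
    fix x assume x: "x \<in> ball x1 \<rho>"
    then have "x \<in> V" using bV by (rule subsetD[rotated])
    then show "?P x \<le> m" unfolding m_def by (intro p(2)) (rule subsetD[OF V(4)])
    show "\<exists>g l. has_lap ?P x g l \<and> l + ?b x \<bullet> g \<ge> 0"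
      by (rule pfun_has_lap[OF W(1-3) pos _ dim]) (use \<open>x \<in> V\<close> V(3) in auto)
    show "norm (?b x) \<le> \<beta>" by (rule \<beta>[OF imageI]) (use x in auto)
  qed (use V(5) z in auto)
  have bW: "ball x1 (\<rho> / 2) \<subseteq> W" using bV V(3) \<rho>(1) by (auto simp: subset_iff)
  have posW: "u x > 0" if "x \<in> W" for x using pos W(2) that by blast
  have "\<exists>x0. \<forall>y\<in>ball x1 (\<rho> / 2). u y = (m / (real DIM('a) - 2)\<^sup>2 * (norm (y - x0))\<^sup>2) powr (- ((real DIM('a) - 2) / 2))"
  proof (rule pfun_constant_imp_model[OF W(1,3) posW dim bW _ m])
    fix x assume x: "x \<in> ball x1 (\<rho> / 2)"
    show "pfun UNIV u x = m" using P_const[OF x] pfun_open[OF W(1) subsetD[OF bW x] W(2)] by simp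
  qed (use \<rho> in auto)
  then obtain x0 where x0: "\<And>y. y \<in> ball x1 (\<rho> / 2) \<Longrightarrow>
    u y = (m / (real DIM('a) - 2)\<^sup>2 * (norm (y - x0))\<^sup>2) powr (- ((real DIM('a) - 2) / 2))" by blast
  define C where "C = m / (real DIM('a) - 2)\<^sup>2"
  have C: "C > 0" using m dim by (simp add: C_def)
  let ?f = "\<lambda>x. (C * (norm (x - x0))\<^sup>2) powr (- ((real DIM('a) - 2) / 2))"
  have nx0: "y \<noteq> x0" if "y \<in> ball x1 (\<rho> / 2)" for y
    using x0[OF that] posW[of y] bW that by auto
  have o: "open (W - {x0})" using W(1) by (rule open_delete)
  \<comment> \<open>\<open>x0\<close> is not known to lie outside \<open>W\<close>; removing it
    keeps \<open>W\<close> connected and makes the model harmonic on what is left.\<close>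
  have con: "connected (W - {x0})" using W(1,4) dim by (intro connected_open_delete) auto
  have h: "harmonic_on (W - {x0}) (\<lambda>x. u x - ?f x)"
  proof (rule harmonic_on_diff[OF o])
    show "harmonic_on (W - {x0}) u" by (rule harmonic_on_subset[OF o _ W(3)]) blast
    show "harmonic_on (W - {x0}) ?f" by (rule harmonic_on_subset[OF o _ harmonic_on_model[OF C]]) blast
  qed
  have "u x = ?f x" if "x \<in> W - {x0}" for x
  proof -
    have "u x - ?f x = 0"
    proof (rule harmonic_on_unique_continuation[OF o con h _ _ _ that, of "\<rho> / 2" x1])
      show "ball x1 (\<rho> / 2) \<subseteq> W - {x0}" using bW nx0 by blast
      show "u z - ?f z = 0" if "z \<in> ball x1 (\<rho> / 2)" for z using x0[OF that] by (simp add: C_def)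
    qed (use \<rho> in auto)
    then show ?thesis by simp
  qed
  then show ?thesis using C by blast
qed

text \<open>Each side of the sphere is connected and misses the frontier, so it lies in \<Omega> or
  is disjoint from it. The unbounded outside cannot lie in \<Omega>.\<close>

lemma frontier_in_sphere_imp_ball:
  fixes \<Omega> :: "'a::euclidean_space set"
  assumes \<Omega>: "open \<Omega>" "bounded \<Omega>" "\<Omega> \<noteq> {}" and fr: "frontier \<Omega> \<subseteq> sphere x0 R" and dim: "DIM('a) \<ge> 2"
  shows "R > 0 \<and> \<Omega> = ball x0 R"
proof -
  have one_side: "S \<subseteq> \<Omega>" if "connected S" "S \<inter> sphere x0 R = {}" "S \<inter> \<Omega> \<noteq> {}" for S
    using connected_Int_frontier[OF that(1,3)] that(2) fr by blast
  have "\<Omega> \<inter> - cball x0 R = {}"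
  proof (rule ccontr)
    assume "\<Omega> \<inter> - cball x0 R \<noteq> {}"
    moreover have "connected (- cball x0 R)"
      using dim by (intro connected_complement_bounded_convex) auto
    ultimately have "- cball x0 R \<subseteq> \<Omega>" by (intro one_side) auto
    then have "bounded (- cball x0 R)" using \<Omega>(2) bounded_subset by blast
    then have "bounded (- cball x0 R \<union> cball x0 R)" unfolding bounded_Un using bounded_cball by (rule conjI)
    moreover have "- cball x0 R \<union> cball x0 R = UNIV" by (rule Compl_partition2)
    ultimately show False using not_bounded_UNIV by metis
  qed
  then have sub: "\<Omega> \<subseteq> ball x0 R" using interior_maximal[of \<Omega> "cball x0 R"] \<Omega>(1) by auto
  then have "R > 0" using \<Omega>(3) by (metis ball_eq_empty not_le subset_empty)
  moreover have "ball x0 R \<subseteq> \<Omega>" by (rule one_side) (use sub \<Omega>(3) in auto)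
  ultimately show ?thesis using sub by blast
qed

text \<open>The model blows up at \<open>x0\<close> while \<open>u\<close> is continuous on
  \<open>M\<close>, so \<open>x0\<close> is not in \<open>M\<close> and the formula extends from
  \<open>W\<close> to all of \<open>M\<close>. It is injective in the distance to \<open>x0\<close>,
  so the constant boundary value puts the frontier on a sphere.\<close>

lemma model_imp_ball:
  fixes u :: "'a::euclidean_space \<Rightarrow> real"
  assumes cu: "continuous_on M u" and W: "open W" "W \<subseteq> M" "M \<subseteq> closure W" and dim: "DIM('a) \<ge> 3"
    and C: "C > 0" and model: "\<And>x. x \<in> W - {x0} \<Longrightarrow> u x = (C * (norm (x - x0))\<^sup>2) powr (- ((real DIM('a) - 2) / 2))"
    and \<Omega>: "open \<Omega>" "bounded \<Omega>" "\<Omega> \<noteq> {}" and fr: "frontier \<Omega> \<subseteq> M" "\<And>x. x \<in> frontier \<Omega> \<Longrightarrow> u x = t"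
  shows "\<exists>r. r > 0 \<and> \<Omega> = ball x0 r \<and> (\<forall>x\<in>M. \<forall>y\<in>M. dist x0 x = dist x0 y \<longrightarrow> u x = u y)"
proof -
  define k where "k = (real DIM('a) - 2) / 2"
  have k: "k > 0" using dim by (simp add: k_def)
  let ?f = "\<lambda>x. (C * (norm (x - x0))\<^sup>2) powr (- k)"
  have x0M: "x0 \<notin> M"
  proof
    assume xM: "x0 \<in> M"
    define B where "B = \<bar>u x0\<bar> + 1"
    have B: "B > 0" by (simp add: B_def)
    obtain d where d: "d > 0" "\<And>x. x \<in> M \<Longrightarrow> dist x x0 < d \<Longrightarrow> dist (u x) (u x0) < 1"
      using cu xM unfolding continuous_on_iff by (metis zero_less_one)
    \<comment> \<open>Within this distance of \<open>x0\<close> the model exceeds \<open>B\<close>,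
      hence exceeds \<open>u x0\<close> by more than continuity permits.\<close>
    define e where "e = min d (sqrt (B powr (- (1 / k)) / C))"
    have e: "e > 0" "e \<le> d" "e \<le> sqrt (B powr (- (1 / k)) / C)" using d(1) B C by (auto simp: e_def)
    have "x0 \<in> closure (W - {x0})"
    proof (cases "x0 \<in> W")
      case True
      then have "x0 islimpt W" using W(1) by (metis interior_limit_point interior_open)
      then show ?thesis by (simp add: islimpt_in_closure)
    next
      case False
      then show ?thesis using xM W(3) by auto
    qed
    then obtain x where x: "x \<in> W - {x0}" "dist x x0 < e" using e(1) closure_approachable by blast
    have "(norm (x - x0))\<^sup>2 < (sqrt (B powr (- (1 / k)) / C))\<^sup>2"
      using x(2) e(3) by (intro power_strict_mono) (auto simp: dist_norm)
    also have "\<dots> = B powr (- (1 / k)) / C" using C by simp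
    finally have "C * (norm (x - x0))\<^sup>2 < B powr (- (1 / k))" using C by (simp add: field_simps)
    then have "(B powr (- (1 / k))) powr (- k) < (C * (norm (x - x0))\<^sup>2) powr (- k)"
      using k C x(1) by (intro powr_less_mono2_neg) auto
    moreover have "(B powr (- (1 / k))) powr (- k) = B" using k B by (simp add: powr_powr)
    ultimately have "B < u x" using model[OF x(1)] by (simp add: k_def)
    moreover have "dist (u x) (u x0) < 1" using d(2)[of x] x e(2) W(2) by auto
    ultimately show False by (simp add: B_def dist_real_def)
  qed
  have uf: "u x = ?f x" if x: "x \<in> M" for x
  proof -
    have "u x - ?f x = 0"
    proof (rule continuous_on_eq_0_closure[OF _ W(2) _ x])
      have "C * (norm (x - x0))\<^sup>2 \<noteq> 0" if "x \<in> M" for x using that x0M C by auto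
      then show "continuous_on M (\<lambda>x. u x - ?f x)" by (intro continuous_intros cu) auto
      show "u z - ?f z = 0" if "z \<in> W" for z
      proof -
        have "z \<in> W - {x0}" using that x0M W(2) by auto
        then show ?thesis using model[of z] by (simp add: k_def)
      qed
      show "x \<in> closure W" using x W(3) by blast
    qed
    then show ?thesis by simp
  qed
  have "frontier \<Omega> \<noteq> {}"
  proof -
    have "\<Omega> \<noteq> UNIV" using \<Omega>(2) not_bounded_UNIV by metis
    then show ?thesis using frontier_eq_empty \<Omega>(3) by blast
  qed
  then obtain z0 where z0: "z0 \<in> frontier \<Omega>" by blast
  have "frontier \<Omega> \<subseteq> sphere x0 (dist x0 z0)"
  proof
    fix z assume z: "z \<in> frontier \<Omega>"
    have ne: "z \<noteq> x0" "z0 \<noteq> x0" using z z0 fr(1) x0M by auto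
    have "z \<in> M" "z0 \<in> M" using z z0 fr(1) by auto
    then have "?f z = ?f z0" using uf[of z] uf[of z0] fr(2)[OF z] fr(2)[OF z0] by argo
    moreover have "(s powr (- k)) powr (- (1 / k)) = s" if "s > 0" for s
      using k that by (simp add: powr_powr)
    moreover have "C * (norm (z - x0))\<^sup>2 > 0" "C * (norm (z0 - x0))\<^sup>2 > 0" using C ne by auto
    ultimately have "C * (norm (z - x0))\<^sup>2 = C * (norm (z0 - x0))\<^sup>2" by metis
    then have "norm (z - x0) = norm (z0 - x0)" using C by simp
    then show "z \<in> sphere x0 (dist x0 z0)" by (simp add: dist_norm norm_minus_commute)
  qed
  then have "dist x0 z0 > 0 \<and> \<Omega> = ball x0 (dist x0 z0)"
    by (rule frontier_in_sphere_imp_ball[OF \<Omega>]) (use dim in simp)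
  then have b: "dist x0 z0 > 0" "\<Omega> = ball x0 (dist x0 z0)" by (rule conjunct1, rule conjunct2)
  have "u x = u y" if "x \<in> M" "y \<in> M" "dist x0 x = dist x0 y" for x y
    using uf[OF that(1)] uf[OF that(2)] that(3) by (simp add: dist_norm norm_minus_commute)
  then have "\<forall>x\<in>M. \<forall>y\<in>M. dist x0 x = dist x0 y \<longrightarrow> u x = u y" by (intro ballI impI)
  with b show ?thesis by (intro exI[of _ "dist x0 z0"] conjI)
qed

text \<open>The exterior ball serves the exterior problem and the interior ball the interior one;
  \<open>N\<close> keeps it near \<open>p\<close>, or away from the origin.\<close>

lemma smooth_boundary_tangent_balls:
  fixes \<Omega> :: "'a::euclidean_space set"
  assumes sb: "smooth_boundary \<Omega>" and p: "p \<in> frontier \<Omega>" and N: "open N" "p \<in> N"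
  shows "\<exists>y r. r > 0 \<and> dist y p = r \<and> ball y r \<subseteq> N \<inter> - closure \<Omega>"
    and "\<exists>y r. r > 0 \<and> dist y p = r \<and> ball y r \<subseteq> N \<inter> \<Omega>"
proof -
  obtain U \<phi> where U: "open U" "p \<in> U" "smooth_on U \<phi>" "\<forall>x\<in>U. grad U \<phi> x \<noteq> 0"
    "\<Omega> \<inter> U = {x \<in> U. \<phi> x < 0}" "frontier \<Omega> \<inter> U = {x \<in> U. \<phi> x = 0}"
    using sb[unfolded smooth_boundary_def, rule_format, OF p] by (elim exE conjE)
  let ?V = "U \<inter> N"
  have V: "open ?V" "p \<in> ?V" "Ck_on 2 ?V \<phi>"
  proof -
    show "open ?V" using U(1) N(1) by (rule open_Int)
    then show "Ck_on 2 ?V \<phi>"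
      by (rule Ck_on_open_subset[OF _ Int_lower1]) (rule U(3)[unfolded smooth_on_def, rule_format])
    show "p \<in> ?V" using U(2) N(2) by (rule IntI)
  qed
  have g: "grad UNIV \<phi> p \<noteq> 0" using U(4) U(2) grad_open[OF U(1,2) order_refl] by metis
  have "p \<in> frontier \<Omega> \<inter> U" using p U(2) by (rule IntI)
  then have p0: "\<phi> p = 0" unfolding U(6) by simp
  obtain y r where yr: "r > 0" "dist y p = r" "ball y r \<subseteq> ?V" "\<forall>x\<in>ball y r. \<phi> x > \<phi> p"
    using inner_tangent_ball[OF V g] by (elim exE conjE)
  have "x \<in> N \<inter> - closure \<Omega>" if x: "x \<in> ball y r" for x
  proof -
    have xV: "x \<in> U" "x \<in> N" using subsetD[OF yr(3) x] by auto
    have "\<phi> x > 0" using bspec[OF yr(4) x] p0 by simp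
    then have "x \<notin> \<Omega> \<inter> U" "x \<notin> frontier \<Omega> \<inter> U" unfolding U(5,6) by auto
    then have "x \<notin> closure \<Omega>" using xV(1) by (auto simp: closure_Un_frontier)
    then show ?thesis using xV(2) by simp
  qed
  then have "ball y r \<subseteq> N \<inter> - closure \<Omega>" by (rule subsetI)
  with yr(1,2) show "\<exists>y r. r > 0 \<and> dist y p = r \<and> ball y r \<subseteq> N \<inter> - closure \<Omega>"
    by (intro exI[of _ y] exI[of _ r] conjI)
  obtain y r where yr: "r > 0" "dist y p = r" "ball y r \<subseteq> ?V" "\<forall>x\<in>ball y r. \<phi> x < \<phi> p"
    using inner_tangent_ball_below[OF V g] by (elim exE conjE)
  have "x \<in> N \<inter> \<Omega>" if x: "x \<in> ball y r" for x
  proof -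
    have xV: "x \<in> U" "x \<in> N" using subsetD[OF yr(3) x] by auto
    have "\<phi> x < 0" using bspec[OF yr(4) x] p0 by simp
    then have "x \<in> \<Omega> \<inter> U" unfolding U(5) using xV(1) by simp
    then show ?thesis using xV(2) by simp
  qed
  then have "ball y r \<subseteq> N \<inter> \<Omega>" by (rule subsetI)
  with yr(1,2) show "\<exists>y r. r > 0 \<and> dist y p = r \<and> ball y r \<subseteq> N \<inter> \<Omega>"
    by (intro exI[of _ y] exI[of _ r] conjI)
qed

section \<open>The exterior and the interior problem\<close>

lemma harmonic_on_laplacian_within:
  assumes "open W" "W \<subseteq> M" "Ck_on 2 M u" "\<And>x. x \<in> W \<Longrightarrow> laplacian M u x = 0"
  shows "harmonic_on W u"
  unfolding harmonic_on_def
  using Ck_on_open_subset[OF assms(1-3)] laplacian_open[OF assms(1) _ assms(2), of _ u] assms(4) by auto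

text \<open>The maximum principle gives \<open>u \<le> 1\<close>, hence \<open>b \<le> 1\<close>. A
  boundary point with value at most \<open>b\<close> therefore lies on the upper level, with
  \<open>b = 1\<close>. Decay at infinity makes the region between the levels compact.\<close>

lemma exterior_radial:
  fixes u :: "'a::euclidean_space \<Rightarrow> real"
  assumes \<Omega>: "open \<Omega>" "bounded \<Omega>" "smooth_boundary \<Omega>" "\<Omega> \<noteq> {}" and dim: "DIM('a) \<ge> 3"
    and ext: "exterior_problem \<Omega> u" and con: "connected (- closure \<Omega>)"
    and pos: "\<And>x. x \<in> - \<Omega> \<Longrightarrow> u x > 0" and ab: "0 < a" "a < b"
    and ne: "\<exists>p\<in>- \<Omega>. u p = a" "\<exists>p\<in>- \<Omega>. u p = b"
    and reg: "\<And>p. p \<in> - \<Omega> \<Longrightarrow> u p = a \<or> u p = b \<Longrightarrow> grad (- \<Omega>) u p \<noteq> 0"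
    and curv_a: "\<And>p. p \<in> - \<Omega> \<Longrightarrow> u p = a \<Longrightarrow>
      mean_curvature (- \<Omega>) u p / (real DIM('a) - 1) \<ge> norm (grad (- \<Omega>) u p) / ((real DIM('a) - 2) * u p)"
    and curv_b: "\<And>p. p \<in> - \<Omega> \<Longrightarrow> u p = b \<Longrightarrow>
      mean_curvature (- \<Omega>) u p / (real DIM('a) - 1) \<le> norm (grad (- \<Omega>) u p) / ((real DIM('a) - 2) * u p)"
  shows "\<exists>x0 r. r > 0 \<and> \<Omega> = ball x0 r \<and> (\<forall>x\<in>- \<Omega>. \<forall>y\<in>- \<Omega>. dist x0 x = dist x0 y \<longrightarrow> u x = u y)"
proof -
  let ?M = "- \<Omega>" and ?W = "- closure \<Omega>"
  have u2: "Ck_on 2 ?M u" and lap: "\<And>x. x \<in> ?W \<Longrightarrow> laplacian ?M u x = 0"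
    and u1: "\<And>x. x \<in> frontier \<Omega> \<Longrightarrow> u x = 1" and lim: "(u \<longlongrightarrow> 0) at_infinity"
    using ext unfolding exterior_problem_def by auto
  have W: "open ?W" "?W \<subseteq> ?M" using closure_subset by auto
  have harm: "harmonic_on ?W u" by (rule harmonic_on_laplacian_within[OF W u2 lap])
  have cu: "continuous_on ?M u" by (rule Ck_on_imp_continuous_on[OF u2])
  have cM: "closed ?M" using \<Omega>(1) by (simp add: closed_Compl)
  have MW: "x \<in> frontier \<Omega>" if "x \<in> ?M" "x \<notin> ?W" for x
    using that \<Omega>(1) by (simp add: frontier_def interior_open)
  have frM: "frontier \<Omega> \<subseteq> ?M" using \<Omega>(1) by (auto simp: frontier_def interior_open)
  have far: "\<exists>R. \<forall>x. R \<le> norm x \<longrightarrow> u x < e" if "e > 0" for e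
  proof -
    have "\<forall>\<^sub>F x in at_infinity. u x < e" using lim that by (rule order_tendstoD(2))
    then show ?thesis unfolding eventually_at_infinity .
  qed
  have le1: "u x \<le> 1" if x: "x \<in> ?M" for x
  proof (cases "x \<in> ?W")
    case False
    then show ?thesis using MW[OF x] u1 by simp
  next
    case True
    obtain R where R: "\<And>x. R \<le> norm x \<Longrightarrow> u x < 1" using far[of 1] by auto
    show ?thesis
    proof (cases "norm x < R")
      case False
      then show ?thesis using R[of x] by simp
    next
      case xR: True
      let ?U = "?W \<inter> ball 0 R"
      have o: "open ?U" using W(1) by (intro open_Int) auto
      have cl: "closure ?U \<subseteq> ?M" by (rule closure_minimal[OF _ cM]) (use W(2) in blast)
      show ?thesis
      proof (rule harmonic_on_le_frontier[where U="?W \<inter> ball 0 R" and f=u and m=1 and x=x])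
        show "open ?U" by (rule o)
        show "bounded ?U" by (simp add: bounded_Int)
        show "continuous_on (closure ?U) u" by (rule continuous_on_subset[OF cu cl])
        show "harmonic_on ?U u" by (rule harmonic_on_subset[OF o _ harm]) blast
        show "x \<in> ?U" using True xR by simp
        fix z assume "z \<in> frontier ?U"
        then have z: "z \<in> closure ?U" "z \<notin> ?U" unfolding frontier_def interior_open[OF o] by blast+
        then have zM: "z \<in> ?M" using cl by blast
        show "u z \<le> 1"
        proof (cases "z \<in> ?W")
          case False
          then show ?thesis using MW[OF zM] u1 by simp
        next
          case True
          then have "R \<le> norm z" using z(2) by simp
          then show ?thesis using R[of z] by simp
        qed
      qed
    qed
  qed
  have b1: "b \<le> 1" using ne(2) le1 by blast
  have K: "compact {x \<in> ?M. a \<le> u x \<and> u x \<le> b}"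
  proof -
    have "closed (?M \<inter> u -` {a..b})" by (rule continuous_closed_preimage[OF cu cM]) simp
    moreover have "{x \<in> ?M. a \<le> u x \<and> u x \<le> b} = ?M \<inter> u -` {a..b}" by auto
    ultimately have cl: "closed {x \<in> ?M. a \<le> u x \<and> u x \<le> b}" by simp
    obtain R where R: "\<And>x. R \<le> norm x \<Longrightarrow> u x < a" using far[OF ab(1)] by auto
    have "norm x \<le> R" if "a \<le> u x" for x using R[of x] that by force
    then have "bounded {x \<in> ?M. a \<le> u x \<and> u x \<le> b}" unfolding bounded_iff by blast
    then show ?thesis using cl by (simp add: compact_eq_bounded_closed)
  qed
  have bdry: "(u p = a \<or> u p = b) \<and> (\<exists>y r. r > 0 \<and> dist y p = r \<and> ball y r \<subseteq> ?W \<and> (\<forall>x\<in>ball y r. a \<le> u x \<and> u x \<le> b))"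
    if p: "p \<in> ?M - ?W" "u p \<le> b" for p
  proof -
    have fr: "p \<in> frontier \<Omega>" using MW p(1) by blast
    \<comment> \<open>Below the level \<open>b\<close> there is room: nearby values exceed
      \<open>a\<close> by continuity, and \<open>le1\<close> gives the upper bound.\<close>
    then have ub: "u p = b" "b = 1" using u1[OF fr] p(2) b1 by auto
    have "p \<in> ?M" "b - a > 0" using p(1) ab(2) by auto
    from cu[unfolded continuous_on_iff, rule_format, OF this]
    obtain d where "d > 0" "\<forall>x\<in>?M. dist x p < d \<longrightarrow> dist (u x) (u p) < b - a" by (elim exE conjE)
    note d = this(1) this(2)[rule_format]
    have "p \<in> ball p d" using d(1) by simp
    from smooth_boundary_tangent_balls(1)[OF \<Omega>(3) fr open_ball this]
    obtain y r where yr: "r > 0" "dist y p = r" "ball y r \<subseteq> ball p d \<inter> - closure \<Omega>"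
      by (elim exE conjE)
    have "a \<le> u x \<and> u x \<le> b" if "x \<in> ball y r" for x
    proof -
      have "x \<in> ball p d" "x \<in> ?W" using subsetD[OF yr(3) that] by blast+
      then have x: "x \<in> ?M" "dist x p < d" using W(2) by (auto simp: dist_commute)
      show ?thesis using d(2)[OF x] le1[OF x(1)] ub by (simp add: dist_real_def)
    qed
    moreover have "ball y r \<subseteq> ?W" using yr(3) by blast
    ultimately show ?thesis using yr(1,2) ub by blast
  qed
  have MclW: "?M \<subseteq> closure ?W"
  proof
    fix p assume p: "p \<in> ?M"
    show "p \<in> closure ?W"
    proof (cases "p \<in> ?W")
      case True
      then show ?thesis using closure_subset by blast
    next
      case False
      obtain y r where yr: "r > 0" "dist y p = r" "ball y r \<subseteq> UNIV \<inter> - closure \<Omega>"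
        using smooth_boundary_tangent_balls(1)[OF \<Omega>(3) MW[OF p False] open_UNIV] by blast
      then have "p \<in> closure (ball y r)" by simp
      then show ?thesis using yr(3) closure_mono by blast
    qed
  qed
  obtain C x0 where "C > 0" "\<And>x. x \<in> ?W - {x0} \<Longrightarrow> u x = (C * (norm (x - x0))\<^sup>2) powr (- ((real DIM('a) - 2) / 2))"
    using model_solution[OF u2 W harm con pos dim K ab(2) ne(1) reg curv_a curv_b bdry] by blast
  from model_imp_ball[OF cu W MclW dim this \<Omega>(1,2,4) frM u1] show ?thesis by blast
qed

text \<open>The mirror image of the exterior case: \<open>c \<le> u\<close> forces
  \<open>c \<le> a\<close>, so boundary points with value at least \<open>a\<close> lie on the lower
  level, with \<open>a = c\<close>.\<close>

lemma interior_radial: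
  fixes u :: "'a::euclidean_space \<Rightarrow> real"
  assumes \<Omega>: "open \<Omega>" "connected \<Omega>" "bounded \<Omega>" "smooth_boundary \<Omega>" "0 \<in> \<Omega>" and dim: "DIM('a) \<ge> 3"
    and int: "interior_problem d c \<Omega> u" and M: "M = closure \<Omega> - {0}"
    and pos: "\<And>x. x \<in> M \<Longrightarrow> u x > 0" and ab: "a < b"
    and ne: "\<exists>p\<in>M. u p = a" "\<exists>p\<in>M. u p = b"
    and reg: "\<And>p. p \<in> M \<Longrightarrow> u p = a \<or> u p = b \<Longrightarrow> grad M u p \<noteq> 0"
    and curv_a: "\<And>p. p \<in> M \<Longrightarrow> u p = a \<Longrightarrow>
      mean_curvature M u p / (real DIM('a) - 1) \<ge> norm (grad M u p) / ((real DIM('a) - 2) * u p)"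
    and curv_b: "\<And>p. p \<in> M \<Longrightarrow> u p = b \<Longrightarrow>
      mean_curvature M u p / (real DIM('a) - 1) \<le> norm (grad M u p) / ((real DIM('a) - 2) * u p)"
  shows "\<exists>x0 r. r > 0 \<and> \<Omega> = ball x0 r \<and> (\<forall>x\<in>M. \<forall>y\<in>M. dist x0 x = dist x0 y \<longrightarrow> u x = u y)"
proof -
  let ?W = "\<Omega> - {0}"
  have u2: "Ck_on 2 M u" and u1: "\<And>x. x \<in> frontier \<Omega> \<Longrightarrow> u x = c"
    and weak: "\<And>\<phi>. test_function \<Omega> \<phi> \<Longrightarrow> - (LINT x:\<Omega>|lborel. u x * laplacian UNIV \<phi> x) = d * boundary_area \<Omega> * \<phi> 0"
    using int unfolding interior_problem_def M by auto
  have W: "open ?W" "?W \<subseteq> M" using \<Omega>(1) closure_subset unfolding M by auto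
  have con: "connected ?W" using \<Omega>(1,2) dim by (intro connected_open_delete) auto
  have cu: "continuous_on M u" by (rule Ck_on_imp_continuous_on[OF u2])
  have harm: "harmonic_on ?W u"
  proof (rule weak_harmonic_imp_harmonic[OF W(1) _ Ck_on_open_subset[OF W u2], of \<Omega>])
    fix \<phi> :: "'a \<Rightarrow> real" assume \<phi>: "test_function \<Omega> \<phi>" "closure {x. \<phi> x \<noteq> 0} \<subseteq> ?W"
    have "\<phi> 0 = 0" using \<phi>(2) closure_subset[of "{x. \<phi> x \<noteq> 0}"] by blast
    then show "(LINT x:\<Omega>|lborel. u x * laplacian UNIV \<phi> x) = 0" using weak[OF \<phi>(1)] by simp
  qed blast
  have MW: "x \<in> frontier \<Omega>" if "x \<in> M" "x \<notin> ?W" for x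
    using that \<Omega>(1) by (simp add: frontier_def interior_open M)
  have frM: "frontier \<Omega> \<subseteq> M" using \<Omega>(1,5) by (auto simp: frontier_def interior_open M)
  have posW: "u x > 0" if "x \<in> ?W" for x using pos W(2) that by blast
  note sing = positive_harmonic_singularity[OF \<Omega>(1,3,5) cu[unfolded M] harm u1 posW dim]
  have ge: "c \<le> u x" if "x \<in> M" for x
    using sing(2)[of x] MW[OF that] u1 by fastforce
  \<comment> \<open>A constant \<open>u\<close> could not take both values \<open>a\<close> and
    \<open>b\<close>; this leaves the blow-up at the origin.\<close>
  have "\<not> (\<forall>x\<in>?W. u x = c)"
  proof
    assume "\<forall>x\<in>?W. u x = c"
    then have "u x = c" if "x \<in> M" for x using MW[OF that] u1 by blast
    then show False using ne ab by fastforce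
  qed
  then obtain r0 where r0: "r0 > 0" "\<And>x. 0 < norm x \<Longrightarrow> norm x < r0 \<Longrightarrow> u x > b" using sing(1) by blast
  have K: "compact {x \<in> M. a \<le> u x \<and> u x \<le> b}"
  proof -
    \<comment> \<open>The removed ball contains no point of \<open>M\<close> with value at most
      \<open>b\<close>, so nothing is lost, and the rest is compact and away from the
      singularity.\<close>
    let ?S = "closure \<Omega> - ball 0 r0"
    have S: "compact ?S" using \<Omega>(3) by (intro compact_diff) (auto simp: compact_closure)
    have "?S \<subseteq> M" using r0(1) by (auto simp: M)
    then have "continuous_on ?S u" by (rule continuous_on_subset[OF cu])
    then have "closed (?S \<inter> u -` {a..b})"
      by (rule continuous_closed_preimage[OF _ compact_imp_closed[OF S]]) simp
    then have "compact (?S \<inter> (?S \<inter> u -` {a..b}))" by (rule compact_Int_closed[OF S])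
    moreover have "{x \<in> M. a \<le> u x \<and> u x \<le> b} = ?S \<inter> (?S \<inter> u -` {a..b})"
    proof
      show "?S \<inter> (?S \<inter> u -` {a..b}) \<subseteq> {x \<in> M. a \<le> u x \<and> u x \<le> b}" using \<open>?S \<subseteq> M\<close> by auto
      show "{x \<in> M. a \<le> u x \<and> u x \<le> b} \<subseteq> ?S \<inter> (?S \<inter> u -` {a..b})"
      proof
        fix x assume x: "x \<in> {x \<in> M. a \<le> u x \<and> u x \<le> b}"
        then have "norm x \<ge> r0" using r0(2)[of x] by (force simp: M)
        then show "x \<in> ?S \<inter> (?S \<inter> u -` {a..b})" using x by (auto simp: M)
      qed
    qed
    ultimately show ?thesis by simp
  qed
  have ca: "c \<le> a" using ne(1) ge by blast
  have bdry: "(u p = a \<or> u p = b) \<and> (\<exists>y r. r > 0 \<and> dist y p = r \<and> ball y r \<subseteq> ?W \<and> (\<forall>x\<in>ball y r. a \<le> u x \<and> u x \<le> b))"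
    if p: "p \<in> M - ?W" "a \<le> u p" for p
  proof -
    have fr: "p \<in> frontier \<Omega>" using MW p(1) by blast
    then have ua: "u p = a" "a = c" using u1[OF fr] p(2) ca by auto
    have "p \<in> M" "b - a > 0" using p(1) ab by auto
    from cu[unfolded continuous_on_iff, rule_format, OF this]
    obtain d where "d > 0" "\<forall>x\<in>M. dist x p < d \<longrightarrow> dist (u x) (u p) < b - a" by (elim exE conjE)
    note d = this(1) this(2)[rule_format]
    have N: "open (ball p d - {0})" "p \<in> ball p d - {0}" using d(1) p(1) by (auto simp: M)
    obtain y r where yr: "r > 0" "dist y p = r" "ball y r \<subseteq> (ball p d - {0}) \<inter> \<Omega>"
      using smooth_boundary_tangent_balls(2)[OF \<Omega>(4) fr N] by blast
    have "a \<le> u x \<and> u x \<le> b" if "x \<in> ball y r" for x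
    proof -
      have "x \<in> ball p d" "x \<in> ?W" using subsetD[OF yr(3) that] by blast+
      then have x: "x \<in> M" "dist x p < d" using W(2) by (auto simp: dist_commute)
      show ?thesis using d(2)[OF x] ge[OF x(1)] ua by (simp add: dist_real_def)
    qed
    moreover have "ball y r \<subseteq> ?W" using yr(3) by blast
    ultimately show ?thesis using yr(1,2) ua by blast
  qed
  have MclW: "M \<subseteq> closure ?W"
  proof -
    have "closure (insert 0 ?W) = insert 0 (closure ?W)" by (rule closure_insert)
    then have "closure \<Omega> = insert 0 (closure ?W)" unfolding insert_Diff[OF \<Omega>(5)] .
    then show ?thesis unfolding M by blast
  qed
  have ne\<Omega>: "\<Omega> \<noteq> {}" using \<Omega>(5) by blast
  obtain C x0 where "C > 0" "\<And>x. x \<in> ?W - {x0} \<Longrightarrow> u x = (C * (norm (x - x0))\<^sup>2) powr (- ((real DIM('a) - 2) / 2))"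
    using model_solution[OF u2 W harm con pos dim K ab ne(1) reg curv_a curv_b bdry] by blast
  from model_imp_ball[OF cu W MclW dim this \<Omega>(1,3) ne\<Omega> frM u1] show ?thesis by blast
qed

text \<open>In the exterior case the complement of the closed domain has to be connected: for a
  spherical shell, \<open>u\<close> may equal 1 in the hole and be radial outside, although the
  shell is not a ball.\<close>

theorem theorem1p9:
  fixes \<Omega> M :: "(real ^ 'n) set" and u :: "real ^ 'n \<Rightarrow> real" and a b c d :: real
  assumes dim: "CARD('n) \<ge> 3"
    and domain: "open \<Omega>" "connected \<Omega>" "bounded \<Omega>" "smooth_boundary \<Omega>" "0 \<in> \<Omega>"
    and problem:
      "(exterior_problem \<Omega> u \<and> connected (- closure \<Omega>) \<and> M = - \<Omega>) \<or>
       (d > 0 \<and> interior_problem d c \<Omega> u \<and> M = closure \<Omega> - {0})"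
    and pos: "\<forall>x\<in>M. u x > 0"
    and ab: "0 < a" "a < b"
    and regular: "regular_level_set M u a" "regular_level_set M u b"
    and curv_a: "\<forall>x \<in> level_set M u a.
      mean_curvature M u x / (real CARD('n) - 1) \<ge> norm (grad M u x) / ((real CARD('n) - 2) * u x)"
    and curv_b: "\<forall>x \<in> level_set M u b.
      mean_curvature M u x / (real CARD('n) - 1) \<le> norm (grad M u x) / ((real CARD('n) - 2) * u x)"
    and conn: "connected (level_set M u a) \<or> connected (level_set M u b)"
  shows "\<exists>x0 r. r > 0 \<and> \<Omega> = ball x0 r \<and>
           (\<forall>x\<in>M. \<forall>y\<in>M. dist x0 x = dist x0 y \<longrightarrow> u x = u y)"
proof -
  have D: "DIM(real ^ 'n) = CARD('n)" by simp
  have dim': "DIM(real ^ 'n) \<ge> 3" using dim by (simp only: D)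
  have ne: "\<exists>p\<in>M. u p = a" "\<exists>p\<in>M. u p = b"
    using regular unfolding regular_level_set_def level_set_def by auto
  have reg: "grad M u p \<noteq> 0" if "p \<in> M" "u p = a \<or> u p = b" for p
    using regular that unfolding regular_level_set_def level_set_def by auto
  have ca: "mean_curvature M u p / (real DIM(real ^ 'n) - 1) \<ge> norm (grad M u p) / ((real DIM(real ^ 'n) - 2) * u p)"
    if "p \<in> M" "u p = a" for p
    using curv_a that unfolding level_set_def D by blast
  have cb: "mean_curvature M u p / (real DIM(real ^ 'n) - 1) \<le> norm (grad M u p) / ((real DIM(real ^ 'n) - 2) * u p)"
    if "p \<in> M" "u p = b" for p
    using curv_b that unfolding level_set_def D by blast
  have p: "u x > 0" if "x \<in> M" for x using pos that by blast
  have ne\<Omega>: "\<Omega> \<noteq> {}" using domain(5) by blast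
  from problem show ?thesis
  proof (elim disjE conjE)
    assume e: "exterior_problem \<Omega> u" "connected (- closure \<Omega>)" and M: "M = - \<Omega>"
    show ?thesis unfolding M
      by (rule exterior_radial[OF domain(1,3,4) ne\<Omega> dim' e p[unfolded M] ab ne[unfolded M] reg[unfolded M]
          ca[unfolded M] cb[unfolded M]])
  next
    assume i: "interior_problem d c \<Omega> u" and M: "M = closure \<Omega> - {0}"
    show ?thesis by (rule interior_radial[OF domain dim' i M p ab(2) ne reg ca cb])
  qed
qed

end
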